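(* Let $r>0$ and $\mathbb{R}_+=(0,\infty)$. Let $X=\{x\in C^4[-r,r]\colon x'(-r)=x'''(-r)=0,\ x(r)=x''(r)=0\}$ with norm $\|x\|_X=\sum_{k=0}^4\max_{s\in[-r,r]}|x^{(k)}(s)|$, let $Y=C[-r,r]$ with the maximum norm, and let $F\colon X\times\mathbb{R}_+^3\to Y$ be given by $$F(x,\alpha,\beta,\gamma)=x^{(4)}+\alpha x''+\beta x-\gamma x^3-3(x'')^3-12x'x''x'''-3(x')^2\left(x^{(4)}-\frac{\alpha}{2}x''\right).$$ For $(\alpha,\beta)\in\mathbb{R}_+^2$ let $N(\alpha,\beta)=\{h\in X\colon h^{(4)}+\alpha h''+\beta h=0 \text{ on } [-r,r]\}$. Then for every $(\alpha_0,\beta_0,\gamma_0)\in\mathbb{R}_+^3$, the point $(0,\alpha_0,\beta_0,\gamma_0)$ is a branching point of the equation $F(x,\alpha,\beta,\gamma)=0$ if and only if $\dim N(\alpha_0,\beta_0)\neq 0$.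
   Context: For all $(\alpha,\beta,\gamma)\in\mathbb{R}_+^3$ one has $F(0,\alpha,\beta,\gamma)=0$. The trivial family of solutions is $\Gamma=\{(0,\alpha,\beta,\gamma)\colon \alpha,\beta,\gamma\in\mathbb{R}_+\}\subset X\times\mathbb{R}_+^3$. A solution $(x,\alpha,\beta,\gamma)\in X\times\mathbb{R}_+^3$ of $F(x,\alpha,\beta,\gamma)=0$ is called nontrivial if it does not belong to $\Gamma$. A point $(0,\alpha_0,\beta_0,\gamma_0)\in\Gamma$ is a bifurcation point of $F(x,\alpha,\beta,\gamma)=0$ if every neighbourhood of it in $X\times\mathbb{R}_+^3$ contains a nontrivial solution. A bifurcation point $(0,\alpha_0,\beta_0,\gamma_0)\in\Gamma$ is a branching point if there is a continuum of nontrivial solutions emanating from it, that is, a closed connected set $C\subset X\times\mathbb{R}_+^3$ such that $(0,\alpha_0,\beta_0,\gamma_0)\in C$, $C\neq\{(0,\alpha_0,\beta_0,\gamma_0)\}$, and every point of $C\setminus\{(0,\alpha_0,\beta_0,\gamma_0)\}$ is a nontrivial solution. *)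

theory Defs
  imports "HOL-Analysis.Analysis" "HOL-Library.Function_Algebras"
begin

text \<open>
  Pointwise real vector space structure on functions; it makes \<^const>\<open>subspace\<close>, \<^const>\<open>span\<close>
  and \<^const>\<open>dim\<close> available for sets of functions.
\<close>

instantiation "fun" :: (type, real_vector) real_vector
begin

definition scaleR_fun :: "real \<Rightarrow> ('a \<Rightarrow> 'b) \<Rightarrow> 'a \<Rightarrow> 'b" where
  "scaleR_fun c f = (\<lambda>s. c *\<^sub>R f s)"

instance
  by standard (simp_all add: scaleR_fun_def fun_eq_iff scaleR_add_right scaleR_add_left)

end

text \<open>
  A function on \<open>[-r, r]\<close> is represented by its extension by \<open>0\<close> to all of \<open>\<real>\<close>, so that equality of
  functions on \<open>[-r, r]\<close> is HOL equality and the function spaces are linear subspaces of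
  \<^typ>\<open>real \<Rightarrow> real\<close>. Derivatives are taken within \<open>[-r, r]\<close>, i.e. they are one-sided at the end points.
\<close>

definition ideriv :: "real \<Rightarrow> (real \<Rightarrow> real) \<Rightarrow> real \<Rightarrow> real" where
  "ideriv r f = (\<lambda>s. if s \<in> {-r..r} then vector_derivative f (at s within {-r..r}) else 0)"

abbreviation der :: "real \<Rightarrow> nat \<Rightarrow> (real \<Rightarrow> real) \<Rightarrow> real \<Rightarrow> real" where
  "der r k \<equiv> ideriv r ^^ k"

definition Ck :: "real \<Rightarrow> nat \<Rightarrow> (real \<Rightarrow> real) set" where
  "Ck r n = {x. (\<forall>s. s \<notin> {-r..r} \<longrightarrow> x s = 0) \<and>
                (\<forall>k<n. der r k x differentiable_on {-r..r}) \<and>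
                continuous_on {-r..r} (der r n x)}"

definition spaceX :: "real \<Rightarrow> (real \<Rightarrow> real) set" where
  "spaceX r = {x \<in> Ck r 4. der r 1 x (-r) = 0 \<and> der r 3 x (-r) = 0 \<and> x r = 0 \<and> der r 2 x r = 0}"

definition normX :: "real \<Rightarrow> (real \<Rightarrow> real) \<Rightarrow> real" where
  "normX r x = (\<Sum>k=0..4. SUP s\<in>{-r..r}. \<bar>der r k x s\<bar>)"

definition spaceY :: "real \<Rightarrow> (real \<Rightarrow> real) set" where
  "spaceY r = Ck r 0"

definition opF :: "real \<Rightarrow> (real \<Rightarrow> real) \<Rightarrow> real \<Rightarrow> real \<Rightarrow> real \<Rightarrow> (real \<Rightarrow> real)" where
  "opF r x \<alpha> \<beta> \<gamma> = (\<lambda>s.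
     der r 4 x s + \<alpha> * der r 2 x s + \<beta> * x s - \<gamma> * (x s)^3
     - 3 * (der r 2 x s)^3
     - 12 * der r 1 x s * der r 2 x s * der r 3 x s
     - 3 * (der r 1 x s)^2 * (der r 4 x s - \<alpha> / 2 * der r 2 x s))"

text \<open>
  \<^const>\<open>dim\<close> is \<open>0\<close> also for spaces without a finite basis; this does not interfere here, since the
  solution space of the fourth-order linear equation is at most four-dimensional.
\<close>

definition kernelN :: "real \<Rightarrow> real \<Rightarrow> real \<Rightarrow> (real \<Rightarrow> real) set" where
  "kernelN r \<alpha> \<beta> = {h \<in> spaceX r. \<forall>s\<in>{-r..r}. der r 4 h s + \<alpha> * der r 2 h s + \<beta> * h s = 0}"

type_synonym point = "(real \<Rightarrow> real) \<times> real \<times> real \<times> real"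

definition Rpos3 :: "(real \<times> real \<times> real) set" where
  "Rpos3 = {0<..} \<times> {0<..} \<times> {0<..}"

text \<open>
  \<^const>\<open>Metric_space\<close> requires nonnegativity and symmetry of the distance even outside the carrier,
  where the formula for \<^const>\<open>normX\<close> is meaningless; hence the case distinction.
\<close>

definition distX :: "real \<Rightarrow> (real \<Rightarrow> real) \<Rightarrow> (real \<Rightarrow> real) \<Rightarrow> real" where
  "distX r x y = (if x \<in> spaceX r \<and> y \<in> spaceX r then normX r (x - y) else 0)"

definition topX :: "real \<Rightarrow> (real \<Rightarrow> real) topology" where
  "topX r = Metric_space.mtopology (spaceX r) (distX r)"

definition top_total :: "real \<Rightarrow> point topology" where
  "top_total r = prod_topology (topX r) (top_of_set Rpos3)"

definition trivial_family :: "point set" where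
  "trivial_family = {0} \<times> Rpos3"

definition is_solution :: "real \<Rightarrow> point \<Rightarrow> bool" where
  "is_solution r = (\<lambda>(x, \<alpha>, \<beta>, \<gamma>). (x, \<alpha>, \<beta>, \<gamma>) \<in> spaceX r \<times> Rpos3 \<and> opF r x \<alpha> \<beta> \<gamma> = 0)"

definition nontrivial_solution :: "real \<Rightarrow> point \<Rightarrow> bool" where
  "nontrivial_solution r p \<longleftrightarrow> is_solution r p \<and> p \<notin> trivial_family"

definition bifurcation_point :: "real \<Rightarrow> point \<Rightarrow> bool" where
  "bifurcation_point r p \<longleftrightarrow> p \<in> trivial_family \<and>
     (\<forall>U. openin (top_total r) U \<and> p \<in> U \<longrightarrow> (\<exists>q\<in>U. nontrivial_solution r q))"

definition branching_point :: "real \<Rightarrow> point \<Rightarrow> bool" where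
  "branching_point r p \<longleftrightarrow> bifurcation_point r p \<and>
     (\<exists>C. closedin (top_total r) C \<and> connectedin (top_total r) C \<and>
          p \<in> C \<and> C \<noteq> {p} \<and> (\<forall>q \<in> C - {p}. nontrivial_solution r q))"


lemma ideriv_outside: "s \<notin> {-r..r} \<Longrightarrow> ideriv r f s = 0"
  unfolding ideriv_def by (rule if_not_P)

lemma der_outside:
  assumes "x \<in> Ck r n" "s \<notin> {-r..r}"
  shows "der r k x s = 0"
  using assms by (cases k) (auto simp: Ck_def ideriv_outside)

lemma has_derivative_ideriv:
  assumes "f differentiable_on {-r..r}" "s \<in> {-r..r}"
  shows "(f has_vector_derivative ideriv r f s) (at s within {-r..r})"
  using assms by (simp add: ideriv_def differentiable_on_def vector_derivative_works)

lemma ideriv_unique: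
  assumes "r > 0" "s \<in> {-r..r}" "(f has_vector_derivative d) (at s within {-r..r})"
  shows "ideriv r f s = d"
  using vector_derivative_within_closed_interval[of "-r" r s f d] assms by (simp add: ideriv_def)

lemma ideriv_add:
  assumes "r > 0" "f differentiable_on {-r..r}" "g differentiable_on {-r..r}"
  shows "ideriv r (f + g) = ideriv r f + ideriv r g"
proof
  fix s show "ideriv r (f + g) s = (ideriv r f + ideriv r g) s"
  proof (cases "s \<in> {-r..r}")
    case True
    then show ?thesis
      using assms by (auto intro!: ideriv_unique has_vector_derivative_add has_derivative_ideriv
          simp: plus_fun_def)
  qed (simp add: ideriv_outside)
qed

lemma ideriv_scaleR:
  assumes "r > 0" "f differentiable_on {-r..r}"
  shows "ideriv r (c *\<^sub>R f) = c *\<^sub>R ideriv r f"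
proof
  fix s show "ideriv r (c *\<^sub>R f) s = (c *\<^sub>R ideriv r f) s"
  proof (cases "s \<in> {-r..r}")
    case True
    have "((\<lambda>t. c *\<^sub>R f t) has_vector_derivative c *\<^sub>R ideriv r f s) (at s within {-r..r})"
      using has_derivative_ideriv[OF assms(2) True]
      by (metis bounded_linear.has_vector_derivative bounded_linear_scaleR_right)
    then show ?thesis
      using assms True by (auto intro!: ideriv_unique simp: scaleR_fun_def)
  qed (simp add: ideriv_outside scaleR_fun_def)
qed

lemma der_add:
  assumes "r > 0" "x \<in> Ck r n" "y \<in> Ck r n" "k \<le> n"
  shows "der r k (x + y) = der r k x + der r k y"
  using \<open>k \<le> n\<close>
proof (induction k)
  case (Suc k)
  then have "der r k x differentiable_on {-r..r}" "der r k y differentiable_on {-r..r}"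
    using assms by (auto simp: Ck_def)
  with Suc ideriv_add[OF assms(1) this] show ?case by (metis Suc_leD comp_apply funpow.simps(2))
qed simp

lemma der_scaleR:
  assumes "r > 0" "x \<in> Ck r n" "k \<le> n"
  shows "der r k (c *\<^sub>R x) = c *\<^sub>R der r k x"
  using \<open>k \<le> n\<close>
proof (induction k)
  case (Suc k)
  then have "der r k x differentiable_on {-r..r}"
    using assms by (auto simp: Ck_def)
  with Suc ideriv_scaleR[OF assms(1) this] show ?case by (metis Suc_leD comp_apply funpow.simps(2))
qed simp

lemma der_zero: "r > 0 \<Longrightarrow> der r k 0 = 0"
proof (induction k)
  case (Suc k)
  have "ideriv r 0 s = 0" for s
  proof (cases "s \<in> {-r..r}")
    case True
    then show ?thesis using Suc.prems by (auto intro!: ideriv_unique simp: zero_fun_def)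
  qed (simp add: ideriv_outside)
  then have "ideriv r 0 = 0" by (metis ext zero_fun_def)
  with Suc show ?case by (metis comp_apply funpow.simps(2))
qed simp

lemma subspace_Ck:
  assumes "r > 0" shows "subspace (Ck r n)"
proof (rule subspaceI)
  show "0 \<in> Ck r n"
    unfolding Ck_def using assms by (auto simp: der_zero) (simp_all add: zero_fun_def)
next
  fix x y assume xy: "x \<in> Ck r n" "y \<in> Ck r n"
  then show "x + y \<in> Ck r n"
    using der_add[OF assms xy]
    by (auto simp: Ck_def) (auto simp: plus_fun_def intro!: differentiable_on_add continuous_on_add)
next
  fix c x assume x: "x \<in> Ck r n"
  then show "c *\<^sub>R x \<in> Ck r n"
    using der_scaleR[OF assms x]
    by (auto simp: Ck_def)
       (auto simp: scaleR_fun_def intro!: derivative_intros continuous_intros)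
qed

lemma subspace_spaceX:
  assumes "r > 0" shows "subspace (spaceX r)"
proof (rule subspaceI)
  show "0 \<in> spaceX r"
    using subspace_0[OF subspace_Ck[OF assms]] der_zero[OF assms]
    by (simp add: spaceX_def del: funpow.simps One_nat_def)
next
  fix x y assume "x \<in> spaceX r" "y \<in> spaceX r"
  then show "x + y \<in> spaceX r"
    using subspace_add[OF subspace_Ck[OF assms]] der_add[OF assms, of x 4 y]
    by (simp add: spaceX_def del: funpow.simps One_nat_def)
next
  fix c x assume "x \<in> spaceX r"
  then show "c *\<^sub>R x \<in> spaceX r"
    using subspace_scale[OF subspace_Ck[OF assms]] der_scaleR[OF assms, of x 4]
    by (simp add: spaceX_def scaleR_fun_def del: funpow.simps One_nat_def)
qed

lemma subspace_kernelN:
  assumes "r > 0" shows "subspace (kernelN r \<alpha> \<beta>)"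
proof (rule subspaceI)
  show "0 \<in> kernelN r \<alpha> \<beta>"
    using subspace_0[OF subspace_spaceX[OF assms]] der_zero[OF assms]
    by (simp add: kernelN_def del: funpow.simps One_nat_def)
next
  fix x y assume xy: "x \<in> kernelN r \<alpha> \<beta>" "y \<in> kernelN r \<alpha> \<beta>"
  then have C: "x \<in> Ck r 4" "y \<in> Ck r 4" by (auto simp: kernelN_def spaceX_def)
  have "der r 4 (x + y) s + \<alpha> * der r 2 (x + y) s + \<beta> * (x + y) s =
      (der r 4 x s + \<alpha> * der r 2 x s + \<beta> * x s) + (der r 4 y s + \<alpha> * der r 2 y s + \<beta> * y s)" for s
    using der_add[OF assms C, of 4] der_add[OF assms C, of 2] by (simp add: algebra_simps)
  then show "x + y \<in> kernelN r \<alpha> \<beta>"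
    using xy subspace_add[OF subspace_spaceX[OF assms]] by (simp add: kernelN_def)
next
  fix c x assume x: "x \<in> kernelN r \<alpha> \<beta>"
  then have C: "x \<in> Ck r 4" by (auto simp: kernelN_def spaceX_def)
  have "der r 4 (c *\<^sub>R x) s + \<alpha> * der r 2 (c *\<^sub>R x) s + \<beta> * (c *\<^sub>R x) s =
      c * (der r 4 x s + \<alpha> * der r 2 x s + \<beta> * x s)" for s
    using der_scaleR[OF assms C, of 4] der_scaleR[OF assms C, of 2]
    by (simp add: scaleR_fun_def algebra_simps)
  then show "c *\<^sub>R x \<in> kernelN r \<alpha> \<beta>"
    using x subspace_scale[OF subspace_spaceX[OF assms]] by (simp add: kernelN_def)
qed

lemma der_continuous:
  assumes "x \<in> Ck r n" "k \<le> n"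
  shows "continuous_on {-r..r} (der r k x)"
  using assms by (cases "k = n") (auto simp: Ck_def intro: differentiable_imp_continuous_on)

lemma der_bdd_above:
  assumes "x \<in> Ck r n" "k \<le> n"
  shows "bdd_above ((\<lambda>s. \<bar>der r k x s\<bar>) ` {-r..r})"
  using der_continuous[OF assms]
  by (intro bounded_imp_bdd_above compact_imp_bounded compact_continuous_image continuous_intros)
     auto

text \<open>The suprema in \<^const>\<open>normX\<close> are maxima.\<close>

lemma der_sup_attained:
  assumes "r > 0" "x \<in> Ck r n" "k \<le> n"
  shows "\<exists>t\<in>{-r..r}. (SUP s\<in>{-r..r}. \<bar>der r k x s\<bar>) = \<bar>der r k x t\<bar>"
proof -
  have "continuous_on {-r..r} (\<lambda>s. \<bar>der r k x s\<bar>)"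
    using der_continuous[OF assms(2,3)] by (intro continuous_intros)
  then obtain t where t: "t \<in> {-r..r}" "\<forall>s\<in>{-r..r}. \<bar>der r k x s\<bar> \<le> \<bar>der r k x t\<bar>"
    using continuous_attains_sup[of "{-r..r}" "\<lambda>s. \<bar>der r k x s\<bar>"] \<open>r > 0\<close> by auto
  then have "(SUP s\<in>{-r..r}. \<bar>der r k x s\<bar>) = \<bar>der r k x t\<bar>"
    by (intro cSup_eq_maximum) auto
  then show ?thesis using t by blast
qed

lemma der_SUP_upper:
  assumes "x \<in> Ck r n" "k \<le> n" "s \<in> {-r..r}"
  shows "\<bar>der r k x s\<bar> \<le> (SUP s\<in>{-r..r}. \<bar>der r k x s\<bar>)"
  using assms by (intro cSUP_upper der_bdd_above)

lemma der_SUP_nonneg: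
  assumes "r > 0" "x \<in> Ck r n" "k \<le> n"
  shows "0 \<le> (SUP s\<in>{-r..r}. \<bar>der r k x s\<bar>)"
  using der_SUP_upper[OF assms(2,3), of 0] assms(1) by simp

lemma spaceX_Ck: "x \<in> spaceX r \<Longrightarrow> x \<in> Ck r 4"
  by (simp add: spaceX_def)

lemma normX_nonneg: "r > 0 \<Longrightarrow> x \<in> spaceX r \<Longrightarrow> 0 \<le> normX r x"
  unfolding normX_def by (intro sum_nonneg der_SUP_nonneg[where n = 4] spaceX_Ck) auto

lemma normX_eq_0_iff:
  assumes "r > 0" "x \<in> spaceX r"
  shows "normX r x = 0 \<longleftrightarrow> x = 0"
proof
  assume "normX r x = 0"
  then have "\<forall>k\<in>{0..4}. (SUP s\<in>{-r..r}. \<bar>der r k x s\<bar>) = 0"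
    using der_SUP_nonneg[OF assms(1) spaceX_Ck[OF assms(2)]]
    unfolding normX_def by (subst (asm) sum_nonneg_eq_0_iff) auto
  then have "(SUP s\<in>{-r..r}. \<bar>der r 0 x s\<bar>) = 0" by (meson atLeastAtMost_iff le0)
  then have "x s = 0" if "s \<in> {-r..r}" for s
    using der_SUP_upper[OF spaceX_Ck[OF assms(2)], of 0 s] that by simp
  moreover have "x s = 0" if "s \<notin> {-r..r}" for s
    using der_outside[OF spaceX_Ck[OF assms(2)] that, of 0] by simp
  ultimately show "x = 0" by (metis ext zero_fun_def)
next
  assume "x = 0"
  then show "normX r x = 0" using assms(1) by (simp add: normX_def der_zero)
qed

lemma normX_scaleR:
  assumes "r > 0" "x \<in> spaceX r"
  shows "normX r (c *\<^sub>R x) = \<bar>c\<bar> * normX r x"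
proof -
  have "(SUP s\<in>{-r..r}. \<bar>der r k (c *\<^sub>R x) s\<bar>) = \<bar>c\<bar> * (SUP s\<in>{-r..r}. \<bar>der r k x s\<bar>)"
    if k: "k \<le> 4" for k
  proof -
    note C = spaceX_Ck[OF assms(2)]
    obtain t where t: "t \<in> {-r..r}" "(SUP s\<in>{-r..r}. \<bar>der r k x s\<bar>) = \<bar>der r k x t\<bar>"
      using der_sup_attained[OF assms(1) C k] by blast
    have "(SUP s\<in>{-r..r}. \<bar>der r k (c *\<^sub>R x) s\<bar>) = \<bar>c\<bar> * \<bar>der r k x t\<bar>"
    proof (rule cSup_eq_maximum)
      show "\<bar>c\<bar> * \<bar>der r k x t\<bar> \<in> (\<lambda>s. \<bar>der r k (c *\<^sub>R x) s\<bar>) ` {-r..r}"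
        using t(1) der_scaleR[OF assms(1) C k] by (auto simp: scaleR_fun_def abs_mult intro!: image_eqI[of _ _ t])
    next
      fix z assume "z \<in> (\<lambda>s. \<bar>der r k (c *\<^sub>R x) s\<bar>) ` {-r..r}"
      then show "z \<le> \<bar>c\<bar> * \<bar>der r k x t\<bar>"
        using t(2) der_SUP_upper[OF C k] der_scaleR[OF assms(1) C k]
        by (auto simp: scaleR_fun_def abs_mult intro!: mult_left_mono)
    qed
    with t show ?thesis by simp
  qed
  then show ?thesis unfolding normX_def by (simp add: sum_distrib_left)
qed

lemma normX_triangle:
  assumes "r > 0" "x \<in> spaceX r" "y \<in> spaceX r"
  shows "normX r (x + y) \<le> normX r x + normX r y"
proof -
  note C = spaceX_Ck[OF assms(2)] spaceX_Ck[OF assms(3)]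
  have "(SUP s\<in>{-r..r}. \<bar>der r k (x + y) s\<bar>)
      \<le> (SUP s\<in>{-r..r}. \<bar>der r k x s\<bar>) + (SUP s\<in>{-r..r}. \<bar>der r k y s\<bar>)" if k: "k \<le> 4" for k
  proof (rule cSUP_least)
    show "{-r..r} \<noteq> {}" using assms(1) by simp
    fix s assume s: "s \<in> {-r..r}"
    have "\<bar>der r k (x + y) s\<bar> \<le> \<bar>der r k x s\<bar> + \<bar>der r k y s\<bar>"
      using der_add[OF assms(1) C k] by simp
    then show "\<bar>der r k (x + y) s\<bar>
        \<le> (SUP s\<in>{-r..r}. \<bar>der r k x s\<bar>) + (SUP s\<in>{-r..r}. \<bar>der r k y s\<bar>)"
      using der_SUP_upper[OF C(1) k s] der_SUP_upper[OF C(2) k s] by linarith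
  qed
  then show ?thesis unfolding normX_def sum.distrib[symmetric] by (intro sum_mono) auto
qed

lemma Metric_space_X:
  assumes "r > 0"
  shows "Metric_space (spaceX r) (distX r)"
proof
  note sub = subspace_spaceX[OF assms]
  have D: "x - y \<in> spaceX r" if "x \<in> spaceX r" "y \<in> spaceX r" for x y
    using that subspace_diff[OF sub] by blast
  fix x y z
  show "0 \<le> distX r x y"
    using normX_nonneg[OF assms D] by (simp add: distX_def)
  show "distX r x y = distX r y x"
    using normX_scaleR[OF assms D, of x y "-1"] by (simp add: distX_def)
  show "distX r x y = 0 \<longleftrightarrow> x = y" if "x \<in> spaceX r" "y \<in> spaceX r"
    using that normX_eq_0_iff[OF assms D[OF that]] by (simp add: distX_def)
  show "distX r x z \<le> distX r x y + distX r y z"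
    if "x \<in> spaceX r" "y \<in> spaceX r" "z \<in> spaceX r"
    using that normX_triangle[OF assms D[of x y] D[of y z]] by (simp add: distX_def)
qed

lemma topspace_top_total: "r > 0 \<Longrightarrow> topspace (top_total r) = spaceX r \<times> Rpos3"
  using Metric_space.topspace_mtopology[OF Metric_space_X]
  by (simp add: top_total_def topX_def)

lemma opF_in_spaceY:
  assumes "x \<in> spaceX r"
  shows "opF r x \<alpha> \<beta> \<gamma> \<in> spaceY r"
proof -
  note C = spaceX_Ck[OF assms]
  have "continuous_on {-r..r} (opF r x \<alpha> \<beta> \<gamma>)"
    using der_continuous[OF C, of 0] der_continuous[OF C, of 1] der_continuous[OF C, of 2]
      der_continuous[OF C, of 3] der_continuous[OF C, of 4]
    unfolding opF_def by (auto intro!: continuous_intros simp del: funpow.simps)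
  moreover have "opF r x \<alpha> \<beta> \<gamma> s = 0" if "s \<notin> {-r..r}" for s
    using der_outside[OF C that] der_outside[OF C that, of 0] by (simp add: opF_def del: funpow.simps One_nat_def)
  ultimately show ?thesis by (simp add: spaceY_def Ck_def)
qed

end

theory Submission
  imports Defs
begin

text \<open>
  The kernel is nonzero iff some \<open>m > 0\<close> satisfies \<open>cos (2rm) = 0\<close> and \<open>m^4 - \<alpha>m^2 + \<beta> = 0\<close>. If there
  is no such \<open>m\<close>, then the complex factorization \<open>(D^2 + p)(D^2 + q)\<close> of the linear part and
  variation of constants bound its inverse, which excludes small nontrivial solutions for nearby
  parameters.

  Otherwise take the largest such \<open>m\<close>, keep \<open>\<alpha>\<close> and \<open>\<gamma>\<close> fixed, and look for solutions
  \<open>x(s) = t y(m(s + r))\<close> with \<open>\<beta>\<close> depending on \<open>t\<close>, in the class of functions \<open>y\<close> with the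
  symmetries of \<open>cos\<close>. The nonlinearity preserves this class, whose elements contain only odd
  harmonics; since \<open>m\<close> is the largest mode, the kernel within the class is one-dimensional even when
  the full kernel is two-dimensional. A contraction argument for the fourth derivative of \<open>y\<close> then
  gives a Lipschitz curve of nontrivial solutions that emanates from the trivial one.
\<close>

section \<open>Antiderivatives with dihedral symmetry\<close>

text \<open>The equation is quasilinear: \<open>(x')^2\<close> multiplies the fourth derivative.
  With the fourth derivative as the unknown, all lower derivatives are bounded integral operators of
  it, no derivative is lost, and sup norms with Banach's theorem suffice. In the variable u = m(s +
  r) the left end is u = 0 and the right end is u = 2rm, some odd multiple of pi/2. The reflections
  at 0 and pi/2 encode the four boundary conditions whichever multiple it is, and they reduce every
  estimate to [0, pi/2], with operator norms independent of r and m. The parameter \<beta> is the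
  one that moves because the derivative of the linear part with respect to \<beta> sends cos to a
  multiple of cos, which is the direction missing from the range. Hence the solvability condition
  can be solved for \<beta> explicitly. Second-order factors are inverted one after the other,
  instead of using four fundamental solutions, because the characteristic roots may be nonreal or
  may coincide; successive inversion treats all cases alike.\<close>

text \<open>Choice of a primitive on the whole line, so that points on both sides of
  \<open>c\<close> are treated alike; for continuous \<open>f\<close> the choice is pinned down by
  \<open>antideriv_works\<close> and \<open>antideriv_unique\<close>.\<close>

definition antideriv :: "real \<Rightarrow> (real \<Rightarrow> real) \<Rightarrow> real \<Rightarrow> real" where
  "antideriv c f = (SOME F. F c = 0 \<and> (\<forall>u. (F has_real_derivative f u) (at u)))"

lemma zero_deriv_const:
  fixes d :: "real \<Rightarrow> real"
  assumes "\<And>u. (d has_real_derivative 0) (at u)"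
  shows "d u = d v"
  using DERIV_isconst_all assms by blast

lemma antideriv_works:
  assumes "continuous_on UNIV f"
  shows "antideriv c f c = 0" "(antideriv c f has_real_derivative f u) (at u)"
proof -
  have "isCont f x" for x
    using assms by (simp add: continuous_on_eq_continuous_at)
  then obtain F where F: "\<And>x. (F has_vector_derivative f x) (at x)"
    using einterval_antiderivative[of "-\<infinity>" "\<infinity>" f] by auto
  have "((\<lambda>u. F u - F c) has_real_derivative f u) (at u)" for u
    using F[of u] by (auto intro!: derivative_eq_intros simp: has_real_derivative_iff_has_vector_derivative)
  then have "\<exists>F. F c = 0 \<and> (\<forall>u. (F has_real_derivative f u) (at u))"
    by (intro exI[of _ "\<lambda>u. F u - F c"]) auto
  from someI_ex[OF this] show "antideriv c f c = 0" "(antideriv c f has_real_derivative f u) (at u)"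
    by (auto simp: antideriv_def)
qed

lemma has_deriv_all_continuous_on:
  fixes F :: "real \<Rightarrow> real"
  assumes "\<And>u. (F has_real_derivative f u) (at u)"
  shows "continuous_on A F"
  using assms DERIV_isCont continuous_at_imp_continuous_on by blast

lemma antideriv_cont [simp]: "continuous_on UNIV f \<Longrightarrow> continuous_on A (antideriv c f)"
  using has_deriv_all_continuous_on antideriv_works(2) by blast

lemma antideriv_unique:
  assumes "continuous_on UNIV f" "F c = 0" "\<And>u. (F has_real_derivative f u) (at u)"
  shows "antideriv c f = F"
proof
  fix u
  have "((\<lambda>u. antideriv c f u - F u) has_real_derivative 0) (at u)" for u
    using antideriv_works(2)[OF assms(1), of c u] assms(3)[of u] by (auto intro!: derivative_eq_intros)
  from zero_deriv_const[OF this, of u c] show "antideriv c f u = F u"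
    using antideriv_works(1)[OF assms(1)] assms(2) by simp
qed

lemma antideriv_lincomb:
  assumes "continuous_on UNIV f" "continuous_on UNIV g"
  shows "antideriv c (\<lambda>u. a * f u + b * g u) = (\<lambda>u. a * antideriv c f u + b * antideriv c g u)"
  using assms
  by (intro antideriv_unique) (auto intro!: continuous_intros derivative_eq_intros antideriv_works simp: antideriv_works)

lemma antideriv_bound:
  assumes "continuous_on UNIV f" "\<And>u. \<bar>f u\<bar> \<le> B"
  shows "\<bar>antideriv c f u\<bar> \<le> B * \<bar>u - c\<bar>"
  using field_differentiable_bound[of UNIV "antideriv c f" f B u c] assms antideriv_works[OF assms(1)] 
  by (auto simp: has_field_derivative_at_within)

text \<open>
  Symmetries of the odd cosine series \<open>cos u, cos 3u, cos 5u, ...\<close> and of the odd sine series. All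
  the boundary conditions of the problem follow from them.
\<close>

definition cos_sym :: "(real \<Rightarrow> real) \<Rightarrow> bool" where
  "cos_sym f \<longleftrightarrow> continuous_on UNIV f \<and> (\<forall>u. f (-u) = f u) \<and> (\<forall>u. f (pi - u) = - f u)"

definition sin_sym :: "(real \<Rightarrow> real) \<Rightarrow> bool" where
  "sin_sym f \<longleftrightarrow> continuous_on UNIV f \<and> (\<forall>u. f (-u) = - f u) \<and> (\<forall>u. f (pi - u) = f u)"

lemma cos_sym_cont: "cos_sym f \<Longrightarrow> continuous_on UNIV f" by (simp add: cos_sym_def)
lemma sin_sym_cont: "sin_sym f \<Longrightarrow> continuous_on UNIV f" by (simp add: sin_sym_def)

lemma cos_sym_half: "cos_sym f \<Longrightarrow> f (pi / 2) = 0"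
proof -
  assume "cos_sym f"
  then have "f (pi - pi / 2) = - f (pi / 2)" unfolding cos_sym_def by blast
  then show "f (pi / 2) = 0" by simp
qed

lemma sin_sym_0: "sin_sym f \<Longrightarrow> f 0 = 0"
proof -
  assume "sin_sym f"
  then have "f (- 0) = - f 0" unfolding sin_sym_def by blast
  then show "f 0 = 0" by simp
qed

lemma cos_sym_cos: "cos_sym cos"
  by (simp add: cos_sym_def continuous_on_cos)

lemma cos_sym_lincomb: "cos_sym f \<Longrightarrow> cos_sym g \<Longrightarrow> cos_sym (\<lambda>u. a * f u + b * g u)"
  by (auto simp: cos_sym_def intro!: continuous_intros)

text \<open>The two reflections compose to the translation by pi, and [0, pi/2] is a fundamental
  domain of the group they generate. The codomain is arbitrary so that several functions can be
  reduced to the same point at once.\<close>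

lemma reduce_dihedral:
  fixes h :: "real \<Rightarrow> 'a"
  assumes even: "\<And>u. h (-u) = h u" and refl: "\<And>u. h (pi - u) = h u"
  shows "\<exists>v\<in>{0..pi/2}. h u = h v"
proof -
  have per: "h (u + pi) = h u" for u
    using refl[of "-u"] even[of u] by (simp add: add.commute)
  have pern: "h (u + real n * pi) = h u" for u n
  proof (induction n)
    case (Suc n)
    have "h (u + real (Suc n) * pi) = h ((u + real n * pi) + pi)" by (simp add: algebra_simps)
    then show ?case using per Suc by simp
  qed simp
  define w where "w = \<bar>u\<bar>"
  have hw: "h u = h w" using even[of u] by (auto simp: w_def abs_if)
  define n where "n = nat \<lfloor>w / pi\<rfloor>"
  have "w / pi \<ge> 0" by (simp add: w_def)
  then have n: "real n \<le> w / pi" "w / pi < real n + 1"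
    unfolding n_def by linarith+
  define v where "v = w - real n * pi"
  have v: "0 \<le> v" "v \<le> pi" using n by (auto simp: v_def field_simps)
  have "h u = h v" using pern[of v n] hw by (simp add: v_def)
  moreover have "h v = h (pi - v)" using refl by simp
  ultimately show ?thesis using v
    by (cases "v \<le> pi/2") (force intro: bexI[of _ v], force intro: bexI[of _ "pi - v"])
qed

text \<open>The absolute value removes the signs in both symmetry types. This turns the linearly
  growing bound \<open>antideriv_bound\<close> into a uniform one.\<close>

lemma cos_sym_reduce_bound:
  assumes "cos_sym f \<or> sin_sym f" "\<And>u. u \<in> {0..pi/2} \<Longrightarrow> \<bar>f u\<bar> \<le> B"
  shows "\<bar>f u\<bar> \<le> B"
proof -
  have "\<exists>v\<in>{0..pi/2}. \<bar>f u\<bar> = \<bar>f v\<bar>"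
    by (rule reduce_dihedral[of "\<lambda>u. \<bar>f u\<bar>"]) (use assms(1) in \<open>auto simp: cos_sym_def sin_sym_def\<close>)
  with assms(2) show ?thesis by auto
qed

lemma cos_sym_bounded:
  assumes "cos_sym f"
  obtains B where "\<And>u. \<bar>f u\<bar> \<le> B"
proof -
  have "continuous_on {0..pi/2} f" using assms cos_sym_cont continuous_on_subset by blast
  then have "bounded (f ` {0..pi/2})" by (intro compact_imp_bounded compact_continuous_image) auto
  then obtain B where "\<And>u. u \<in> {0..pi/2} \<Longrightarrow> \<bar>f u\<bar> \<le> B" unfolding bounded_iff by fastforce
  with cos_sym_reduce_bound assms that show ?thesis by blast
qed

abbreviation "prim \<equiv> antideriv 0"
abbreviation "prim2 f \<equiv> antideriv (pi / 2) (prim f)"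

text \<open>
  \<open>g = prim2 f\<close> solves \<open>g'' = f\<close>, \<open>g'(0) = 0\<close>, \<open>g(pi/2) = 0\<close>, so \<open>prim2\<close> multiplies \<open>cos (nu)\<close> by
  \<open>-1/n^2\<close> for odd \<open>n\<close>.
\<close>

lemma sin_sym_prim:
  assumes "cos_sym f" shows "sin_sym (prim f)"
proof -
  note c = cos_sym_cont[OF assms]
  note d = antideriv_works(2)[OF c, of 0]
  note d' = DERIV_chain2[OF d]
  have 1: "prim f (-u) = - prim f u" for u
  proof -
    have "((\<lambda>u. prim f (-u) + prim f u) has_real_derivative 0) (at u)" for u
      using assms by (auto intro!: derivative_eq_intros d d' simp: cos_sym_def)
    from zero_deriv_const[OF this, of u 0] show ?thesis using antideriv_works(1)[OF c] by simp
  qed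
  have 2: "prim f (pi - u) = prim f u" for u
  proof -
    have "((\<lambda>u. prim f (pi - u) - prim f u) has_real_derivative 0) (at u)" for u
      using assms by (auto intro!: derivative_eq_intros d d' simp: cos_sym_def)
    from zero_deriv_const[OF this, of u "pi/2"] show ?thesis by simp
  qed
  show ?thesis using 1 2 c by (simp add: sin_sym_def)
qed

text \<open>As in \<open>sin_sym_prim\<close>, the defect of each symmetry has derivative zero and
  is evaluated at the fixed point of the reflection, 0 or pi/2. An even defect vanishes there by
  itself; an odd one vanishes because the base point of the antiderivative is that fixed
  point.\<close>

lemma cos_sym_antideriv:
  assumes "sin_sym f" shows "cos_sym (antideriv (pi / 2) f)"
proof -
  note c = sin_sym_cont[OF assms]
  note d = antideriv_works(2)[OF c, of "pi/2"]
  note d' = DERIV_chain2[OF d]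
  have 1: "antideriv (pi / 2) f (-u) = antideriv (pi / 2) f u" for u
  proof -
    have "((\<lambda>u. antideriv (pi / 2) f (-u) - antideriv (pi / 2) f u) has_real_derivative 0) (at u)" for u
      using assms by (auto intro!: derivative_eq_intros d d' simp: sin_sym_def)
    from zero_deriv_const[OF this, of u 0] show ?thesis by simp
  qed
  have 2: "antideriv (pi / 2) f (pi - u) = - antideriv (pi / 2) f u" for u
  proof -
    have "((\<lambda>u. antideriv (pi / 2) f (pi - u) + antideriv (pi / 2) f u) has_real_derivative 0) (at u)" for u
      using assms by (auto intro!: derivative_eq_intros d d' simp: sin_sym_def)
    from zero_deriv_const[OF this, of u "pi/2"] show ?thesis using antideriv_works(1)[OF c, of "pi/2"] by simp
  qed
  show ?thesis using 1 2 c by (simp add: cos_sym_def)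
qed

lemma cos_sym_prim2: "cos_sym f \<Longrightarrow> cos_sym (prim2 f)"
  by (intro cos_sym_antideriv sin_sym_prim)

text \<open>Rounding pi/2 up to 2 gives \<open>prim\<close>, \<open>prim2\<close> and the iterated
  \<open>prim2\<close> the integer norm bounds 2, 4 and 16.\<close>

lemma pi_half_le_2: "pi / 2 \<le> 2"
  using pi_less_4 by simp

lemma bound_nonneg:
  fixes f :: "'a \<Rightarrow> real"
  assumes "\<And>u. \<bar>f u\<bar> \<le> B" shows "0 \<le> B"
  using assms[of undefined] by linarith

lemma prim_bound:
  assumes "cos_sym f" "\<And>u. \<bar>f u\<bar> \<le> B" shows "\<bar>prim f u\<bar> \<le> 2 * B"
proof (rule cos_sym_reduce_bound[of "prim f"])
  fix u assume u: "u \<in> {0..pi/2}"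
  have "\<bar>prim f u\<bar> \<le> B * \<bar>u - 0\<bar>" by (rule antideriv_bound[OF cos_sym_cont[OF assms(1)] assms(2)])
  also have "\<dots> \<le> B * 2" using u pi_half_le_2 bound_nonneg[of f, OF assms(2)] by (intro mult_left_mono) auto
  finally show "\<bar>prim f u\<bar> \<le> 2 * B" by simp
qed (use assms sin_sym_prim in auto)

lemma antideriv_half_pi_bound:
  assumes "sin_sym f" "\<And>u. \<bar>f u\<bar> \<le> B" shows "\<bar>antideriv (pi/2) f u\<bar> \<le> 2 * B"
proof (rule cos_sym_reduce_bound[of "antideriv (pi/2) f"])
  fix u assume u: "u \<in> {0..pi/2}"
  have "\<bar>antideriv (pi/2) f u\<bar> \<le> B * \<bar>u - pi/2\<bar>" by (rule antideriv_bound[OF sin_sym_cont[OF assms(1)] assms(2)])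
  also have "\<dots> \<le> B * 2" using u pi_half_le_2 bound_nonneg[of f, OF assms(2)] by (intro mult_left_mono) auto
  finally show "\<bar>antideriv (pi/2) f u\<bar> \<le> 2 * B" by simp
qed (use assms cos_sym_antideriv in auto)

lemma prim2_bound: "cos_sym f \<Longrightarrow> (\<And>u. \<bar>f u\<bar> \<le> B) \<Longrightarrow> \<bar>prim2 f u\<bar> \<le> 4 * B"
  using antideriv_half_pi_bound[OF sin_sym_prim, of f "2*B"] prim_bound[of f B] by simp

lemma prim2_lincomb:
  assumes "cos_sym f" "cos_sym g"
  shows "prim2 (\<lambda>u. a * f u + b * g u) = (\<lambda>u. a * prim2 f u + b * prim2 g u)"
  using assms by (simp add: antideriv_lincomb cos_sym_cont)

lemma prim_lincomb:
  assumes "cos_sym f" "cos_sym g"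
  shows "prim (\<lambda>u. a * f u + b * g u) = (\<lambda>u. a * prim f u + b * prim g u)"
  using assms by (simp add: antideriv_lincomb cos_sym_cont)

lemma prim2_cos: "prim2 cos = (\<lambda>u. - cos u)"
proof -
  have "prim cos = sin" by (rule antideriv_unique) (auto intro!: derivative_eq_intros continuous_intros)
  then show ?thesis 
    by (simp) (rule antideriv_unique, auto intro!: derivative_eq_intros continuous_intros)
qed

lemma prim2_deriv:
  assumes "cos_sym f"
  shows "(prim2 f has_real_derivative prim f u) (at u)" "(prim f has_real_derivative f u) (at u)"
  using assms antideriv_works(2) cos_sym_cont by auto

lemma prim2_unique:
  assumes "cos_sym f" "\<And>u. (g has_real_derivative g1 u) (at u)" "\<And>u. (g1 has_real_derivative f u) (at u)"
    "g1 0 = 0" "g (pi/2) = 0"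
  shows "prim2 f = g"
proof -
  have "prim f = g1" by (rule antideriv_unique) (use assms cos_sym_cont in auto)
  moreover have "continuous_on UNIV g1"
    by (rule has_deriv_all_continuous_on) (rule assms(3))
  ultimately show ?thesis using antideriv_unique[of g1 g "pi/2"] assms(2,5) by simp
qed

text \<open>
  The Fourier coefficient at \<open>cos u\<close>.
\<close>

definition cos_coeff :: "(real \<Rightarrow> real) \<Rightarrow> real" where
  "cos_coeff f = 4 / pi * prim (\<lambda>u. f u * cos u) (pi / 2)"

lemma cos_coeff_lincomb:
  assumes "cos_sym f" "cos_sym g"
  shows "cos_coeff (\<lambda>u. a * f u + b * g u) = a * cos_coeff f + b * cos_coeff g"
proof -
  have "(\<lambda>u. (a * f u + b * g u) * cos u) = (\<lambda>u. a * (f u * cos u) + b * (g u * cos u))"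
    by (auto simp: algebra_simps)
  then show ?thesis using assms
    by (simp add: cos_coeff_def antideriv_lincomb cos_sym_cont continuous_on_mult continuous_on_cos algebra_simps)
qed

lemma cos_coeff_bound:
  assumes "cos_sym f" "\<And>u. \<bar>f u\<bar> \<le> B" shows "\<bar>cos_coeff f\<bar> \<le> 2 * B"
proof -
  have "\<bar>prim (\<lambda>u. f u * cos u) (pi/2)\<bar> \<le> B * \<bar>pi/2 - 0\<bar>"
  proof (rule antideriv_bound)
    show "\<bar>f u * cos u\<bar> \<le> B" for u
      using assms(2)[of u] mult_mono[of "\<bar>f u\<bar>" B "\<bar>cos u\<bar>" 1] by (auto simp: abs_mult)
  qed (use assms cos_sym_cont in \<open>auto intro!: continuous_intros\<close>)
  then show ?thesis by (simp add: cos_coeff_def abs_mult field_simps)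
qed

lemma cos_coeff_cos: "cos_coeff cos = 1"
proof -
  have "prim (\<lambda>u. cos u * cos u) = (\<lambda>u. (u + sin u * cos u) / 2)"
  proof (rule antideriv_unique)
    fix u :: real
    have "((\<lambda>u. (u + sin u * cos u) / 2) has_real_derivative (1 + (cos u * cos u - sin u * sin u)) / 2) (at u)"
      by (auto intro!: derivative_eq_intros)
    moreover have "(1 + (cos u * cos u - sin u * sin u)) / 2 = cos u * cos u"
      using sin_cos_squared_add[of u] by (simp add: power2_eq_square)
    ultimately show "((\<lambda>u. (u + sin u * cos u) / 2) has_real_derivative cos u * cos u) (at u)" by simp
  qed (auto intro!: continuous_intros)
  then show ?thesis by (simp add: cos_coeff_def)
qed

text \<open>Green's formula: with g = \<open>prim2 f\<close>, the derivative of g' cos + g sin is (f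
  + g) cos. The boundary terms vanish since g'(0) = 0 and g(pi/2) = 0.\<close>

lemma cos_coeff_prim2:
  assumes "cos_sym f" shows "cos_coeff (prim2 f) = - cos_coeff f"
proof -
  note c = cos_sym_cont[OF assms] cos_sym_cont[OF cos_sym_prim2[OF assms]]
  have "prim (\<lambda>u. 1 * (prim2 f u * cos u) + 1 * (f u * cos u)) = (\<lambda>u. prim f u * cos u + prim2 f u * sin u)"
    by (rule antideriv_unique) (use c prim2_deriv[OF assms] in \<open>auto intro!: continuous_intros derivative_eq_intros simp: antideriv_works(1)\<close>)
  moreover have "prim (\<lambda>u. 1 * (prim2 f u * cos u) + 1 * (f u * cos u)) =
      (\<lambda>u. 1 * prim (\<lambda>u. prim2 f u * cos u) u + 1 * prim (\<lambda>u. f u * cos u) u)"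
    by (rule antideriv_lincomb) (use c in \<open>auto intro!: continuous_intros\<close>)
  ultimately have "prim (\<lambda>u. prim2 f u * cos u) (pi/2) + prim (\<lambda>u. f u * cos u) (pi/2) = prim2 f (pi/2)"
    by (auto simp: fun_eq_iff dest!: spec[of _ "pi/2"])
  also have "\<dots> = 0" using cos_sym_half[OF cos_sym_prim2[OF assms]] by simp
  finally have "prim (\<lambda>u. prim2 f u * cos u) (pi/2) = - prim (\<lambda>u. f u * cos u) (pi/2)" by simp
  then show ?thesis by (simp add: cos_coeff_def)
qed

section \<open>Forced oscillators\<close>

lemma vector_mvt_bound:
  fixes f :: "real \<Rightarrow> 'a::real_normed_vector"
  assumes "\<And>t. t \<in> {a..b} \<Longrightarrow> (f has_vector_derivative f' t) (at t within {a..b})"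
    "\<And>t. t \<in> {a..b} \<Longrightarrow> norm (f' t) \<le> B" "s \<in> {a..b}"
  shows "norm (f s - f a) \<le> B * (b - a)"
proof -
  have ab: "a \<in> {a..b}" using assms(3) by simp
  have B: "0 \<le> B" using assms(2)[OF ab] norm_ge_zero order_trans by blast
  have "norm (f s - f a) \<le> B * norm (s - a)"
  proof (rule differentiable_bound[of "{a..b}" f "\<lambda>t h. h *\<^sub>R f' t"])
    show "(f has_derivative (\<lambda>h. h *\<^sub>R f' t)) (at t within {a..b})" if "t \<in> {a..b}" for t
      using assms(1)[OF that] by (simp add: has_vector_derivative_def)
    show "onorm (\<lambda>h. h *\<^sub>R f' t) \<le> B" if "t \<in> {a..b}" for t
      using assms(2)[OF that] by (intro onorm_le) (auto simp: mult.commute[of B] intro: mult_left_mono)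
  qed (use assms ab in auto)
  also have "\<dots> \<le> B * (b - a)" using B assms(3) by (intro mult_left_mono) auto
  finally show ?thesis .
qed

text \<open>The equation f'' + w^2 f = e as a first-order system with \<open>f1\<close> = f', a
  Neumann condition at the left end and forcing bounded by \<open>B\<close>. The frequency is
  complex because the characteristic roots may be nonreal.\<close>

definition forced_oscillator ::
    "real \<Rightarrow> real \<Rightarrow> complex \<Rightarrow> (real \<Rightarrow> complex) \<Rightarrow> (real \<Rightarrow> complex) \<Rightarrow> (real \<Rightarrow> complex) \<Rightarrow> real \<Rightarrow> bool" where
  "forced_oscillator a b w f f1 e B \<longleftrightarrow> f1 a = 0 \<and>
     (\<forall>s\<in>{a..b}. (f has_vector_derivative f1 s) (at s within {a..b}) \<and>
        (f1 has_vector_derivative e s - w\<^sup>2 * f s) (at s within {a..b}) \<and> norm (e s) \<le> B)"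

text \<open>Variation of constants without division by \<open>w\<close>, which is why
  \<open>w * f\<close> is estimated. The free motion with initial value \<open>f a\<close> is
  subtracted; what remains is linear in the forcing.\<close>

lemma forced_oscillator_bound:
  fixes w :: complex and a b :: real
  assumes "a \<le> b"
  shows "\<exists>C\<ge>0. \<forall>f f1 e B. forced_oscillator a b w f f1 e B \<longrightarrow>
      (\<forall>s\<in>{a..b}. norm (w * f s - w * f a * cos (w * of_real (s - a))) \<le> C * B \<and>
                  norm (f1 s + w * f a * sin (w * of_real (s - a))) \<le> C * B)"
proof -
  define cs where "cs = (\<lambda>s. cos (w * of_real (s - a)))"
  define sn where "sn = (\<lambda>s. sin (w * of_real (s - a)))"
  have dcs: "(cs has_vector_derivative - (w * sn s)) (at s within S)" for s S
  proof -
    have "((\<lambda>z. cos (w * (z - of_real a))) has_field_derivative - (w * sn s)) (at (of_real s))"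
      by (auto intro!: derivative_eq_intros simp: sn_def)
    from has_vector_derivative_real_field[OF this, of S] show ?thesis by (simp add: cs_def)
  qed
  have dsn: "(sn has_vector_derivative w * cs s) (at s within S)" for s S
  proof -
    have "((\<lambda>z. sin (w * (z - of_real a))) has_field_derivative w * cs s) (at (of_real s))"
      by (auto intro!: derivative_eq_intros simp: cs_def)
    from has_vector_derivative_real_field[OF this, of S] show ?thesis by (simp add: sn_def)
  qed
  have cont: "continuous_on {a..b} cs" "continuous_on {a..b} sn"
    by (auto simp: cs_def sn_def intro!: continuous_intros)
  have "bounded (cs ` {a..b})" "bounded (sn ` {a..b})"
    using cont by (auto intro!: compact_imp_bounded compact_continuous_image)
  then obtain m1 m2 where m12: "\<And>s. s \<in> {a..b} \<Longrightarrow> norm (cs s) \<le> m1" "\<And>s. s \<in> {a..b} \<Longrightarrow> norm (sn s) \<le> m2"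
    unfolding bounded_iff by fastforce
  define m where "m = max 0 (max m1 m2)"
  have m: "m \<ge> 0" "\<And>s. s \<in> {a..b} \<Longrightarrow> norm (cs s) \<le> m" "\<And>s. s \<in> {a..b} \<Longrightarrow> norm (sn s) \<le> m"
    using m12 by (force simp: m_def)+
  have pyth: "cs s * cs s + sn s * sn s = 1" for s
    using sin_cos_squared_add3[of "w * of_real (s - a)"] by (simp add: cs_def sn_def)
  \<comment> \<open>Each rotated coordinate changes by at most B m (b - a); rotating back costs
    another factor m, and two such terms are added.\<close>
  define C where "C = 2 * m * m * (b - a)"
  show ?thesis
  proof (intro exI[of _ C] conjI allI impI ballI)
    show "C \<ge> 0" using m(1) assms by (simp add: C_def)
  next
    fix f f1 e B s
    assume osc: "forced_oscillator a b w f f1 e B" and s: "s \<in> {a..b}"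
    from osc have df: "\<forall>s\<in>{a..b}. (f has_vector_derivative f1 s) (at s within {a..b})"
      and df1: "\<forall>s\<in>{a..b}. (f1 has_vector_derivative e s - w\<^sup>2 * f s) (at s within {a..b})"
      and f1a: "f1 a = 0" and e: "\<forall>s\<in>{a..b}. norm (e s) \<le> B"
      by (simp_all add: forced_oscillator_def)
    \<comment> \<open>Rotating the phase vector (w f, f') backwards along the free motion cancels
      the oscillator, so that u' = - e sin and v' = e cos contain only the forcing.\<close>
    define u where "u = (\<lambda>s. w * f s * cs s - f1 s * sn s)"
    define v where "v = (\<lambda>s. w * f s * sn s + f1 s * cs s)"
    have B: "B \<ge> 0" using e s norm_ge_zero order_trans by blast
    have du: "(u has_vector_derivative - (e t * sn t)) (at t within {a..b})" if "t \<in> {a..b}" for t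
      unfolding u_def using that df df1
      by (auto intro!: derivative_eq_intros dcs dsn simp: algebra_simps power2_eq_square)
    have dv: "(v has_vector_derivative e t * cs t) (at t within {a..b})" if "t \<in> {a..b}" for t
      unfolding v_def using that df df1
      by (auto intro!: derivative_eq_intros dcs dsn simp: algebra_simps power2_eq_square)
    have b1: "norm (- (e t * sn t)) \<le> B * m" "norm (e t * cs t) \<le> B * m" if "t \<in> {a..b}" for t
      using that e m B by (auto simp: norm_mult intro!: mult_mono)
    have u: "norm (u s - u a) \<le> B * m * (b - a)"
      by (rule vector_mvt_bound[OF du b1(1) s])
    have "norm (v s - v a) \<le> B * m * (b - a)"
      by (rule vector_mvt_bound[OF dv b1(2) s])
    then have v: "norm (v s) \<le> B * m * (b - a)" by (simp add: v_def sn_def f1a)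
    have ua: "u a = w * f a" by (simp add: u_def cs_def sn_def)
    have mm: "norm (u s - u a) * norm (cs s) \<le> B * m * (b - a) * m" "norm (u s - u a) * norm (sn s) \<le> B * m * (b - a) * m"
      "norm (v s) * norm (cs s) \<le> B * m * (b - a) * m" "norm (v s) * norm (sn s) \<le> B * m * (b - a) * m"
      using u v m(2,3)[OF s] B m(1) assms by (auto intro!: mult_mono)
    have CB: "C * B = B * m * (b - a) * m + B * m * (b - a) * m" by (simp add: C_def)
    have "w * f s = u s * cs s + v s * sn s"
      using pyth[of s] unfolding u_def v_def by algebra
    then have eq: "w * f s - w * f a * cs s = (u s - u a) * cs s + v s * sn s"
      by (simp add: ua algebra_simps)
    have 1: "norm (w * f s - w * f a * cs s) \<le> C * B"
      using mm(1,4) norm_triangle_ineq[of "(u s - u a) * cs s" "v s * sn s"]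
      unfolding eq norm_mult CB by linarith
    have "f1 s = v s * cs s - u s * sn s"
      using pyth[of s] unfolding u_def v_def by algebra
    then have eq: "f1 s + w * f a * sn s = v s * cs s - (u s - u a) * sn s"
      by (simp add: ua algebra_simps)
    have 2: "norm (f1 s + w * f a * sn s) \<le> C * B"
      using mm(2,3) norm_triangle_ineq4[of "v s * cs s" "(u s - u a) * sn s"]
      unfolding eq norm_mult CB by linarith
    show "norm (w * f s - w * f a * cos (w * of_real (s - a))) \<le> C * B"
      "norm (f1 s + w * f a * sin (w * of_real (s - a))) \<le> C * B"
      using 1 2 by (simp_all add: cs_def sn_def)
  qed
qed

text \<open>At s = b the condition \<open>f b = 0\<close> turns the previous estimate into a bound
  for \<open>w * f a\<close> times cos(w(b - a)). Off resonance this controls the initial value, and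
  with it the whole solution.\<close>

lemma forced_oscillator_bound_nonresonant:
  fixes w :: complex and a b :: real
  assumes "a \<le> b" "w \<noteq> 0" "cos (w * of_real (b - a)) \<noteq> 0"
  shows "\<exists>C\<ge>0. \<forall>f f1 e B. forced_oscillator a b w f f1 e B \<longrightarrow> f b = 0 \<longrightarrow>
      (\<forall>s\<in>{a..b}. norm (f s) \<le> C * B \<and> norm (f1 s) \<le> C * B)"
proof -
  obtain C where C: "C \<ge> 0" and est: "\<And>f f1 e B s. forced_oscillator a b w f f1 e B \<Longrightarrow> s \<in> {a..b} \<Longrightarrow>
      norm (w * f s - w * f a * cos (w * of_real (s - a))) \<le> C * B \<and>
      norm (f1 s + w * f a * sin (w * of_real (s - a))) \<le> C * B"
    using forced_oscillator_bound[OF assms(1), of w] by blast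
  have cont: "continuous_on {a..b} (\<lambda>s. cos (w * of_real (s - a)))" "continuous_on {a..b} (\<lambda>s. sin (w * of_real (s - a)))"
    by (auto intro!: continuous_intros)
  have "bounded ((\<lambda>s. cos (w * of_real (s - a))) ` {a..b})" "bounded ((\<lambda>s. sin (w * of_real (s - a))) ` {a..b})"
    using cont by (auto intro!: compact_imp_bounded compact_continuous_image)
  then obtain m1 m2 where m12: "\<And>s. s \<in> {a..b} \<Longrightarrow> norm (cos (w * of_real (s - a))) \<le> m1"
      "\<And>s. s \<in> {a..b} \<Longrightarrow> norm (sin (w * of_real (s - a))) \<le> m2"
    unfolding bounded_iff by fastforce
  define m where "m = max 0 (max m1 m2)"
  have m: "m \<ge> 0" "\<And>s. s \<in> {a..b} \<Longrightarrow> norm (cos (w * of_real (s - a))) \<le> m"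
      "\<And>s. s \<in> {a..b} \<Longrightarrow> norm (sin (w * of_real (s - a))) \<le> m"
    using m12 by (force simp: m_def)+
  define k where "k = norm (cos (w * of_real (b - a)))"
  have k: "k > 0" using assms by (simp add: k_def)
  define D where "D = C / k * m + C"
  have D: "D \<ge> 0" using C k m by (simp add: D_def)
  have nw: "norm w > 0" using assms(2) by simp
  show ?thesis
  proof (intro exI[of _ "D / norm w + D"] conjI allI impI ballI)
    show "0 \<le> D / norm w + D" using D nw by simp
  next
    fix f f1 e B s
    assume osc: "forced_oscillator a b w f f1 e B" and fb: "f b = 0" and s: "s \<in> {a..b}"
    then have e: "\<forall>s\<in>{a..b}. norm (e s) \<le> B" by (simp add: forced_oscillator_def)
    note E = est[OF osc]
    have B: "B \<ge> 0" using e s norm_ge_zero order_trans by blast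
    have "norm (w * f a) * k \<le> C * B"
      using E[of b] assms(1) fb by (simp add: k_def norm_mult)
    then have A: "norm (w * f a) \<le> C / k * B" using k by (simp add: field_simps)
    have "norm (w * f s) \<le> norm (w * f s - w * f a * cos (w * of_real (s - a))) + norm (w * f a) * norm (cos (w * of_real (s - a)))"
      using norm_triangle_sub[of "w * f s" "w * f a * cos (w * of_real (s - a))"]
      by (simp only: norm_mult add.commute)
    also have "\<dots> \<le> C * B + C / k * B * m"
      using E[OF s] A m s C k B by (intro add_mono mult_mono) auto
    also have "\<dots> = D * B" by (simp add: D_def algebra_simps)
    finally have 1: "norm (f s) \<le> D / norm w * B" using nw by (simp add: norm_mult field_simps)
    have "norm (f1 s) \<le> norm (f1 s + w * f a * sin (w * of_real (s - a))) + norm (w * f a) * norm (sin (w * of_real (s - a)))"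
      using norm_triangle_ineq4[of "f1 s + w * f a * sin (w * of_real (s - a))" "w * f a * sin (w * of_real (s - a))"]
      by (simp add: norm_mult)
    also have "\<dots> \<le> C * B + C / k * B * m"
      using E[OF s] A m s C k B by (intro add_mono mult_mono) auto
    also have "\<dots> = D * B" by (simp add: D_def algebra_simps)
    finally have 2: "norm (f1 s) \<le> D * B" .
    have "D / norm w * B \<ge> 0" "D * B \<ge> 0" using B D nw by auto
    then have "D / norm w * B \<le> (D / norm w + D) * B" "D * B \<le> (D / norm w + D) * B"
      unfolding distrib_right by linarith+
    with 1 2 show "norm (f s) \<le> (D / norm w + D) * B" "norm (f1 s) \<le> (D / norm w + D) * B"
      by (blast intro: order_trans)+
  qed
qed

section \<open>Solving the linear problem on symmetric functions\<close>

text \<open>Conservation of the energy d'^2 + q d^2.\<close>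

lemma oscillator_unique:
  fixes d d' :: "real \<Rightarrow> real"
  assumes "q > 0" "\<And>u. (d has_real_derivative d' u) (at u)"
    "\<And>u. (d' has_real_derivative - q * d u) (at u)" "d c = 0" "d' c = 0"
  shows "d u = 0"
proof -
  have "((\<lambda>u. (d' u)\<^sup>2 + q * (d u)\<^sup>2) has_real_derivative 0) (at u)" for u
    by (rule derivative_eq_intros assms refl | simp)+
  from zero_deriv_const[OF this, of u c] have "(d' u)\<^sup>2 + q * (d u)\<^sup>2 = 0" using assms by simp
  moreover have "q * (d u)\<^sup>2 \<ge> 0" using assms(1) by simp
  ultimately have "q * (d u)\<^sup>2 = 0" using zero_le_power2[of "d' u"] by linarith
  then show ?thesis using assms(1) by simp
qed

text \<open>Each symmetry defect of \<open>g\<close> solves the homogeneous equation, since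
  \<open>f\<close> has the symmetry. Its Cauchy data vanish at the fixed point of the reflection:
  g'(0) = 0 settles evenness, g(pi/2) = 0 the antisymmetry about pi/2.\<close>

lemma cos_sym_of_ode:
  assumes "q > 0" "cos_sym f" and g: "\<And>u. (g has_real_derivative g1 u) (at u)"
    and g1: "\<And>u. (g1 has_real_derivative f u - q * g u) (at u)" and "g1 0 = 0" "g (pi/2) = 0"
  shows "cos_sym g"
proof -
  note g' = DERIV_chain2[OF g] DERIV_chain2[OF g1]
  have 1: "g (-u) = g u" for u
  proof -
    have "g (-u) - g u = 0"
    proof (rule oscillator_unique[where d = "\<lambda>u. g (-u) - g u" and d' = "\<lambda>u. - g1 (-u) - g1 u" and c = 0, OF assms(1)])
      fix u show "((\<lambda>u. g (-u) - g u) has_real_derivative - g1 (-u) - g1 u) (at u)"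
        by (auto intro!: derivative_eq_intros g g')
      show "((\<lambda>u. - g1 (-u) - g1 u) has_real_derivative - q * (g (-u) - g u)) (at u)"
        using assms(2) by (auto intro!: derivative_eq_intros g1 g' simp: cos_sym_def algebra_simps)
    qed (use assms in auto)
    then show ?thesis by simp
  qed
  have 2: "g (pi - u) = - g u" for u
  proof -
    have "g (pi - u) + g u = 0"
    proof (rule oscillator_unique[where d = "\<lambda>u. g (pi-u) + g u" and d' = "\<lambda>u. - g1 (pi-u) + g1 u" and c = "pi/2", OF assms(1)])
      fix u show "((\<lambda>u. g (pi-u) + g u) has_real_derivative - g1 (pi-u) + g1 u) (at u)"
        by (auto intro!: derivative_eq_intros g g')
      show "((\<lambda>u. - g1 (pi-u) + g1 u) has_real_derivative - q * (g (pi-u) + g u)) (at u)"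
        using assms(2) by (auto intro!: derivative_eq_intros g1 g' simp: cos_sym_def algebra_simps)
    qed (use assms in auto)
    then show ?thesis by simp
  qed
  show ?thesis using 1 2 has_deriv_all_continuous_on[of g g1, OF g] by (simp add: cos_sym_def)
qed

definition cos_free :: "(real \<Rightarrow> real) \<Rightarrow> bool" where
  "cos_free f \<longleftrightarrow> cos_sym f \<and> cos_coeff f = 0"

text \<open>
  Invertibility of \<open>1 + q prim2\<close> on functions free of \<open>cos u\<close>: \<open>q\<close> is not the square of an odd
  \<open>n > 1\<close>.
\<close>

definition solvable_ratio :: "real \<Rightarrow> bool" where
  "solvable_ratio q \<longleftrightarrow> q > 0 \<and> (q = 1 \<or> cos (sqrt q * (pi / 2)) \<noteq> 0)"

lemma solvable_ratio_1: "solvable_ratio 1" by (simp add: solvable_ratio_def)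

text \<open>With g = \<open>prim2 v\<close> the equation becomes g'' + q g = f, g'(0) = 0, g(pi/2) =
  0. Once g is found, v = f - q g.\<close>

lemma factor_solve:
  assumes "solvable_ratio q" "cos_free f"
  shows "\<exists>v. cos_free v \<and> (\<forall>u. v u + q * prim2 v u = f u)"
proof -
  have q: "q > 0" using assms by (simp add: solvable_ratio_def)
  define \<omega> where "\<omega> = sqrt q"
  have w: "\<omega> > 0" "\<omega> * \<omega> = q" using q by (auto simp: \<omega>_def)
  have f: "cos_sym f" "cos_coeff f = 0" using assms by (auto simp: cos_free_def)
  define H1 where "H1 = antideriv 0 (\<lambda>u. f u * sin (\<omega> * u))"
  define H2 where "H2 = antideriv 0 (\<lambda>u. f u * cos (\<omega> * u))"
  have dH: "(H1 has_real_derivative f u * sin (\<omega> * u)) (at u)" "(H2 has_real_derivative f u * cos (\<omega> * u)) (at u)" for u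
    unfolding H1_def H2_def using cos_sym_cont[OF f(1)] by (auto intro!: antideriv_works continuous_intros)
  have H0: "H1 0 = 0" "H2 0 = 0"
    unfolding H1_def H2_def using cos_sym_cont[OF f(1)] by (auto intro!: antideriv_works continuous_intros)
  \<comment> \<open>All solutions with g'(0) = 0, by variation of constants; \<open>c\<close> is
    left free for the condition at pi/2.\<close>
  define g where "g = (\<lambda>c u. c * cos (\<omega> * u) + (sin (\<omega> * u) * H2 u - cos (\<omega> * u) * H1 u) / \<omega>)"
  define g1 where "g1 = (\<lambda>c u. - c * \<omega> * sin (\<omega> * u) + cos (\<omega> * u) * H2 u + sin (\<omega> * u) * H1 u)"
  have dg: "(g c has_real_derivative g1 c u) (at u)" for c u
    unfolding g_def g1_def using w(1)
    by (auto intro!: derivative_eq_intros dH simp: field_simps)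
  have dg1: "(g1 c has_real_derivative f u - q * g c u) (at u)" for c u
  proof -
    have "(g1 c has_real_derivative
        f u * (cos (\<omega> * u) * cos (\<omega> * u)) + f u * (sin (\<omega> * u) * sin (\<omega> * u)) - \<omega> * \<omega> * g c u) (at u)"
      unfolding g_def g1_def using w(1)
      by (auto intro!: derivative_eq_intros dH simp: field_simps)
    then show ?thesis using w by (simp flip: distrib_left)
  qed
  \<comment> \<open>For q = 1 the free multiple of cos vanishes at pi/2 and cannot help; there the
    condition is the vanishing of \<open>H2\<close> at pi/2, which says
    \<open>cos_coeff f = 0\<close>.\<close>
  have "\<exists>c. g c (pi/2) = 0"
  proof (cases "q = 1")
    case True
    then have "\<omega> = 1" by (simp add: \<omega>_def)
    moreover have "H2 (pi/2) = 0" using f(2) \<open>\<omega> = 1\<close> by (simp add: cos_coeff_def H2_def)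
    ultimately show ?thesis by (simp add: g_def)
  next
    case False
    then have "cos (\<omega> * (pi/2)) \<noteq> 0" using assms(1) by (simp add: solvable_ratio_def \<omega>_def)
    then show ?thesis
      by (intro exI[of _ "- ((sin (\<omega> * (pi/2)) * H2 (pi/2) - cos (\<omega> * (pi/2)) * H1 (pi/2)) / \<omega>) / cos (\<omega> * (pi/2))"])
         (simp add: g_def)
  qed
  then obtain c where c: "g c (pi/2) = 0" by blast
  have g10: "g1 c 0 = 0" by (simp add: g1_def H0)
  have gc: "cos_sym (g c)" by (rule cos_sym_of_ode[OF q f(1) dg dg1 g10 c])
  define v where "v = (\<lambda>u. 1 * f u + (-q) * g c u)"
  have v: "cos_sym v" unfolding v_def by (rule cos_sym_lincomb[OF f(1) gc])
  have Pv: "prim2 v = g c" by (rule prim2_unique[OF v dg _ g10 c]) (use dg1 in \<open>simp add: v_def\<close>)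
  have sol: "v u + q * prim2 v u = f u" for u unfolding Pv by (simp add: v_def)
  have "(\<lambda>u. 1 * v u + q * prim2 v u) = f" using sol by auto
  then have "cos_coeff f = cos_coeff v + q * cos_coeff (prim2 v)" using cos_coeff_lincomb[OF v cos_sym_prim2[OF v], of 1 q] by simp
  then have lv: "cos_coeff v * (1 - q) = 0" using f(2) cos_coeff_prim2[OF v] by (simp add: algebra_simps)
  show ?thesis
  proof (cases "q = 1")
    case False
    then show ?thesis using v sol lv by (intro exI[of _ v]) (auto simp: cos_free_def)
  next
    case True
    \<comment> \<open>For q = 1 the function cos lies in the kernel of 1 + \<open>prim2\<close>, so
      removing the cos component leaves the equation intact.\<close>
    define v' where "v' = (\<lambda>u. 1 * v u + (- cos_coeff v) * cos u)"
    have v': "cos_sym v'" unfolding v'_def by (rule cos_sym_lincomb[OF v cos_sym_cos])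
    have "cos_coeff v' = 0" unfolding v'_def cos_coeff_lincomb[OF v cos_sym_cos] by (simp add: cos_coeff_cos)
    moreover have "v' u + q * prim2 v' u = f u" for u
      unfolding v'_def prim2_lincomb[OF v cos_sym_cos] using sol[of u] True by (simp add: prim2_cos)
    ultimately show ?thesis using v' by (auto simp: cos_free_def)
  qed
qed

text \<open>On [0, pi/2], \<open>prim2 v\<close> is an oscillator forced by v + q
  \<open>prim2 v\<close>. A bound for it gives one for v by subtraction.\<close>

lemma factor_apriori:
  assumes "solvable_ratio q"
  shows "\<exists>C\<ge>0. \<forall>v B. cos_free v \<longrightarrow> (\<forall>u. \<bar>v u + q * prim2 v u\<bar> \<le> B) \<longrightarrow> (\<forall>u. \<bar>v u\<bar> \<le> C * B)"
proof -
  have q: "q > 0" using assms by (simp add: solvable_ratio_def)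
  define w where "w = complex_of_real (sqrt q)"
  have w2: "w\<^sup>2 = of_real q" using q by (simp add: w_def flip: of_real_power)
  have w0: "w \<noteq> 0" using q by (simp add: w_def)
  have cosw: "cos (w * of_real (u - 0)) = of_real (cos (sqrt q * u))" for u
    by (simp add: w_def flip: of_real_mult cos_of_real)
  define F where "F = (\<lambda>v u. complex_of_real (prim2 v u))"
  define F1 where "F1 = (\<lambda>v u. complex_of_real (prim v u))"
  define e where "e = (\<lambda>v u. complex_of_real (v u + q * prim2 v u))"
  have F: "forced_oscillator 0 (pi/2) w (F v) (F1 v) (e v) B" "F v (pi/2) = 0"
    if "cos_free v" and B: "\<forall>u. \<bar>v u + q * prim2 v u\<bar> \<le> B" for v B
  proof -
    have v: "cos_sym v" using that by (simp add: cos_free_def)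
    have "(F v has_vector_derivative F1 v s) (at s within {0..pi/2})" for s
      unfolding F_def F1_def using prim2_deriv(1)[OF v, of s]
      by (intro has_vector_derivative_of_real) (auto simp: has_real_derivative_iff_has_vector_derivative has_vector_derivative_at_within)
    moreover have "(F1 v has_vector_derivative of_real (v s)) (at s within {0..pi/2})" for s
      unfolding F1_def using prim2_deriv(2)[OF v, of s]
      by (intro has_vector_derivative_of_real) (auto simp: has_real_derivative_iff_has_vector_derivative has_vector_derivative_at_within)
    moreover have "e v s - w\<^sup>2 * F v s = of_real (v s)" for s
      by (simp add: e_def F_def w2)
    moreover have "norm (e v s) \<le> B" for s
      using B unfolding e_def norm_of_real by blast
    ultimately show "forced_oscillator 0 (pi/2) w (F v) (F1 v) (e v) B" "F v (pi/2) = 0"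
      using cos_sym_half[OF cos_sym_prim2[OF v]] sin_sym_0[OF sin_sym_prim[OF v]] by (auto simp: forced_oscillator_def F_def F1_def)
  qed
  have pi2: "(0::real) \<le> pi / 2" by simp
  show ?thesis
  proof (cases "q = 1")
    case False
    then have "cos (w * of_real (pi/2 - 0)) \<noteq> 0" using assms unfolding cosw by (simp add: solvable_ratio_def)
    from forced_oscillator_bound_nonresonant[OF pi2 w0 this] obtain C where C: "C \<ge> 0"
      and est: "\<And>f f1 e B s. forced_oscillator 0 (pi/2) w f f1 e B \<Longrightarrow> f (pi/2) = 0 \<Longrightarrow> s \<in> {0..pi/2} \<Longrightarrow>
      norm (f s) \<le> C * B"
      by blast
    show ?thesis
    proof (intro exI[of _ "1 + q * C"] conjI allI impI)
      show "0 \<le> 1 + q * C" using C q by simp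
      fix v B u assume v: "cos_free v" and B: "\<forall>u. \<bar>v u + q * prim2 v u\<bar> \<le> B"
      have "\<bar>v u\<bar> \<le> (1 + q * C) * B" if u: "u \<in> {0..pi/2}" for u
      proof -
        from est[OF F[OF v B] u] have "\<bar>prim2 v u\<bar> \<le> C * B" by (simp add: F_def)
        then have "q * \<bar>prim2 v u\<bar> \<le> q * (C * B)" using q by (intro mult_left_mono) auto
        moreover have "\<bar>v u\<bar> \<le> \<bar>v u + q * prim2 v u\<bar> + q * \<bar>prim2 v u\<bar>"
          using abs_triangle_ineq4[of "v u + q * prim2 v u" "q * prim2 v u"] q by (simp add: abs_mult)
        ultimately show ?thesis using B[rule_format, of u] by (simp add: algebra_simps)
      qed
      then show "\<bar>v u\<bar> \<le> (1 + q * C) * B" using cos_sym_reduce_bound[of v] v by (auto simp: cos_free_def)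
    qed
  next
    case True
    then have w1: "w = 1" by (simp add: w_def)
    from forced_oscillator_bound[OF pi2, of w] obtain C where C: "C \<ge> 0"
      and est: "\<And>f f1 e B s. forced_oscillator 0 (pi/2) w f f1 e B \<Longrightarrow> s \<in> {0..pi/2} \<Longrightarrow>
      norm (w * f s - w * f 0 * cos (w * of_real (s - 0))) \<le> C * B"
      by blast
    show ?thesis
    proof (intro exI[of _ "1 + 3 * C"] conjI allI impI)
      show "0 \<le> 1 + 3 * C" using C q by simp
      fix v B u assume v: "cos_free v" and B: "\<forall>u. \<bar>v u + q * prim2 v u\<bar> \<le> B"
      have vc: "cos_sym v" and Pc: "cos_sym (prim2 v)" using v cos_sym_prim2 by (auto simp: cos_free_def)
      \<comment> \<open>At resonance the oscillator estimate controls \<open>prim2 v\<close> only up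
        to its free part, a multiple of cos. Since \<open>prim2 v\<close> has no cos component,
        \<open>cos_coeff h\<close> recovers this multiple, at twice the bound on \<open>h\<close>;
        hence 3 = 1 + 2 in the constant.\<close>
      define h where "h = (\<lambda>u. 1 * prim2 v u + (- prim2 v 0) * cos u)"
      have hc: "cos_sym h" unfolding h_def by (rule cos_sym_lincomb[OF Pc cos_sym_cos])
      have "\<bar>h u\<bar> \<le> C * B" if u: "u \<in> {0..pi/2}" for u
      proof -
        from est[OF F(1)[OF v B] u] have "norm (complex_of_real (h u)) \<le> C * B"
          using cosw[of u] True by (simp add: F_def h_def w1)
        then show ?thesis by simp
      qed
      then have hB: "\<bar>h u\<bar> \<le> C * B" for u using cos_sym_reduce_bound[of h] hc by auto
      have "cos_coeff h = - prim2 v 0"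
        unfolding h_def cos_coeff_lincomb[OF Pc cos_sym_cos] using v by (simp add: cos_coeff_cos cos_coeff_prim2[OF vc] cos_free_def)
      then have "\<bar>prim2 v 0\<bar> \<le> 2 * (C * B)" using cos_coeff_bound[OF hc hB] by simp
      moreover have "\<bar>prim2 v 0 * cos u\<bar> \<le> \<bar>prim2 v 0\<bar>"
        using mult_left_mono[of "\<bar>cos u\<bar>" 1 "\<bar>prim2 v 0\<bar>"] by (simp add: abs_mult)
      ultimately have "\<bar>prim2 v u\<bar> \<le> 3 * (C * B)" using hB[of u] by (simp add: h_def)
      moreover have "\<bar>v u + prim2 v u\<bar> \<le> B" using B True by simp
      ultimately show "\<bar>v u\<bar> \<le> (1 + 3 * C) * B" by (simp add: algebra_simps)
    qed
  qed
qed

text \<open>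
  The linear part with characteristic roots \<open>1\<close> and \<open>q\<close>, acting on the fourth derivative; it
  equals \<open>(1 + prim2)(1 + q prim2)\<close>.
\<close>

definition lin_op :: "real \<Rightarrow> (real \<Rightarrow> real) \<Rightarrow> real \<Rightarrow> real" where
  "lin_op q v = (\<lambda>u. v u + (1 + q) * prim2 v u + q * prim2 (prim2 v) u)"

lemma lin_op_factor:
  assumes "cos_sym v"
  shows "lin_op q v u = (v u + q * prim2 v u) + prim2 (\<lambda>u. v u + q * prim2 v u) u"
  using prim2_lincomb[OF assms cos_sym_prim2[OF assms], of 1 q] by (simp add: lin_op_def algebra_simps)

lemma cos_free_factor:
  assumes "cos_free v" shows "cos_free (\<lambda>u. v u + q * prim2 v u)"
proof -
  have v: "cos_sym v" "cos_sym (prim2 v)" using assms cos_sym_prim2 by (auto simp: cos_free_def)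
  show ?thesis using cos_sym_lincomb[OF v, of 1 q] cos_coeff_lincomb[OF v, of 1 q] cos_coeff_prim2[OF v(1)] assms
    by (simp add: cos_free_def)
qed

text \<open>Both inversions stay within \<open>cos_free\<close>, so the second can follow the first
  even for a double root q = 1.\<close>

lemma lin_op_solve:
  assumes "solvable_ratio q" "cos_free f"
  shows "\<exists>v. cos_free v \<and> lin_op q v = f"
proof -
  obtain h where h: "cos_free h" "\<forall>u. h u + 1 * prim2 h u = f u" using factor_solve[OF solvable_ratio_1 assms(2)] by blast
  obtain v where v: "cos_free v" "\<forall>u. v u + q * prim2 v u = h u" using factor_solve[OF assms(1) h(1)] by blast
  have "(\<lambda>u. v u + q * prim2 v u) = h" using v by auto
  then have "lin_op q v = f" using lin_op_factor[of v q] v(1) h(2) by (auto simp: cos_free_def)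
  with v show ?thesis by blast
qed

lemma lin_op_apriori:
  assumes "solvable_ratio q"
  shows "\<exists>C\<ge>0. \<forall>v B. cos_free v \<longrightarrow> (\<forall>u. \<bar>lin_op q v u\<bar> \<le> B) \<longrightarrow> (\<forall>u. \<bar>v u\<bar> \<le> C * B)"
proof -
  obtain C where C: "C \<ge> 0" "\<And>v B u. cos_free v \<Longrightarrow> (\<And>u. \<bar>v u + q * prim2 v u\<bar> \<le> B) \<Longrightarrow> \<bar>v u\<bar> \<le> C * B"
    using factor_apriori[OF assms] by blast
  obtain C1 where C1: "C1 \<ge> 0" "\<And>v B u. cos_free v \<Longrightarrow> (\<And>u. \<bar>v u + 1 * prim2 v u\<bar> \<le> B) \<Longrightarrow> \<bar>v u\<bar> \<le> C1 * B"
    using factor_apriori[OF solvable_ratio_1] by blast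
  show ?thesis
  proof (intro exI[of _ "C * C1"] conjI allI impI)
    fix v B u assume v: "cos_free v" and B: "\<forall>u. \<bar>lin_op q v u\<bar> \<le> B"
    have "\<bar>v u + q * prim2 v u\<bar> \<le> C1 * B" for u
      by (rule C1(2)[OF cos_free_factor[OF v]]) (use B lin_op_factor[of v q] v in \<open>auto simp: cos_free_def\<close>)
    from C(2)[OF v this] show "\<bar>v u\<bar> \<le> C * C1 * B" by (simp add: algebra_simps)
  qed (use C C1 in auto)
qed

section \<open>The bifurcating family\<close>

text \<open>
  The argument \<open>z\<close> is the fourth derivative of \<open>y\<close>; the derivatives of order 3, 2, 1, 0 are
  \<open>prim z\<close>, \<open>prim2 z\<close>, \<open>prim (prim2 z)\<close>, \<open>prim2 (prim2 z)\<close>.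
\<close>

definition cubic_op :: "(nat \<Rightarrow> real) \<Rightarrow> (real \<Rightarrow> real) \<Rightarrow> real \<Rightarrow> real" where
  "cubic_op c z = (\<lambda>u. c 1 * (prim2 (prim2 z) u * prim2 (prim2 z) u * prim2 (prim2 z) u) + c 2 * (prim2 z u * prim2 z u * prim2 z u)
     + c 3 * (prim (prim2 z) u * prim2 z u * prim z u) + c 4 * (prim (prim2 z) u * prim (prim2 z) u * z u)
     + c 5 * (prim (prim2 z) u * prim (prim2 z) u * prim2 z u))"

text \<open>Every monomial has an odd number of factors of cosine type and zero or two of sine type,
  so both symmetries survive. This is where the particular derivatives occurring in the cubic terms
  matter.\<close>

lemma cos_sym_cubic_op:
  assumes "cos_sym z" shows "cos_sym (cubic_op c z)"
proof -
  have "cos_sym z" "cos_sym (prim2 z)" "cos_sym (prim2 (prim2 z))" "sin_sym (prim z)" "sin_sym (prim (prim2 z))"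
    using assms cos_sym_prim2 sin_sym_prim by auto
  then show ?thesis
    unfolding cos_sym_def sin_sym_def cubic_op_def by (auto intro!: continuous_intros)
qed

section \<open>Lipschitz estimates for the cubic terms\<close>

lemma abs_mult3_le:
  fixes x y z :: real
  assumes "\<bar>x\<bar> \<le> X" "\<bar>y\<bar> \<le> Y" "\<bar>z\<bar> \<le> Z"
  shows "\<bar>x * y * z\<bar> \<le> X * Y * Z"
proof -
  have "0 \<le> X" "0 \<le> Y" using assms abs_ge_zero order_trans by blast+
  then show ?thesis
    unfolding abs_mult by (intro mult_mono assms) auto
qed

lemma trilinear_diff:
  fixes a b c a' b' c' :: real
  assumes "\<bar>a'\<bar> \<le> R" "\<bar>b\<bar> \<le> R" "\<bar>b'\<bar> \<le> R" "\<bar>c\<bar> \<le> R"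
    "\<bar>a - a'\<bar> \<le> D" "\<bar>b - b'\<bar> \<le> D" "\<bar>c - c'\<bar> \<le> D"
  shows "\<bar>a * b * c - a' * b' * c'\<bar> \<le> 3 * R * R * D"
proof -
  have "a * b * c - a' * b' * c' = (a - a') * b * c + a' * (b - b') * c + a' * b' * (c - c')"
    by (simp add: algebra_simps)
  moreover have "\<bar>(a - a') * b * c\<bar> \<le> D * R * R" "\<bar>a' * (b - b') * c\<bar> \<le> R * D * R" "\<bar>a' * b' * (c - c')\<bar> \<le> R * R * D"
    by (intro abs_mult3_le assms)+
  moreover have "3 * R * R * D = D * R * R + R * D * R + R * R * D" by simp
  ultimately show ?thesis by linarith
qed

lemma prim2_diff_bound:
  assumes "cos_sym f" "cos_sym g" "\<And>u. \<bar>f u - g u\<bar> \<le> d"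
  shows "\<bar>prim2 f u - prim2 g u\<bar> \<le> 4 * d"
  using prim2_bound[OF cos_sym_lincomb[OF assms(1,2), of 1 "-1"], of d u] prim2_lincomb[OF assms(1,2), of 1 "-1"] assms(3) by simp

lemma prim_diff_bound:
  assumes "cos_sym f" "cos_sym g" "\<And>u. \<bar>f u - g u\<bar> \<le> d"
  shows "\<bar>prim f u - prim g u\<bar> \<le> 2 * d"
  using prim_bound[OF cos_sym_lincomb[OF assms(1,2), of 1 "-1"], of d u] prim_lincomb[OF assms(1,2), of 1 "-1"] assms(3) by simp

lemma cos_coeff_diff_bound:
  assumes "cos_sym f" "cos_sym g" "\<And>u. \<bar>f u - g u\<bar> \<le> d"
  shows "\<bar>cos_coeff f - cos_coeff g\<bar> \<le> 2 * d"
  using cos_coeff_bound[OF cos_sym_lincomb[OF assms(1,2), of 1 "-1"], of d] cos_coeff_lincomb[OF assms(1,2), of 1 "-1"] assms(3) by simp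

text \<open>A Lipschitz constant of \<open>cubic_op\<close> on the ball of radius 2: there y and its
  derivatives are at most 16 * 2 = 32 and differences grow at most 16-fold, so each monomial
  contributes 3 * 32 * 32 * 16 = 49152.\<close>

definition cubic_bound :: "(nat \<Rightarrow> real) \<Rightarrow> real" where
  "cubic_bound c = (\<bar>c 1\<bar> + \<bar>c 2\<bar> + \<bar>c 3\<bar> + \<bar>c 4\<bar> + \<bar>c 5\<bar>) * 49152"

lemma cubic_bound_nonneg: "cubic_bound c \<ge> 0" by (simp add: cubic_bound_def)

lemma abs_diff5:
  fixes a1 a2 a3 a4 a5 :: real
  assumes "\<bar>a1 - b1\<bar> \<le> d1" "\<bar>a2 - b2\<bar> \<le> d2" "\<bar>a3 - b3\<bar> \<le> d3" "\<bar>a4 - b4\<bar> \<le> d4" "\<bar>a5 - b5\<bar> \<le> d5"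
  shows "\<bar>(a1 + a2 + a3 + a4 + a5) - (b1 + b2 + b3 + b4 + b5)\<bar> \<le> d1 + d2 + d3 + d4 + d5"
  using assms by linarith

lemma cubic_form_diff:
  fixes x0 x1 x2 x3 x4 y0 y1 y2 y3 y4 d :: real
  assumes x: "\<bar>x0\<bar> \<le> 32" "\<bar>x1\<bar> \<le> 32" "\<bar>x2\<bar> \<le> 32" "\<bar>x3\<bar> \<le> 32" "\<bar>x4\<bar> \<le> 32"
    and y: "\<bar>y0\<bar> \<le> 32" "\<bar>y1\<bar> \<le> 32" "\<bar>y2\<bar> \<le> 32" "\<bar>y3\<bar> \<le> 32" "\<bar>y4\<bar> \<le> 32"
    and d: "\<bar>x0 - y0\<bar> \<le> 16 * d" "\<bar>x1 - y1\<bar> \<le> 16 * d" "\<bar>x2 - y2\<bar> \<le> 16 * d" "\<bar>x3 - y3\<bar> \<le> 16 * d" "\<bar>x4 - y4\<bar> \<le> 16 * d"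
  shows "\<bar>(c 1 * (x0 * x0 * x0) + c 2 * (x2 * x2 * x2) + c 3 * (x1 * x2 * x3) + c 4 * (x1 * x1 * x4) + c 5 * (x1 * x1 * x2))
     - (c 1 * (y0 * y0 * y0) + c 2 * (y2 * y2 * y2) + c 3 * (y1 * y2 * y3) + c 4 * (y1 * y1 * y4) + c 5 * (y1 * y1 * y2))\<bar>
     \<le> cubic_bound c * d"
proof -
  have ap: "\<bar>k * a - k * b\<bar> \<le> \<bar>k\<bar> * (3 * 32 * 32 * (16 * d))" if "\<bar>a - b\<bar> \<le> 3 * 32 * 32 * (16 * d)" for k a b :: real
    using mult_left_mono[OF that, of "\<bar>k\<bar>"] by (simp flip: right_diff_distrib add: abs_mult)
  note t = ap[OF trilinear_diff]
  have "cubic_bound c * d = \<bar>c 1\<bar> * (3 * 32 * 32 * (16 * d)) + \<bar>c 2\<bar> * (3 * 32 * 32 * (16 * d)) + \<bar>c 3\<bar> * (3 * 32 * 32 * (16 * d))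
      + \<bar>c 4\<bar> * (3 * 32 * 32 * (16 * d)) + \<bar>c 5\<bar> * (3 * 32 * 32 * (16 * d))"
    by (simp add: cubic_bound_def algebra_simps)
  then show ?thesis
    using abs_diff5[OF t[OF y(1) x(1) y(1) x(1) d(1,1,1), of "c 1"] t[OF y(3) x(3) y(3) x(3) d(3,3,3), of "c 2"]
      t[OF y(2) x(3) y(3) x(4) d(2,3,4), of "c 3"] t[OF y(2) x(2) y(2) x(5) d(2,2,5), of "c 4"] t[OF y(2) x(2) y(2) x(3) d(2,2,3), of "c 5"]]
    by simp
qed

lemma cubic_op_diff:
  assumes c: "cos_sym y" "cos_sym z" and y: "\<And>u. \<bar>y u\<bar> \<le> 2" and z: "\<And>u. \<bar>z u\<bar> \<le> 2"
    and d: "\<And>u. \<bar>y u - z u\<bar> \<le> d"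
  shows "\<bar>cubic_op c y u - cubic_op c z u\<bar> \<le> cubic_bound c * d"
proof -
  note cP = c[THEN cos_sym_prim2]
  have d0: "0 \<le> d" using d[of 0] by linarith
  have by': "\<bar>prim2 y u\<bar> \<le> 8" "\<bar>prim2 z u\<bar> \<le> 8" for u
    using prim2_bound[OF c(1) y, of u] prim2_bound[OF c(2) z, of u] by simp_all
  have dP: "\<bar>prim2 y u - prim2 z u\<bar> \<le> 4 * d" for u by (rule prim2_diff_bound[OF c d])
  show ?thesis
    unfolding cubic_op_def
  proof (rule cubic_form_diff)
    show "\<bar>prim2 (prim2 y) u\<bar> \<le> 32" "\<bar>prim2 (prim2 z) u\<bar> \<le> 32"
      using prim2_bound[OF cP(1) by'(1), of u] prim2_bound[OF cP(2) by'(2), of u] by linarith+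
    show "\<bar>prim (prim2 y) u\<bar> \<le> 32" "\<bar>prim (prim2 z) u\<bar> \<le> 32"
      using prim_bound[OF cP(1) by'(1), of u] prim_bound[OF cP(2) by'(2), of u] by linarith+
    show "\<bar>prim2 y u\<bar> \<le> 32" "\<bar>prim2 z u\<bar> \<le> 32"
      using by'[of u] by linarith+
    show "\<bar>prim y u\<bar> \<le> 32" "\<bar>prim z u\<bar> \<le> 32"
      using prim_bound[OF c(1) y, of u] prim_bound[OF c(2) z, of u] by linarith+
    show "\<bar>y u\<bar> \<le> 32" "\<bar>z u\<bar> \<le> 32"
      using y[of u] z[of u] by linarith+
    show "\<bar>prim2 (prim2 y) u - prim2 (prim2 z) u\<bar> \<le> 16 * d"
      using prim2_diff_bound[OF cP dP, of u] d0 by linarith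
    show "\<bar>prim (prim2 y) u - prim (prim2 z) u\<bar> \<le> 16 * d"
      using prim_diff_bound[OF cP dP, of u] d0 by linarith
    show "\<bar>prim2 y u - prim2 z u\<bar> \<le> 16 * d" using dP[of u] d0 by linarith
    show "\<bar>prim y u - prim z u\<bar> \<le> 16 * d" using prim_diff_bound[OF c d, of u] d0 by linarith
    show "\<bar>y u - z u\<bar> \<le> 16 * d" using d[of u] d0 by linarith
  qed
qed

lemma cos_sym_zero: "cos_sym (\<lambda>u. 0)" by (simp add: cos_sym_def)

lemma prim2_zero: "prim2 (\<lambda>u. 0) = (\<lambda>u. 0)"
  by (rule prim2_unique[of _ _ "\<lambda>u. 0"]) (auto simp: cos_sym_zero)

lemma prim_zero: "prim (\<lambda>u. 0) = (\<lambda>u. 0)"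
  by (rule antideriv_unique) auto

lemma cubic_op_bound:
  assumes "cos_sym y" "\<And>u. \<bar>y u\<bar> \<le> 2"
  shows "\<bar>cubic_op c y u\<bar> \<le> 2 * cubic_bound c"
proof -
  have "cubic_op c (\<lambda>u. 0) u = 0" unfolding cubic_op_def prim2_zero unfolding prim_zero by simp
  then show ?thesis using cubic_op_diff[OF assms(1) cos_sym_zero assms(2), of 2 c u] assms(2) by simp
qed

text \<open>
  With \<open>z = cos + v\<close> and \<open>v\<close> free of \<open>cos\<close>, the equation reads
  \<open>lin_op q v = t^2 cubic_op c z - b prim2 (prim2 z)\<close>. Its \<open>cos\<close>-component determines
  \<open>b = t^2 cos_coeff (cubic_op c z)\<close>, and what remains is \<open>lin_op q v = t^2 reduced_rhs c v\<close>, a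
  contraction for small \<open>t\<close>.
\<close>

definition reduced_rhs :: "(nat \<Rightarrow> real) \<Rightarrow> (real \<Rightarrow> real) \<Rightarrow> real \<Rightarrow> real" where
  "reduced_rhs c v = (\<lambda>u. cubic_op c (\<lambda>u. cos u + v u) u - cos_coeff (cubic_op c (\<lambda>u. cos u + v u)) * (cos u + prim2 (prim2 v) u))"

lemma cos_plus:
  assumes "cos_sym v" "\<And>u. \<bar>v u\<bar> \<le> 1/2"
  shows "cos_sym (\<lambda>u. cos u + v u)" "\<bar>cos u + v u\<bar> \<le> 2"
proof -
  show "cos_sym (\<lambda>u. cos u + v u)" using cos_sym_lincomb[OF cos_sym_cos assms(1), of 1 1] by simp
  show "\<bar>cos u + v u\<bar> \<le> 2" using assms(2)[of u] abs_cos_le_one[of u] by linarith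
qed

text \<open>The function cos + \<open>prim2 (prim2 v)\<close> has cos coefficient exactly 1, so the
  subtracted multiple removes the whole cos component of the cubic term.\<close>

lemma cos_free_reduced_rhs:
  assumes v: "cos_free v" "\<And>u. \<bar>v u\<bar> \<le> 1/2"
  shows "cos_free (reduced_rhs c v)"
proof -
  have vc: "cos_sym v" "cos_sym (prim2 v)" "cos_sym (prim2 (prim2 v))" using v cos_sym_prim2 by (auto simp: cos_free_def)
  let ?m = "cubic_op c (\<lambda>u. cos u + v u)"
  have m: "cos_sym ?m" by (intro cos_sym_cubic_op cos_plus vc v)
  have y: "cos_sym (\<lambda>u. 1 * cos u + 1 * prim2 (prim2 v) u)" by (rule cos_sym_lincomb[OF cos_sym_cos vc(3)])
  have ly: "cos_coeff (\<lambda>u. 1 * cos u + 1 * prim2 (prim2 v) u) = 1"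
    unfolding cos_coeff_lincomb[OF cos_sym_cos vc(3)] cos_coeff_prim2[OF vc(2)] cos_coeff_prim2[OF vc(1)] cos_coeff_cos using v by (simp add: cos_free_def)
  have "reduced_rhs c v = (\<lambda>u. 1 * ?m u + (- cos_coeff ?m) * (1 * cos u + 1 * prim2 (prim2 v) u))"
    by (simp add: reduced_rhs_def)
  then show ?thesis unfolding cos_free_def using cos_sym_lincomb[OF m y, of 1 "- cos_coeff ?m"] cos_coeff_lincomb[OF m y, of 1 "- cos_coeff ?m"] ly by simp
qed

text \<open>The factor 100 rounds up 1 + 2 * 9 + 4 * 16 = 83 in the difference and 2 + 4 * 9 = 38 in
  the bound, where 9 bounds cos + \<open>prim2 (prim2 v)\<close>. A common factor lets one smallness
  condition serve both self-mapping and contraction.\<close>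

lemma reduced_rhs_diff:
  assumes v: "cos_sym v" "\<And>u. \<bar>v u\<bar> \<le> 1/2" and w: "cos_sym w" "\<And>u. \<bar>w u\<bar> \<le> 1/2"
    and d: "\<And>u. \<bar>v u - w u\<bar> \<le> d"
  shows "\<bar>reduced_rhs c v u - reduced_rhs c w u\<bar> \<le> 100 * cubic_bound c * d"
    "\<bar>cos_coeff (cubic_op c (\<lambda>u. cos u + v u)) - cos_coeff (cubic_op c (\<lambda>u. cos u + w u))\<bar> \<le> 2 * cubic_bound c * d"
    "\<bar>reduced_rhs c v u\<bar> \<le> 100 * cubic_bound c" "\<bar>cos_coeff (cubic_op c (\<lambda>u. cos u + v u))\<bar> \<le> 4 * cubic_bound c"
proof -
  let ?m = "cubic_op c (\<lambda>u. cos u + v u)" and ?n = "cubic_op c (\<lambda>u. cos u + w u)"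
  let ?\<Lambda> = "cubic_bound c"
  have d0: "0 \<le> d" using d[of 0] by linarith
  note L0 = cubic_bound_nonneg[of c]
  note cv = cos_plus[OF v] cos_plus[OF w]
  have mn: "cos_sym ?m" "cos_sym ?n" by (intro cos_sym_cubic_op cv)+
  have bm: "\<bar>?m u\<bar> \<le> 2 * ?\<Lambda>" "\<bar>?n u\<bar> \<le> 2 * ?\<Lambda>" for u
    using cubic_op_bound[OF cv(1,2)] cubic_op_bound[OF cv(3,4)] by auto
  have dm: "\<bar>?m u - ?n u\<bar> \<le> ?\<Lambda> * d" for u
    by (rule cubic_op_diff[OF cv(1,3) cv(2) cv(4)]) (use d in auto)
  have lm: "\<bar>cos_coeff ?m\<bar> \<le> 4 * ?\<Lambda>" "\<bar>cos_coeff ?n\<bar> \<le> 4 * ?\<Lambda>" "\<bar>cos_coeff ?m - cos_coeff ?n\<bar> \<le> 2 * (?\<Lambda> * d)"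
    using cos_coeff_bound[OF mn(1) bm(1)] cos_coeff_bound[OF mn(2) bm(2)] cos_coeff_diff_bound[OF mn dm] by auto
  have Pv: "\<bar>prim2 v u\<bar> \<le> 2" for u using prim2_bound[OF v] by simp
  have PPv: "\<bar>prim2 (prim2 v) u\<bar> \<le> 8" using prim2_bound[OF cos_sym_prim2[OF v(1)] Pv] by simp
  have Pd: "\<bar>prim2 v u - prim2 w u\<bar> \<le> 4 * d" for u using prim2_diff_bound[OF v(1) w(1) d] by simp
  have PPd: "\<bar>prim2 (prim2 v) u - prim2 (prim2 w) u\<bar> \<le> 16 * d"
    using prim2_diff_bound[OF cos_sym_prim2[OF v(1)] cos_sym_prim2[OF w(1)] Pd] by simp
  have y: "\<bar>cos u + prim2 (prim2 v) u\<bar> \<le> 9" using PPv abs_cos_le_one[of u] by linarith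
  have 1: "\<bar>(cos_coeff ?m - cos_coeff ?n) * (cos u + prim2 (prim2 v) u)\<bar> \<le> 2 * (?\<Lambda> * d) * 9"
    unfolding abs_mult using lm y L0 d0 by (intro mult_mono) auto
  have 2: "\<bar>cos_coeff ?n * (prim2 (prim2 v) u - prim2 (prim2 w) u)\<bar> \<le> 4 * ?\<Lambda> * (16 * d)"
    unfolding abs_mult using lm PPd L0 d0 by (intro mult_mono) auto
  have 3: "\<bar>cos_coeff ?m * (cos u + prim2 (prim2 v) u)\<bar> \<le> 4 * ?\<Lambda> * 9"
    unfolding abs_mult using lm y L0 d0 by (intro mult_mono) auto
  have "reduced_rhs c v u - reduced_rhs c w u = (?m u - ?n u) - (cos_coeff ?m - cos_coeff ?n) * (cos u + prim2 (prim2 v) u)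
      - cos_coeff ?n * (prim2 (prim2 v) u - prim2 (prim2 w) u)"
    by (simp add: reduced_rhs_def algebra_simps)
  moreover have "0 \<le> ?\<Lambda> * d" using L0 d0 by simp
  moreover have "2 * (?\<Lambda> * d) * 9 + 4 * ?\<Lambda> * (16 * d) = 82 * (?\<Lambda> * d)" by (simp add: algebra_simps)
  moreover have "100 * ?\<Lambda> * d = 100 * (?\<Lambda> * d)" by simp
  ultimately show "\<bar>reduced_rhs c v u - reduced_rhs c w u\<bar> \<le> 100 * ?\<Lambda> * d"
    using dm[of u] 1 2 by linarith
  show "\<bar>cos_coeff ?m - cos_coeff ?n\<bar> \<le> 2 * ?\<Lambda> * d" using lm(3) by simp
  show "\<bar>cos_coeff ?m\<bar> \<le> 4 * ?\<Lambda>" by (rule lm(1))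
  show "\<bar>reduced_rhs c v u\<bar> \<le> 100 * ?\<Lambda>" using bm(1)[of u] 3 L0 unfolding reduced_rhs_def by linarith
qed

lemma lin_op_lincomb:
  assumes "cos_sym f" "cos_sym g"
  shows "lin_op q (\<lambda>u. a * f u + b * g u) u = a * lin_op q f u + b * lin_op q g u"
  unfolding lin_op_def prim2_lincomb[OF assms] prim2_lincomb[OF assms[THEN cos_sym_prim2]] by (simp add: algebra_simps)

lemma cos_free_lincomb: "cos_free f \<Longrightarrow> cos_free g \<Longrightarrow> cos_free (\<lambda>u. a * f u + b * g u)"
  by (simp add: cos_free_def cos_sym_lincomb cos_coeff_lincomb)

lemma lin_op_cos: "lin_op q cos u = 0"
proof -
  have "prim2 (\<lambda>u. - cos u) = (\<lambda>u. - prim2 cos u)"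
    using prim2_lincomb[OF cos_sym_cos cos_sym_cos, of "-1" 0] by simp
  then show ?thesis unfolding lin_op_def prim2_cos by (simp add: prim2_cos algebra_simps)
qed

section \<open>The contraction and the resulting curve of solutions\<close>

text \<open>Gives completeness inside the bounded continuous functions: the symmetries are closed
  conditions on point evaluations, and \<open>cos_coeff\<close> is continuous in the sup norm among
  symmetric functions.\<close>

lemma closed_cos_free_ball: "closed {v :: real \<Rightarrow>\<^sub>C real. cos_free (apply_bcontfun v) \<and> norm v \<le> R}"
proof -
  have ev: "continuous_on UNIV (\<lambda>v :: real \<Rightarrow>\<^sub>C real. apply_bcontfun v u)" for u
    by (rule continuous_onI) (meson dist_bounded le_less_trans less_imp_le)
  have A: "{v :: real \<Rightarrow>\<^sub>C real. cos_sym (apply_bcontfun v)} =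
      (\<Inter>u. {v. apply_bcontfun v (-u) = apply_bcontfun v u}) \<inter> (\<Inter>u. {v. apply_bcontfun v (pi - u) = - apply_bcontfun v u})"
    by (auto simp: cos_sym_def)
  have cA: "closed {v :: real \<Rightarrow>\<^sub>C real. cos_sym (apply_bcontfun v)}"
    unfolding A by (intro closed_Int closed_INT ballI closed_Collect_eq continuous_intros ev)
  have "continuous_on {v :: real \<Rightarrow>\<^sub>C real. cos_sym (apply_bcontfun v)} (\<lambda>v. cos_coeff (apply_bcontfun v))"
  proof (rule continuous_onI)
    fix v :: "real \<Rightarrow>\<^sub>C real" and \<epsilon> :: real
    assume v: "v \<in> {v. cos_sym (apply_bcontfun v)}" and \<epsilon>: "0 < \<epsilon>"
    show "\<exists>d>0. \<forall>v'\<in>{v. cos_sym (apply_bcontfun v)}. dist v' v < d \<longrightarrow> dist (cos_coeff (apply_bcontfun v')) (cos_coeff (apply_bcontfun v)) \<le> \<epsilon>"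
    proof (intro exI[of _ "\<epsilon>/2"] conjI ballI impI)
      fix v' :: "real \<Rightarrow>\<^sub>C real" assume v': "v' \<in> {v. cos_sym (apply_bcontfun v)}" "dist v' v < \<epsilon>/2"
      have "\<bar>apply_bcontfun v' u - apply_bcontfun v u\<bar> \<le> \<epsilon>/2" for u
        using dist_bounded[of v' u v] v'(2) by (simp add: dist_real_def)
      from cos_coeff_diff_bound[OF _ _ this] v v' show "dist (cos_coeff (apply_bcontfun v')) (cos_coeff (apply_bcontfun v)) \<le> \<epsilon>"
        by (simp add: dist_real_def)
    qed (use \<epsilon> in simp)
  qed
  then have "closed ({v :: real \<Rightarrow>\<^sub>C real. cos_sym (apply_bcontfun v)} \<inter> (\<lambda>v. cos_coeff (apply_bcontfun v)) -` {0})"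
    by (rule continuous_closed_preimage) (use cA in auto)
  then have "closed (({v :: real \<Rightarrow>\<^sub>C real. cos_sym (apply_bcontfun v)} \<inter> (\<lambda>v. cos_coeff (apply_bcontfun v)) -` {0}) \<inter> cball 0 R)"
    by (rule closed_Int) simp
  moreover have "({v :: real \<Rightarrow>\<^sub>C real. cos_sym (apply_bcontfun v)} \<inter> (\<lambda>v. cos_coeff (apply_bcontfun v)) -` {0}) \<inter> cball 0 R
     = {v :: real \<Rightarrow>\<^sub>C real. cos_free (apply_bcontfun v) \<and> norm v \<le> R}"
    by (auto simp: cos_free_def)
  ultimately show ?thesis by simp
qed

lemma cos_sym_bcontfun: "cos_sym f \<Longrightarrow> apply_bcontfun (Bcontfun f) = f"
proof -
  assume f: "cos_sym f"
  obtain B where "\<And>u. \<bar>f u\<bar> \<le> B" using cos_sym_bounded[OF f] by blast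
  then have "f \<in> bcontfun"
    using cos_sym_cont[OF f] by (intro bcontfun_normI) auto
  then show ?thesis by (rule Bcontfun_inverse)
qed

text \<open>Fixed point of the map sending v to a solution of
  \<open>lin_op q w = \<tau> * reduced_rhs c v\<close>. The a priori bound, applied to images and to
  their differences, yields the self-map and the contraction factor 1/2. Radius 1/2 keeps cos + v
  within the ball of radius 2 and away from zero at u = 0.\<close>

lemma fixed_point:
  assumes "solvable_ratio q"
    and C: "C \<ge> 0" "\<And>v B u. cos_free v \<Longrightarrow> (\<And>u. \<bar>lin_op q v u\<bar> \<le> B) \<Longrightarrow> \<bar>v u\<bar> \<le> C * B"
    and \<tau>: "0 \<le> \<tau>" "\<tau> * C * (100 * cubic_bound c) \<le> 1/2"
  shows "\<exists>v. cos_free v \<and> (\<forall>u. \<bar>v u\<bar> \<le> 1/2) \<and> (\<forall>u. lin_op q v u = \<tau> * reduced_rhs c v u)"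
proof -
  define S where "S = {v :: real \<Rightarrow>\<^sub>C real. cos_free (apply_bcontfun v) \<and> norm v \<le> 1/2}"
  have S: "cos_free (apply_bcontfun v)" "\<bar>apply_bcontfun v u\<bar> \<le> 1/2" if "v \<in> S" for v u
    using that norm_bounded[of v u] by (auto simp: S_def)
  have "\<exists>w. cos_free w \<and> lin_op q w = (\<lambda>u. \<tau> * reduced_rhs c (apply_bcontfun v) u)" if "v \<in> S" for v
  proof -
    have e: "cos_free (reduced_rhs c (apply_bcontfun v))" using cos_free_reduced_rhs S[OF that] by blast
    then show ?thesis using lin_op_solve[OF assms(1)] cos_free_lincomb[OF e e, of \<tau> 0] by simp
  qed
  then obtain T where T: "\<And>v. v \<in> S \<Longrightarrow> cos_free (T v) \<and> lin_op q (T v) = (\<lambda>u. \<tau> * reduced_rhs c (apply_bcontfun v) u)"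
    by metis
  have app: "apply_bcontfun (Bcontfun (T v)) = T v" if "v \<in> S" for v
    using T[OF that] by (intro cos_sym_bcontfun) (auto simp: cos_free_def)
  have "\<exists>!v. v \<in> S \<and> Bcontfun (T v) = v"
  proof (rule Banach_fix[where c = "1/2"])
    show "complete S" unfolding S_def using closed_cos_free_ball complete_eq_closed by blast
    have "cos_free (\<lambda>u. 0)" using cos_sym_zero by (simp add: cos_free_def cos_coeff_def prim_zero)
    then have "0 \<in> S" by (simp add: S_def zero_bcontfun.rep_eq)
    then show "S \<noteq> {}" by blast
    show "(\<lambda>v. Bcontfun (T v)) ` S \<subseteq> S"
    proof (rule image_subsetI)
      fix v assume v: "v \<in> S"
      note sv = S[OF v]
      have cv: "cos_sym (apply_bcontfun v)" using sv(1) by (simp add: cos_free_def)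
      have "\<bar>reduced_rhs c (apply_bcontfun v) u\<bar> \<le> 100 * cubic_bound c" for u
        by (rule reduced_rhs_diff(3)[OF cv sv(2) cv sv(2), of 0]) simp
      then have "\<bar>lin_op q (T v) u\<bar> \<le> \<tau> * (100 * cubic_bound c)" for u
        using T[OF v] \<tau>(1) by (auto simp: abs_mult intro!: mult_left_mono)
      then have "\<bar>T v u\<bar> \<le> C * (\<tau> * (100 * cubic_bound c))" for u
        by (rule C(2)[OF conjunct1[OF T[OF v]]])
      moreover have "C * (\<tau> * (100 * cubic_bound c)) \<le> 1/2" using \<tau>(2) by (simp add: mult.left_commute mult.assoc)
      ultimately have "\<bar>T v u\<bar> \<le> 1/2" for u by (rule order_trans)
      then have "norm (Bcontfun (T v)) \<le> 1/2" by (intro norm_bound) (simp add: app[OF v])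
      then show "Bcontfun (T v) \<in> S" using T[OF v] app[OF v] by (simp add: S_def)
    qed
    fix v w assume v: "v \<in> S" and w: "w \<in> S"
    note sv = S[OF v] and sw = S[OF w]
    have cvw: "cos_sym (T v)" "cos_sym (T w)" using T v w by (auto simp: cos_free_def)
    have d: "\<bar>apply_bcontfun v u - apply_bcontfun w u\<bar> \<le> dist v w" for u
      using dist_bounded[of v u w] by (simp add: dist_real_def)
    have "\<bar>lin_op q (\<lambda>u. 1 * T v u + (-1) * T w u) u\<bar> \<le> \<tau> * (100 * cubic_bound c * dist v w)" for u
    proof -
      have "lin_op q (\<lambda>u. 1 * T v u + (-1) * T w u) u = \<tau> * (reduced_rhs c (apply_bcontfun v) u - reduced_rhs c (apply_bcontfun w) u)"
        unfolding lin_op_lincomb[OF cvw] using T[OF v] T[OF w] by (simp add: algebra_simps)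
      moreover have "\<bar>reduced_rhs c (apply_bcontfun v) u - reduced_rhs c (apply_bcontfun w) u\<bar> \<le> 100 * cubic_bound c * dist v w"
        by (rule reduced_rhs_diff(1)[OF _ sv(2) _ sw(2) d]) (use sv sw in \<open>simp_all add: cos_free_def\<close>)
      ultimately show ?thesis using \<tau>(1) by (simp add: abs_mult mult_left_mono)
    qed
    from C(2)[OF cos_free_lincomb[OF conjunct1[OF T[OF v]] conjunct1[OF T[OF w]], of 1 "-1"] this]
    have "\<bar>T v u - T w u\<bar> \<le> C * (\<tau> * (100 * cubic_bound c * dist v w))" for u by simp
    moreover have "C * (\<tau> * (100 * cubic_bound c * dist v w)) \<le> 1/2 * dist v w"
      using mult_right_mono[OF \<tau>(2), of "dist v w"] by (simp add: mult.left_commute mult.assoc)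
    ultimately have "\<bar>T v u - T w u\<bar> \<le> 1/2 * dist v w" for u by (rule order_trans)
    then show "dist (Bcontfun (T v)) (Bcontfun (T w)) \<le> 1/2 * dist v w"
      by (intro dist_bound) (simp add: app v w dist_real_def)
  qed auto
  then obtain v where v: "v \<in> S" "Bcontfun (T v) = v" by blast
  then have "T v = apply_bcontfun v" using app by metis
  with T[OF v(1)] S[OF v(1)] show ?thesis by metis
qed

lemma bifurcating_family:
  assumes "solvable_ratio q"
  shows "\<exists>\<delta>>0. \<exists>z b K. K \<ge> 0 \<and> b 0 = 0 \<and>
    (\<forall>t\<in>{0..\<delta>}. cos_sym (z t) \<and> (\<forall>u. \<bar>z t u\<bar> \<le> 2) \<and> z t 0 \<ge> 1/2 \<and>
       (\<forall>u. lin_op q (z t) u + b t * prim2 (prim2 (z t)) u = t\<^sup>2 * cubic_op c (z t) u)) \<and>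
    (\<forall>t\<in>{0..\<delta>}. \<forall>s\<in>{0..\<delta>}. (\<forall>u. \<bar>z t u - z s u\<bar> \<le> K * \<bar>t\<^sup>2 - s\<^sup>2\<bar>) \<and> \<bar>b t - b s\<bar> \<le> K * \<bar>t\<^sup>2 - s\<^sup>2\<bar>)"
proof -
  obtain C where C: "C \<ge> 0" "\<And>v B u. cos_free v \<Longrightarrow> (\<And>u. \<bar>lin_op q v u\<bar> \<le> B) \<Longrightarrow> \<bar>v u\<bar> \<le> C * B"
    using lin_op_apriori[OF assms] by blast
  define \<Lambda> where "\<Lambda> = cubic_bound c"
  have L0: "\<Lambda> \<ge> 0" unfolding \<Lambda>_def by (rule cubic_bound_nonneg)
  \<comment> \<open>The summand 1 gives t^2 <= 1; the summand 200 C \<Lambda> gives the smallness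
    condition of \<open>fixed_point\<close> with \<tau> = t^2.\<close>
  define \<delta> where "\<delta> = 1 / sqrt (1 + 200 * C * \<Lambda>)"
  have CL: "C * \<Lambda> \<ge> 0" using C L0 by simp
  have \<delta>: "\<delta> > 0" "\<delta>\<^sup>2 = 1 / (1 + 200 * C * \<Lambda>)" using CL by (auto simp: \<delta>_def power_divide)
  have small: "t\<^sup>2 * C * (100 * \<Lambda>) \<le> 1/2" "t\<^sup>2 \<le> 1" if "t \<in> {0..\<delta>}" for t
  proof -
    have t: "t\<^sup>2 \<le> 1 / (1 + 200 * C * \<Lambda>)" using that \<delta>(2) power_mono[of t \<delta> 2] by auto
    have "t\<^sup>2 * (C * \<Lambda>) \<le> 1 / (1 + 200 * C * \<Lambda>) * (C * \<Lambda>)" by (rule mult_right_mono[OF t CL])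
    also have "\<dots> \<le> 1 / 200" using CL by (simp add: field_simps)
    finally show "t\<^sup>2 * C * (100 * \<Lambda>) \<le> 1/2" by simp
    have "1 / (1 + 200 * C * \<Lambda>) \<le> 1" using CL by (simp add: field_simps)
    then show "t\<^sup>2 \<le> 1" using t by linarith
  qed
  have "\<exists>v. cos_free v \<and> (\<forall>u. \<bar>v u\<bar> \<le> 1/2) \<and> (\<forall>u. lin_op q v u = t\<^sup>2 * reduced_rhs c v u)" if "t \<in> {0..\<delta>}" for t
    by (rule fixed_point[OF assms C(1)]) (use C(2) small[OF that] in \<open>auto simp: \<Lambda>_def\<close>)
  then obtain v where v: "\<And>t. t \<in> {0..\<delta>} \<Longrightarrow> cos_free (v t)" "\<And>t u. t \<in> {0..\<delta>} \<Longrightarrow> \<bar>v t u\<bar> \<le> 1/2"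
      "\<And>t u. t \<in> {0..\<delta>} \<Longrightarrow> lin_op q (v t) u = t\<^sup>2 * reduced_rhs c (v t) u"
    by metis
  have vc: "cos_sym (v t)" if "t \<in> {0..\<delta>}" for t using v(1)[OF that] by (simp add: cos_free_def)
  define z where "z = (\<lambda>t u. cos u + v t u)"
  define b where "b = (\<lambda>t. t\<^sup>2 * cos_coeff (cubic_op c (z t)))"
  \<comment> \<open>The first summand serves z. The other two serve b: one for the change of z
    inside the coefficient, one for the change of the factor t^2.\<close>
  define K where "K = 200 * C * \<Lambda> + 2 * \<Lambda> * (200 * C * \<Lambda>) + 4 * \<Lambda>"
  have diff: "(\<forall>u. \<bar>z t u - z s u\<bar> \<le> K * \<bar>t\<^sup>2 - s\<^sup>2\<bar>) \<and> \<bar>b t - b s\<bar> \<le> K * \<bar>t\<^sup>2 - s\<^sup>2\<bar>"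
    if t: "t \<in> {0..\<delta>}" and s: "s \<in> {0..\<delta>}" for t s
  proof -
    define w where "w = (\<lambda>u. 1 * v t u + (-1) * v s u)"
    have w: "cos_free w" unfolding w_def by (rule cos_free_lincomb[OF v(1)[OF t] v(1)[OF s]])
    then have wc: "cos_sym w" by (simp add: cos_free_def)
    \<comment> \<open>The sup norm of the difference itself. It will appear on both sides of the
      estimate, with factor at most 1/2 on the right, and can be absorbed.\<close>
    define D where "D = (SUP u\<in>UNIV. \<bar>w u\<bar>)"
    have w1: "\<bar>w u\<bar> \<le> 1" for u using v(2)[OF t, of u] v(2)[OF s, of u] unfolding w_def by linarith
    have wD: "\<bar>w u\<bar> \<le> D" for u
      unfolding D_def by (rule cSUP_upper) (use w1 in \<open>auto intro!: bdd_aboveI\<close>)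
    have d: "\<bar>v t u - v s u\<bar> \<le> D" for u using wD[of u] by (simp add: w_def)
    note R = reduced_rhs_diff[OF vc[OF t] v(2)[OF t] vc[OF s] v(2)[OF s] d, of c, folded \<Lambda>_def]
    \<comment> \<open>The plain bounds in \<open>reduced_rhs_diff\<close> concern its first
      function, hence a copy with s and t exchanged.\<close>
    note R' = reduced_rhs_diff[OF vc[OF s] v(2)[OF s] vc[OF t] v(2)[OF t], of D c, folded \<Lambda>_def]
    have Rs: "\<bar>reduced_rhs c (v s) u\<bar> \<le> 100 * \<Lambda>" "\<bar>cos_coeff (cubic_op c (z s))\<bar> \<le> 4 * \<Lambda>" for u
      using R'(3,4) d unfolding z_def by (auto simp: abs_minus_commute)
    have "\<bar>lin_op q w u\<bar> \<le> t\<^sup>2 * (100 * \<Lambda> * D) + \<bar>t\<^sup>2 - s\<^sup>2\<bar> * (100 * \<Lambda>)" for u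
    proof -
      have eq: "lin_op q w u = t\<^sup>2 * (reduced_rhs c (v t) u - reduced_rhs c (v s) u) + (t\<^sup>2 - s\<^sup>2) * reduced_rhs c (v s) u"
        unfolding w_def lin_op_lincomb[OF vc[OF t] vc[OF s]] using v(3)[OF t] v(3)[OF s] by (simp add: algebra_simps)
      have "\<bar>lin_op q w u\<bar> \<le> \<bar>t\<^sup>2 * (reduced_rhs c (v t) u - reduced_rhs c (v s) u)\<bar> + \<bar>(t\<^sup>2 - s\<^sup>2) * reduced_rhs c (v s) u\<bar>"
        unfolding eq by (rule abs_triangle_ineq)
      also have "\<dots> \<le> t\<^sup>2 * (100 * \<Lambda> * D) + \<bar>t\<^sup>2 - s\<^sup>2\<bar> * (100 * \<Lambda>)"
        unfolding abs_mult using R(1)[of u] Rs(1)[of u] by (intro add_mono mult_mono) auto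
      finally show ?thesis .
    qed
    then have wb: "\<bar>w u\<bar> \<le> C * (t\<^sup>2 * (100 * \<Lambda> * D) + \<bar>t\<^sup>2 - s\<^sup>2\<bar> * (100 * \<Lambda>))" for u
      by (rule C(2)[OF w])
    have "D \<le> C * (t\<^sup>2 * (100 * \<Lambda> * D) + \<bar>t\<^sup>2 - s\<^sup>2\<bar> * (100 * \<Lambda>))"
      unfolding D_def by (rule cSUP_least) (use wb in \<open>auto simp: D_def\<close>)
    also have "\<dots> = t\<^sup>2 * C * (100 * \<Lambda>) * D + \<bar>t\<^sup>2 - s\<^sup>2\<bar> * (100 * C * \<Lambda>)" by (simp add: algebra_simps)
    also have "\<dots> \<le> 1/2 * D + \<bar>t\<^sup>2 - s\<^sup>2\<bar> * (100 * C * \<Lambda>)"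
      by (rule add_right_mono, rule mult_right_mono[OF small(1)[OF t]]) (use wD[of 0] in linarith)
    finally have D: "D \<le> 200 * C * \<Lambda> * \<bar>t\<^sup>2 - s\<^sup>2\<bar>" by (simp add: algebra_simps)
    have D0: "D \<ge> 0" using wD[of 0] by linarith
    have Kp: "200 * C * \<Lambda> * \<bar>t\<^sup>2 - s\<^sup>2\<bar> \<le> K * \<bar>t\<^sup>2 - s\<^sup>2\<bar>"
      by (rule mult_right_mono) (use C L0 CL in \<open>auto simp: K_def\<close>)
    have 1: "\<bar>z t u - z s u\<bar> \<le> K * \<bar>t\<^sup>2 - s\<^sup>2\<bar>" for u
      using d[of u] D Kp by (simp add: z_def)
    have eq: "b t - b s = t\<^sup>2 * (cos_coeff (cubic_op c (z t)) - cos_coeff (cubic_op c (z s))) + (t\<^sup>2 - s\<^sup>2) * cos_coeff (cubic_op c (z s))"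
      by (simp add: b_def algebra_simps)
    have "\<bar>b t - b s\<bar> \<le> \<bar>t\<^sup>2 * (cos_coeff (cubic_op c (z t)) - cos_coeff (cubic_op c (z s)))\<bar> + \<bar>(t\<^sup>2 - s\<^sup>2) * cos_coeff (cubic_op c (z s))\<bar>"
      unfolding eq by (rule abs_triangle_ineq)
    also have "\<dots> \<le> 1 * (2 * \<Lambda> * D) + \<bar>t\<^sup>2 - s\<^sup>2\<bar> * (4 * \<Lambda>)"
      unfolding abs_mult using R(2) Rs(2) small(2)[OF t] by (intro add_mono mult_mono) (auto simp: z_def)
    also have "\<dots> \<le> 1 * (2 * \<Lambda> * (200 * C * \<Lambda> * \<bar>t\<^sup>2 - s\<^sup>2\<bar>)) + \<bar>t\<^sup>2 - s\<^sup>2\<bar> * (4 * \<Lambda>)"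
      using D L0 by (intro add_mono mult_left_mono) auto
    also have "\<dots> = (2 * \<Lambda> * (200 * C * \<Lambda>) + 4 * \<Lambda>) * \<bar>t\<^sup>2 - s\<^sup>2\<bar>" by (simp add: algebra_simps)
    also have "\<dots> \<le> K * \<bar>t\<^sup>2 - s\<^sup>2\<bar>"
      by (rule mult_right_mono) (use CL in \<open>auto simp: K_def\<close>)
    finally show ?thesis using 1 by blast
  qed
  have sol: "cos_sym (z t) \<and> (\<forall>u. \<bar>z t u\<bar> \<le> 2) \<and> z t 0 \<ge> 1/2 \<and>
       (\<forall>u. lin_op q (z t) u + b t * prim2 (prim2 (z t)) u = t\<^sup>2 * cubic_op c (z t) u)" if t: "t \<in> {0..\<delta>}" for t
  proof -
    note cp = cos_plus[OF vc[OF t] v(2)[OF t]]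
    have "z t 0 \<ge> 1/2" using v(2)[OF t, of 0] unfolding z_def by simp
    moreover have "lin_op q (z t) u + b t * prim2 (prim2 (z t)) u = t\<^sup>2 * cubic_op c (z t) u" for u
    proof -
      have zz: "z t = (\<lambda>u. 1 * cos u + 1 * v t u)" by (simp add: z_def)
      have L: "lin_op q (z t) u = lin_op q (v t) u"
        unfolding zz lin_op_lincomb[OF cos_sym_cos vc[OF t]] by (simp add: lin_op_cos)
      have PP: "prim2 (prim2 (z t)) u = cos u + prim2 (prim2 (v t)) u"
      proof -
        have "prim2 (prim2 cos) = cos" using prim2_lincomb[OF cos_sym_cos cos_sym_cos, of "-1" 0] by (simp add: prim2_cos)
        then show ?thesis
          unfolding zz prim2_lincomb[OF cos_sym_cos vc[OF t]] prim2_lincomb[OF cos_sym_cos[THEN cos_sym_prim2] vc[OF t, THEN cos_sym_prim2]] by simp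
      qed
      have "lin_op q (z t) u + b t * prim2 (prim2 (z t)) u = t\<^sup>2 * reduced_rhs c (v t) u + b t * (cos u + prim2 (prim2 (v t)) u)"
        unfolding L PP v(3)[OF t] ..
      also have "\<dots> = t\<^sup>2 * cubic_op c (z t) u"
        by (simp add: reduced_rhs_def b_def z_def algebra_simps)
      finally show ?thesis .
    qed
    ultimately show ?thesis using cp by (simp add: z_def)
  qed
  have "K \<ge> 0" using C L0 by (simp add: K_def)
  moreover have "b 0 = 0" by (simp add: b_def)
  ultimately show ?thesis using \<delta>(1) sol diff by (intro exI[of _ \<delta>] conjI exI[of _ z] exI[of _ b] exI[of _ K]) auto
qed

section \<open>Passage to the function space\<close>

text \<open>Cuts a function on the line down to the representation used by \<open>Ck\<close>, so
  that derivatives can be computed on the line and transferred.\<close>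

definition zero_ext :: "real \<Rightarrow> (real \<Rightarrow> real) \<Rightarrow> real \<Rightarrow> real" where
  "zero_ext r F = (\<lambda>s. if s \<in> {-r..r} then F s else 0)"

lemma zero_ext_has_deriv:
  assumes "(F has_real_derivative D) (at s)" "s \<in> {-r..r}"
  shows "(zero_ext r F has_vector_derivative D) (at s within {-r..r})"
proof (rule has_vector_derivative_transform[OF assms(2)])
  show "(F has_vector_derivative D) (at s within {-r..r})"
    using assms(1) by (simp add: has_real_derivative_iff_has_vector_derivative has_vector_derivative_at_within)
qed (simp add: zero_ext_def)

lemma der_zero_ext:
  assumes "r > 0" "\<And>k s. k < n \<Longrightarrow> (F k has_real_derivative F (Suc k) s) (at s)" "k \<le> n"
  shows "der r k (zero_ext r (F 0)) = zero_ext r (F k)"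
  using assms(3)
proof (induction k)
  case (Suc k)
  have "ideriv r (zero_ext r (F k)) s = zero_ext r (F (Suc k)) s" for s
  proof (cases "s \<in> {-r..r}")
    case True
    then have "ideriv r (zero_ext r (F k)) s = F (Suc k) s"
      using Suc.prems by (intro ideriv_unique zero_ext_has_deriv assms) auto
    then show ?thesis using True by (simp add: zero_ext_def)
  qed (auto simp: ideriv_def zero_ext_def)
  then show ?case using Suc by auto
qed simp

lemma zero_ext_Ck:
  assumes "r > 0" "\<And>k s. k < n \<Longrightarrow> (F k has_real_derivative F (Suc k) s) (at s)" "continuous_on UNIV (F n)"
  shows "zero_ext r (F 0) \<in> Ck r n"
  unfolding Ck_def
proof (intro CollectI conjI allI impI)
  have D: "der r k (zero_ext r (F 0)) = zero_ext r (F k)" if "k \<le> n" for k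
    by (rule der_zero_ext[where F = F and n = n, OF assms(1) _ that]) (rule assms(2))
  show "zero_ext r (F 0) s = 0" if "s \<notin> {-r..r}" for s using that by (auto simp: zero_ext_def)
  show "der r k (zero_ext r (F 0)) differentiable_on {-r..r}" if "k < n" for k
    unfolding D[OF less_imp_le[OF that]]
    unfolding differentiable_on_def
    by (intro ballI differentiableI_vector[OF zero_ext_has_deriv[OF assms(2)[OF that]]])
  have "continuous_on {-r..r} (zero_ext r (F n)) \<longleftrightarrow> continuous_on {-r..r} (F n)"
    by (rule continuous_on_cong) (auto simp: zero_ext_def)
  then show "continuous_on {-r..r} (der r n (zero_ext r (F 0)))"
    unfolding D[OF order_refl]
    using assms(3) continuous_on_subset by blast
qed

text \<open>Reducing |cos| and |f| together moves the point to a zero of cos in [0, pi/2], which can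
  only be pi/2. Thus any zero of cos, not just the first, can serve as the right end point.\<close>

lemma cos_sym_zero_at:
  assumes "cos_sym f" "cos a = 0" shows "f a = 0"
proof -
  have "\<exists>v\<in>{0..pi/2}. (\<bar>cos a\<bar>, \<bar>f a\<bar>) = (\<bar>cos v\<bar>, \<bar>f v\<bar>)"
    by (rule reduce_dihedral[of "\<lambda>u. (\<bar>cos u\<bar>, \<bar>f u\<bar>)"]) (use assms in \<open>auto simp: cos_sym_def\<close>)
  then obtain v where v: "v \<in> {0..pi/2}" "cos v = 0" "\<bar>f a\<bar> = \<bar>f v\<bar>" using assms(2) by auto
  have "v = pi / 2"
  proof (rule ccontr)
    assume "v \<noteq> pi / 2"
    then have "0 < cos v" using v(1) by (intro cos_gt_zero_pi) auto
    with v(2) show False by simp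
  qed
  then have "f v = 0" using cos_sym_half[OF assms(1)] by (simp only:)
  then show ?thesis using v(3) by simp
qed

definition chain :: "(real \<Rightarrow> real) \<Rightarrow> nat \<Rightarrow> real \<Rightarrow> real" where
  "chain z k = (if k = 0 then prim2 (prim2 z) else if k = 1 then prim (prim2 z) else if k = 2 then prim2 z else if k = 3 then prim z else z)"

lemma chain_simps: "chain z 0 = prim2 (prim2 z)" "chain z (Suc 0) = prim (prim2 z)" "chain z 1 = prim (prim2 z)" "chain z 2 = prim2 z" "chain z 3 = prim z" "chain z 4 = z"
  by (simp_all add: chain_def)

lemma less_4_cases: "(k::nat) < 4 \<Longrightarrow> k = 0 \<or> k = 1 \<or> k = 2 \<or> k = 3" by linarith

lemma le_4_cases: "(k::nat) \<le> 4 \<Longrightarrow> k = 0 \<or> k = 1 \<or> k = 2 \<or> k = 3 \<or> k = 4" by linarith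

lemma chain_deriv:
  assumes "cos_sym z" "k < 4"
  shows "(chain z k has_real_derivative chain z (Suc k) u) (at u)"
  using less_4_cases[OF assms(2)] prim2_deriv[OF assms(1)] prim2_deriv[OF cos_sym_prim2[OF assms(1)]]
  by (auto simp: chain_def)

lemma chain_bound:
  assumes "cos_sym z" "\<And>u. \<bar>z u\<bar> \<le> B" "k \<le> 4"
  shows "\<bar>chain z k u\<bar> \<le> 16 * B"
proof -
  note PB = prim2_bound[OF assms(1,2)] and c = cos_sym_prim2[OF assms(1)]
  have "0 \<le> B" using assms(2)[of 0] by linarith
  then show ?thesis
    using le_4_cases[OF assms(3)] prim2_bound[OF c PB, of u] prim_bound[OF c PB, of u] PB[of u] prim_bound[OF assms(1,2), of u] assms(2)[of u]
    by (elim disjE) (simp_all add: chain_def)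
qed

lemma chain_lincomb:
  assumes "cos_sym f" "cos_sym g"
  shows "chain (\<lambda>u. a * f u + b * g u) k u = a * chain f k u + b * chain g k u"
  using assms by (simp add: chain_def antideriv_lincomb cos_sym_cont)

text \<open>The k-th derivative in s of y(m(s + r)), where y has fourth derivative \<open>z\<close>;
  the ends s = -r and s = r correspond to u = 0 and u = 2rm.\<close>

definition rescaled :: "real \<Rightarrow> real \<Rightarrow> (real \<Rightarrow> real) \<Rightarrow> nat \<Rightarrow> real \<Rightarrow> real" where
  "rescaled r m z k s = m ^ k * chain z k (m * (s + r))"

definition profile :: "real \<Rightarrow> real \<Rightarrow> (real \<Rightarrow> real) \<Rightarrow> real \<Rightarrow> real" where
  "profile r m z = zero_ext r (rescaled r m z 0)"

lemma rescaled_deriv: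
  assumes "cos_sym z" "k < 4"
  shows "(rescaled r m z k has_real_derivative rescaled r m z (Suc k) s) (at s)"
  unfolding rescaled_def [abs_def]
  by (rule derivative_eq_intros DERIV_chain2[OF chain_deriv[OF assms]] refl | simp)+

lemma der_profile: "r > 0 \<Longrightarrow> cos_sym z \<Longrightarrow> k \<le> 4 \<Longrightarrow> der r k (profile r m z) = zero_ext r (rescaled r m z k)"
  unfolding profile_def by (rule der_zero_ext[where n = 4]) (auto intro: rescaled_deriv)

text \<open>Derivatives of odd order are of sine type and vanish at u = 0; those of even order below
  four are of cosine type and vanish at the zero 2rm of cos.\<close>

lemma profile_spaceX:
  assumes "r > 0" "cos_sym z" "cos (2 * r * m) = 0"
  shows "profile r m z \<in> spaceX r"
proof -
  have "profile r m z \<in> Ck r 4"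
    unfolding profile_def
  proof (rule zero_ext_Ck[OF assms(1)])
    show "continuous_on UNIV (rescaled r m z 4)"
      unfolding rescaled_def [abs_def] chain_simps
      by (intro continuous_intros continuous_on_compose2[OF cos_sym_cont[OF assms(2)]]) auto
  qed (rule rescaled_deriv[OF assms(2)])
  moreover have "zero_ext r (rescaled r m z k) (-r) = m ^ k * chain z k 0" "zero_ext r (rescaled r m z k) r = m ^ k * chain z k (2 * r * m)" for k
    using assms(1) by (simp_all add: zero_ext_def rescaled_def mult.commute mult.left_commute flip: mult_2)
  then have "der r k (profile r m z) (-r) = m ^ k * chain z k 0" "der r k (profile r m z) r = m ^ k * chain z k (2 * r * m)" if "k \<le> 4" for k
    using der_profile[OF assms(1,2) that, of m] by simp_all
  note this[of 0] this[of 1] this[of 2] this[of 3]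
  then have "der r 1 (profile r m z) (-r) = 0" "der r 3 (profile r m z) (-r) = 0" "profile r m z r = 0" "der r 2 (profile r m z) r = 0"
    using sin_sym_0[OF sin_sym_prim[OF assms(2)]] sin_sym_0[OF sin_sym_prim[OF cos_sym_prim2[OF assms(2)]]]
      cos_sym_zero_at[OF cos_sym_prim2[OF assms(2)] assms(3)] cos_sym_zero_at[OF cos_sym_prim2[OF cos_sym_prim2[OF assms(2)]] assms(3)]
    by (simp_all add: chain_simps del: funpow.simps(2) One_nat_def)
  ultimately show ?thesis by (simp add: spaceX_def)
qed

lemma normX_profile:
  assumes "r > 0" "m > 0" "cos_sym z" "\<And>u. \<bar>z u\<bar> \<le> B"
  shows "normX r (profile r m z) \<le> (\<Sum>k=0..4. m ^ k * 16) * B"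
  unfolding normX_def sum_distrib_right
proof (rule sum_mono)
  fix k :: nat assume k: "k \<in> {0..4}"
  show "(SUP s\<in>{-r..r}. \<bar>der r k (profile r m z) s\<bar>) \<le> m ^ k * 16 * B"
  proof (rule cSUP_least)
    fix s assume "s \<in> {-r..r}"
    then have "\<bar>der r k (profile r m z) s\<bar> = m ^ k * \<bar>chain z k (m * (s + r))\<bar>"
      using k assms(2) der_profile[OF assms(1,3), of k] by (simp add: zero_ext_def rescaled_def abs_mult)
    also have "\<dots> \<le> m ^ k * (16 * B)"
      using k assms(2) chain_bound[OF assms(3,4)] by (intro mult_left_mono) auto
    finally show "\<bar>der r k (profile r m z) s\<bar> \<le> m ^ k * 16 * B" by simp
  qed (use assms(1) in simp)
qed

lemma profile_lincomb:
  assumes "cos_sym f" "cos_sym g"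
  shows "profile r m (\<lambda>u. a * f u + b * g u) = a *\<^sub>R profile r m f + b *\<^sub>R profile r m g"
  by (rule ext) (simp add: profile_def zero_ext_def rescaled_def chain_lincomb[OF assms] scaleR_fun_def)

text \<open>
  The coefficients of the cubic terms after the substitution \<open>x(s) = t y(m(s + r))\<close> and division by
  \<open>m^4\<close>.
\<close>

definition cubic_coeff :: "real \<Rightarrow> real \<Rightarrow> real \<Rightarrow> nat \<Rightarrow> real" where
  "cubic_coeff m \<alpha> \<gamma> k = (if k = 1 then \<gamma> / m ^ 4 else if k = 2 then 3 * m\<^sup>2 else if k = 3 then 12 * m\<^sup>2
     else if k = 4 then 3 * m\<^sup>2 else - (3/2) * \<alpha>)"

lemma opF_profile:
  assumes "r > 0" "m > 0" "cos_sym z"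
    and eq: "\<And>u. z u + \<alpha> / m\<^sup>2 * prim2 z u + \<beta> / m ^ 4 * prim2 (prim2 z) u = t\<^sup>2 * cubic_op (cubic_coeff m \<alpha> \<gamma>) z u"
  shows "opF r (t *\<^sub>R profile r m z) \<alpha> \<beta> \<gamma> = 0"
proof
  fix s
  have x: "t *\<^sub>R profile r m z = profile r m (\<lambda>u. t * z u)"
    using profile_lincomb[OF assms(3,3), of r m t 0] by simp
  have tc: "cos_sym (\<lambda>u. t * z u)" using cos_sym_lincomb[OF assms(3,3), of t 0] by simp
  have Wt: "chain (\<lambda>u. t * z u) k u = t * chain z k u" for k u
    using chain_lincomb[OF assms(3,3), of t 0] by simp
  have der: "der r k (t *\<^sub>R profile r m z) s = (if s \<in> {-r..r} then m ^ k * (t * chain z k (m * (s + r))) else 0)" if "k \<le> 4" for k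
    unfolding x using der_profile[OF assms(1) tc that] by (simp add: zero_ext_def rescaled_def Wt)
  have der0: "(t *\<^sub>R profile r m z) s = (if s \<in> {-r..r} then t * chain z 0 (m * (s + r)) else 0)"
    using der[of 0] by simp
  show "opF r (t *\<^sub>R profile r m z) \<alpha> \<beta> \<gamma> s = (0 :: real \<Rightarrow> real) s"
  proof (cases "s \<in> {-r..r}")
    case False
    then have "der r k (t *\<^sub>R profile r m z) s = 0" if "k \<le> 4" for k
      using der[OF that] by (simp only: if_False)
    note this[of 1] this[of 2] this[of 3] this[of 4]
    moreover have "(t *\<^sub>R profile r m z) s = 0" using der0 False by (simp only: if_False)
    ultimately show ?thesis unfolding opF_def by (simp del: funpow.simps One_nat_def)
  next
    case True
    define u where "u = m * (s + r)"
    define w0 w1 w2 w3 w4 where "w0 = prim2 (prim2 z) u" and "w1 = prim (prim2 z) u" and "w2 = prim2 z u" and "w3 = prim z u" and "w4 = z u"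
    have d: "der r 1 (t *\<^sub>R profile r m z) s = m * (t * w1)" "der r 2 (t *\<^sub>R profile r m z) s = m\<^sup>2 * (t * w2)"
      "der r 3 (t *\<^sub>R profile r m z) s = m ^ 3 * (t * w3)" "der r 4 (t *\<^sub>R profile r m z) s = m ^ 4 * (t * w4)"
      "(t *\<^sub>R profile r m z) s = t * w0"
      using True der[of 1] der[of 2] der[of 3] der[of 4] der0
      by (simp_all add: chain_simps u_def w0_def w1_def w2_def w3_def w4_def del: funpow.simps One_nat_def)
    have "w4 + \<alpha> / m\<^sup>2 * w2 + \<beta> / m ^ 4 * w0 = t\<^sup>2 * (\<gamma> / m ^ 4 * (w0 * w0 * w0) + 3 * m\<^sup>2 * (w2 * w2 * w2)
       + 12 * m\<^sup>2 * (w1 * w2 * w3) + 3 * m\<^sup>2 * (w1 * w1 * w4) + - (3/2) * \<alpha> * (w1 * w1 * w2))"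
      using eq[of u] by (simp add: cubic_op_def cubic_coeff_def w0_def w1_def w2_def w3_def w4_def)
    \<comment> \<open>Multiplying by m^4 t reverses the normalization in \<open>cubic_coeff\<close>.
      The powers m^6, m^4 and m^0 that remain count the derivatives in each cubic monomial.\<close>
    then have e1: "m ^ 4 * t * (w4 + \<alpha> / m\<^sup>2 * w2 + \<beta> / m ^ 4 * w0) = m ^ 4 * t * (t\<^sup>2 * (\<gamma> / m ^ 4 * (w0 * w0 * w0) + 3 * m\<^sup>2 * (w2 * w2 * w2)
       + 12 * m\<^sup>2 * (w1 * w2 * w3) + 3 * m\<^sup>2 * (w1 * w1 * w4) + - (3/2) * \<alpha> * (w1 * w1 * w2)))" by simp
    have e2: "m ^ 4 * t * (w4 + \<alpha> / m\<^sup>2 * w2 + \<beta> / m ^ 4 * w0) = t * (m ^ 4 * w4 + \<alpha> * m\<^sup>2 * w2 + \<beta> * w0)"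
      using assms(2) by (simp add: field_simps power4_eq_xxxx power2_eq_square)
    have e3: "m ^ 4 * t * (t\<^sup>2 * (\<gamma> / m ^ 4 * (w0 * w0 * w0) + 3 * m\<^sup>2 * (w2 * w2 * w2)
       + 12 * m\<^sup>2 * (w1 * w2 * w3) + 3 * m\<^sup>2 * (w1 * w1 * w4) + - (3/2) * \<alpha> * (w1 * w1 * w2)))
      = t ^ 3 * (\<gamma> * w0 ^ 3 + 3 * m ^ 6 * w2 ^ 3 + 12 * m ^ 6 * (w1 * w2 * w3) + 3 * m ^ 6 * (w1\<^sup>2 * w4) - 3/2 * \<alpha> * m ^ 4 * (w1\<^sup>2 * w2))"
      using assms(2) by (simp add: distrib_left right_diff_distrib) (simp add: field_simps eval_nat_numeral)
    have key: "t * (m ^ 4 * w4 + \<alpha> * m\<^sup>2 * w2 + \<beta> * w0) =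
      t ^ 3 * (\<gamma> * w0 ^ 3 + 3 * m ^ 6 * w2 ^ 3 + 12 * m ^ 6 * (w1 * w2 * w3) + 3 * m ^ 6 * (w1\<^sup>2 * w4) - 3/2 * \<alpha> * m ^ 4 * (w1\<^sup>2 * w2))"
      by (rule trans[OF e2[symmetric] trans[OF e1 e3]])
    have "opF r (t *\<^sub>R profile r m z) \<alpha> \<beta> \<gamma> s = t * (m ^ 4 * w4 + \<alpha> * m\<^sup>2 * w2 + \<beta> * w0) -
      t ^ 3 * (\<gamma> * w0 ^ 3 + 3 * m ^ 6 * w2 ^ 3 + 12 * m ^ 6 * (w1 * w2 * w3) + 3 * m ^ 6 * (w1\<^sup>2 * w4) - 3/2 * \<alpha> * m ^ 4 * (w1\<^sup>2 * w2))"
      unfolding opF_def d by (simp add: field_simps eval_nat_numeral)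
    then show ?thesis using key by simp
  qed
qed

text \<open>Detected by the fourth derivative at the left end, which is m^4 z(0).\<close>

lemma profile_nonzero:
  assumes "r > 0" "cos_sym z" "z 0 \<noteq> 0" "t \<noteq> 0" "m > 0"
  shows "t *\<^sub>R profile r m z \<noteq> 0"
proof
  assume "t *\<^sub>R profile r m z = 0"
  then have "profile r m z = 0" using assms(4) by simp
  then have "der r 4 (profile r m z) (-r) = 0" using der_zero[OF assms(1), of 4] by simp
  then show False using der_profile[OF assms(1,2), of 4 m] assms by (simp add: zero_ext_def rescaled_def chain_simps)
qed

section \<open>From a curve of solutions to a branching point\<close>

lemma continuous_map_to_top_total:
  assumes r: "r > 0"
    and x: "\<And>t. t \<in> S \<Longrightarrow> x t \<in> spaceX r" "\<And>s t. s \<in> S \<Longrightarrow> t \<in> S \<Longrightarrow> normX r (x t - x s) \<le> K * \<bar>t - s\<bar>"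
    and p: "continuous_on S p" "p ` S \<subseteq> Rpos3"
  shows "continuous_map (top_of_set (S :: real set)) (top_total r) (\<lambda>t. (x t, p t))"
proof -
  interpret Metric_space "spaceX r" "distX r" by (rule Metric_space_X[OF r])
  have "continuous_map (top_of_set S) mtopology x"
    unfolding continuous_map_to_metric
  proof (intro ballI allI impI)
    fix t \<epsilon> :: real assume t: "t \<in> topspace (top_of_set S)" and \<epsilon>: "0 < \<epsilon>"
    define d where "d = \<epsilon> / (\<bar>K\<bar> + 1)"
    have d: "d > 0" using \<epsilon> by (simp add: d_def add_nonneg_pos)
    show "\<exists>U. openin (top_of_set S) U \<and> t \<in> U \<and> (\<forall>y\<in>U. x y \<in> mball (x t) \<epsilon>)"
    proof (intro exI[of _ "S \<inter> ball t d"] conjI ballI)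
      show "openin (top_of_set S) (S \<inter> ball t d)" by (simp add: openin_open_Int)
      show "t \<in> S \<inter> ball t d" using t d by simp
      fix y assume y: "y \<in> S \<inter> ball t d"
      have ts: "t \<in> S" using t by simp
      have "distX r (x t) (x y) \<le> K * \<bar>t - y\<bar>"
        using x(1)[of t] x(1)[of y] x(2)[of y t] y ts by (simp add: distX_def)
      also have "\<dots> \<le> \<bar>K\<bar> * \<bar>t - y\<bar>" by (intro mult_right_mono) auto
      also have "\<dots> \<le> \<bar>K\<bar> * d" using y by (intro mult_left_mono) (auto simp: dist_real_def)
      also have "\<dots> < \<epsilon>" using \<epsilon> by (simp add: d_def field_simps)
      finally show "x y \<in> mball (x t) \<epsilon>" using x(1) y ts by simp
    qed
  qed
  moreover have "continuous_map (top_of_set S) (top_of_set Rpos3) p"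
    using p by (auto simp: continuous_map_in_subtopology)
  ultimately show ?thesis
    unfolding top_total_def topX_def by (intro continuous_map_pairedI)
qed

text \<open>The arc is the continuous image of a compact interval: connected, and compact, hence
  closed because the total space is Hausdorff. Small positive t supplies the nontrivial solutions
  near \<open>g 0\<close>.\<close>

lemma branching_from_curve:
  fixes \<delta> :: real
  assumes r: "r > 0" and \<delta>: "\<delta> > 0"
    and g: "continuous_map (top_of_set {0..\<delta>}) (top_total r) g"
    and p: "g 0 \<in> trivial_family" and sol: "\<And>t. t \<in> {0<..\<delta>} \<Longrightarrow> nontrivial_solution r (g t)"
  shows "branching_point r (g 0)"
proof -
  have ne: "g t \<noteq> g 0" if "t \<in> {0<..\<delta>}" for t
    using sol[OF that] p by (auto simp: nontrivial_solution_def)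
  have "bifurcation_point r (g 0)"
    unfolding bifurcation_point_def
  proof (intro conjI p allI impI)
    fix U assume U: "openin (top_total r) U \<and> g 0 \<in> U"
    then have "openin (top_of_set {0..\<delta>}) {t \<in> topspace (top_of_set {0..\<delta>}). g t \<in> U}"
      using openin_continuous_map_preimage[OF g] by blast
    then obtain V where V: "open V" "{t \<in> topspace (top_of_set {0..\<delta>}). g t \<in> U} = {0..\<delta>} \<inter> V"
      unfolding openin_open by blast
    have "0 \<in> {0..\<delta>} \<inter> V" using U \<delta> unfolding V(2)[symmetric] by simp
    then obtain e where e: "e > 0" "ball 0 e \<subseteq> V" using V(1) open_contains_ball by blast
    define t where "t = min \<delta> (e/2)"
    have t: "t \<in> {0<..\<delta>}" using \<delta> e(1) by (simp add: t_def)
    have "t \<in> ball 0 e" using t e(1) by (auto simp: t_def dist_real_def)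
    then have "t \<in> {0..\<delta>} \<inter> V" using t e by auto
    then have "g t \<in> U" unfolding V(2)[symmetric] by simp
    then show "\<exists>q\<in>U. nontrivial_solution r q" using sol[OF t] by blast
  qed
  moreover have "closedin (top_total r) (g ` {0..\<delta>})"
  proof (rule compactin_imp_closedin)
    show "Hausdorff_space (top_total r)"
      unfolding top_total_def topX_def
      using Metric_space.Hausdorff_space_mtopology[OF Metric_space_X[OF r]]
      by (auto simp: Hausdorff_space_prod_topology intro!: Hausdorff_space_subtopology)
    show "compactin (top_total r) (g ` {0..\<delta>})"
      by (rule image_compactin[OF _ g]) (simp add: compactin_subtopology)
  qed
  moreover have "connectedin (top_total r) (g ` {0..\<delta>})"
    by (rule connectedin_continuous_map_image[OF g]) (simp add: connectedin_subtopology)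
  moreover have "g 0 \<in> g ` {0..\<delta>}" "g \<delta> \<in> g ` {0..\<delta>}" using \<delta> by auto
  moreover have "g ` {0..\<delta>} \<noteq> {g 0}" using ne[of \<delta>] \<delta> by auto
  moreover have "nontrivial_solution r q" if "q \<in> g ` {0..\<delta>} - {g 0}" for q
  proof -
    obtain t where t: "t \<in> {0..\<delta>}" "q = g t" "q \<noteq> g 0" using \<open>q \<in> g ` {0..\<delta>} - {g 0}\<close> by blast
    then have "t \<in> {0<..\<delta>}" by (cases "t = 0") auto
    then show ?thesis using sol t by blast
  qed
  ultimately show ?thesis unfolding branching_point_def by blast
qed

section \<open>Modes of the linear problem and their branches\<close>

text \<open>These are the frequencies for which cos(m(s + r)) lies in the kernel: the cosine
  condition gives the boundary values at s = r, the quartic is the characteristic equation.\<close>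

definition mode :: "real \<Rightarrow> real \<Rightarrow> real \<Rightarrow> real \<Rightarrow> bool" where
  "mode r \<alpha> \<beta> m \<longleftrightarrow> m > 0 \<and> cos (2 * r * m) = 0 \<and> m ^ 4 - \<alpha> * m\<^sup>2 + \<beta> = 0"

lemma mode_branching:
  assumes r: "r > 0" and pos: "\<alpha> > 0" "\<beta> > 0" "\<gamma> > 0" and m: "mode r \<alpha> \<beta> m" and solvable_ratio: "solvable_ratio (\<beta> / m ^ 4)"
  shows "branching_point r (0, \<alpha>, \<beta>, \<gamma>)"
proof -
  define q where "q = \<beta> / m ^ 4"
  have m0: "m > 0" "cos (2 * r * m) = 0" and ch: "m ^ 4 - \<alpha> * m\<^sup>2 + \<beta> = 0" using m by (auto simp: mode_def)
  have q: "q > 0" "\<beta> = m ^ 4 * q" using pos m0 by (auto simp: q_def)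
  have m4: "m ^ 4 = m\<^sup>2 * m\<^sup>2" by (simp add: power4_eq_xxxx power2_eq_square)
  \<comment> \<open>The squared characteristic frequencies are m^2 and q m^2, with product \<beta>
    and sum \<alpha>; so 1 + q is the coefficient of y'' after rescaling.\<close>
  have "m\<^sup>2 * (m\<^sup>2 - \<alpha> + m\<^sup>2 * q) = 0" using ch unfolding q(2) m4 by (simp add: algebra_simps)
  then have "m\<^sup>2 = 0 \<or> m\<^sup>2 - \<alpha> + m\<^sup>2 * q = 0" by (rule mult_eq_0_iff[THEN iffD1])
  then have "\<alpha> = m\<^sup>2 * (1 + q)" using m0(1) by (auto simp: algebra_simps)
  then have q1: "1 + q = \<alpha> / m\<^sup>2" using m0 by simp
  obtain \<delta>0 z b K where \<delta>0: "\<delta>0 > 0" and K: "K \<ge> 0" "b 0 = 0"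
    and z: "\<And>t. t \<in> {0..\<delta>0} \<Longrightarrow> cos_sym (z t)" "\<And>t u. t \<in> {0..\<delta>0} \<Longrightarrow> \<bar>z t u\<bar> \<le> 2" "\<And>t. t \<in> {0..\<delta>0} \<Longrightarrow> z t 0 \<ge> 1/2"
      "\<And>t u. t \<in> {0..\<delta>0} \<Longrightarrow> lin_op q (z t) u + b t * prim2 (prim2 (z t)) u = t\<^sup>2 * cubic_op (cubic_coeff m \<alpha> \<gamma>) (z t) u"
    and lip: "\<And>s t u. t \<in> {0..\<delta>0} \<Longrightarrow> s \<in> {0..\<delta>0} \<Longrightarrow> \<bar>z t u - z s u\<bar> \<le> K * \<bar>t\<^sup>2 - s\<^sup>2\<bar>"
      "\<And>s t u. t \<in> {0..\<delta>0} \<Longrightarrow> s \<in> {0..\<delta>0} \<Longrightarrow> \<bar>b t - b s\<bar> \<le> K * \<bar>t\<^sup>2 - s\<^sup>2\<bar>"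
    using bifurcating_family[OF solvable_ratio[folded q_def], of "cubic_coeff m \<alpha> \<gamma>"] by (elim exE conjE) blast
  \<comment> \<open>The bound 1 makes t^2 Lipschitz with constant 2; the last entry keeps |b t|
    below q, so that \<beta> stays positive along the curve.\<close>
  define \<delta> where "\<delta> = Min {\<delta>0, 1, q / (2 * (K + 1))}"
  have \<delta>: "\<delta> > 0" "\<delta> \<le> \<delta>0" "\<delta> \<le> 1" "\<delta> \<le> q / (2 * (K + 1))"
    using \<delta>0 q K by (auto simp: \<delta>_def)
  have sub: "t \<in> {0..\<delta>0}" "\<bar>t\<bar> \<le> 1" if "t \<in> {0..\<delta>}" for t using that \<delta> by auto
  have sq: "\<bar>t\<^sup>2 - s\<^sup>2\<bar> \<le> 2 * \<bar>t - s\<bar>" if "t \<in> {0..\<delta>}" "s \<in> {0..\<delta>}" for s t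
  proof -
    have "t\<^sup>2 - s\<^sup>2 = (t + s) * (t - s)" by (simp add: power2_eq_square algebra_simps)
    moreover have "\<bar>t + s\<bar> \<le> 2" using sub[OF that(1)] sub[OF that(2)] by linarith
    ultimately show ?thesis by (simp add: abs_mult mult_right_mono)
  qed
  have Ksq: "K * \<bar>t\<^sup>2 - s\<^sup>2\<bar> \<le> 2 * K * \<bar>t - s\<bar>" if "t \<in> {0..\<delta>}" "s \<in> {0..\<delta>}" for s t
    using mult_left_mono[OF sq[OF that] K(1)] by simp
  define x where "x = (\<lambda>t. t *\<^sub>R profile r m (z t))"
  define p where "p = (\<lambda>t. (\<alpha>, m ^ 4 * (q + b t), \<gamma>))"
  have xX: "x t \<in> spaceX r" if "t \<in> {0..\<delta>}" for t
    unfolding x_def by (intro subspace_scale subspace_spaceX profile_spaceX r z sub that m0)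
  have xlip: "normX r (x t - x s) \<le> (\<Sum>k=0..4. m ^ k * 16) * (2 * K + 2) * \<bar>t - s\<bar>" if t: "t \<in> {0..\<delta>}" and s: "s \<in> {0..\<delta>}" for s t
  proof -
    let ?w = "\<lambda>u. t * z t u + (-s) * z s u"
    note zc = z(1)[OF sub(1)[OF t]] z(1)[OF sub(1)[OF s]]
    have x: "x t - x s = profile r m ?w" unfolding x_def profile_lincomb[OF zc] by simp
    have "\<bar>?w u\<bar> \<le> (2 * K + 2) * \<bar>t - s\<bar>" for u
    proof -
      have eq: "?w u = t * (z t u - z s u) + (t - s) * z s u" by (simp add: algebra_simps)
      have "\<bar>?w u\<bar> \<le> \<bar>t * (z t u - z s u)\<bar> + \<bar>(t - s) * z s u\<bar>" unfolding eq by (rule abs_triangle_ineq)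
      also have "\<dots> \<le> 1 * (2 * K * \<bar>t - s\<bar>) + \<bar>t - s\<bar> * 2"
        unfolding abs_mult
        using lip(1)[OF sub(1)[OF t] sub(1)[OF s], of u] Ksq[OF t s] sub(2)[OF t] z(2)[OF sub(1)[OF s], of u]
        by (intro add_mono mult_mono) auto
      also have "\<dots> = (2 * K + 2) * \<bar>t - s\<bar>" by (simp add: algebra_simps)
      finally show ?thesis .
    qed
    from normX_profile[OF r m0(1) cos_sym_lincomb[OF zc] this] show ?thesis unfolding x by (simp add: mult.assoc)
  qed
  have b: "q + b t > 0" if "t \<in> {0..\<delta>}" for t
  proof -
    have z0: "0 \<in> {0..\<delta>}" using \<delta> by simp
    have "\<bar>b t\<bar> \<le> K * \<bar>t\<^sup>2 - 0\<^sup>2\<bar>" using lip(2)[OF sub(1)[OF that] sub(1)[OF z0]] K by simp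
    also have "\<dots> \<le> 2 * K * \<bar>t - 0\<bar>" by (rule Ksq[OF that z0])
    also have "\<dots> \<le> 2 * K * (q / (2 * (K + 1)))" using that \<delta>(4) K by (intro mult_left_mono) auto
    also have "\<dots> < q" using q K by (simp add: field_simps)
    finally show ?thesis by linarith
  qed
  have cb: "continuous_on {0..\<delta>} b"
  proof (rule continuous_onI)
    fix t e :: real assume t: "t \<in> {0..\<delta>}" and e: "0 < e"
    show "\<exists>d>0. \<forall>s\<in>{0..\<delta>}. dist s t < d \<longrightarrow> dist (b s) (b t) \<le> e"
    proof (intro exI[of _ "e / (2 * K + 1)"] conjI ballI impI)
      show "0 < e / (2 * K + 1)" using e K by simp
      fix s assume s: "s \<in> {0..\<delta>}" "dist s t < e / (2 * K + 1)"
      have "\<bar>b s - b t\<bar> \<le> 2 * K * \<bar>s - t\<bar>"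
        using lip(2)[OF sub(1)[OF s(1)] sub(1)[OF t]] Ksq[OF s(1) t] by linarith
      also have "\<dots> \<le> 2 * K * (e / (2 * K + 1))" using s(2) K by (intro mult_left_mono) (auto simp: dist_real_def)
      also have "\<dots> \<le> e" using e K by (simp add: field_simps)
      finally show "dist (b s) (b t) \<le> e" by (simp add: dist_real_def)
    qed
  qed
  have pR: "p t \<in> Rpos3" if "t \<in> {0..\<delta>}" for t using b[OF that] pos m0 by (simp add: p_def Rpos3_def)
  have cont: "continuous_map (top_of_set {0..\<delta>}) (top_total r) (\<lambda>t. (x t, p t))"
    using r xX xlip
  proof (rule continuous_map_to_top_total)
    show "continuous_on {0..\<delta>} p" unfolding p_def by (intro continuous_intros cb)
    show "p ` {0..\<delta>} \<subseteq> Rpos3" using pR by blast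
  qed
  have "branching_point r (x 0, p 0)"
  proof (rule branching_from_curve[OF r \<delta>(1) cont])
    show "(x 0, p 0) \<in> trivial_family"
      using pR[of 0] \<delta>(1) by (simp add: x_def trivial_family_def)
    fix t assume t: "t \<in> {0<..\<delta>}"
    then have t': "t \<in> {0..\<delta>}" by simp
    note zc = z(1)[OF sub(1)[OF t']]
    have "opF r (t *\<^sub>R profile r m (z t)) \<alpha> (m ^ 4 * (q + b t)) \<gamma> = 0"
    proof (rule opF_profile[OF r m0(1) zc])
      fix u
      have "m ^ 4 * (q + b t) / m ^ 4 = q + b t" using m0 by simp
      then show "z t u + \<alpha> / m\<^sup>2 * prim2 (z t) u + m ^ 4 * (q + b t) / m ^ 4 * prim2 (prim2 (z t)) u = t\<^sup>2 * cubic_op (cubic_coeff m \<alpha> \<gamma>) (z t) u"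
        unfolding z(4)[OF sub(1)[OF t'], symmetric] lin_op_def q1[symmetric] by (simp add: algebra_simps)
    qed
    moreover have "x t \<noteq> 0"
      unfolding x_def by (rule profile_nonzero[OF r zc]) (use z(3)[OF sub(1)[OF t']] t m0 in auto)
    ultimately show "nontrivial_solution r (x t, p t)"
      using xX[OF t'] pR[OF t']
      by (simp add: nontrivial_solution_def is_solution_def trivial_family_def p_def x_def)
  qed
  then show ?thesis using K(2) q(2) by (simp add: x_def p_def)
qed

text \<open>
  The other characteristic frequency is \<open>k m\<close> with \<open>k = sqrt \<beta> / m^2\<close>. If \<open>m\<close> violates solvability, then
  \<open>k > 1\<close> is an odd integer, so \<open>k m\<close> is itself a mode, and the ratio seen from there is \<open>1/k^2\<close>.
\<close>

lemma mode_exists_solvable_ratio: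
  assumes "r > 0" "\<beta> > 0" "mode r \<alpha> \<beta> m"
  shows "\<exists>m'. mode r \<alpha> \<beta> m' \<and> solvable_ratio (\<beta> / m' ^ 4)"
proof (cases "solvable_ratio (\<beta> / m ^ 4)")
  case True
  then show ?thesis using assms(3) by blast
next
  case False
  have m: "m > 0" "cos (2 * r * m) = 0" "m ^ 4 - \<alpha> * m\<^sup>2 + \<beta> = 0" using assms(3) by (auto simp: mode_def)
  have m4: "m ^ 4 = m\<^sup>2 * m\<^sup>2" by (simp add: power4_eq_xxxx power2_eq_square)
  define k where "k = sqrt (\<beta> / m ^ 4)"
  have k0: "k > 0" "k\<^sup>2 = \<beta> / m ^ 4" using assms(2) m by (auto simp: k_def)
  have k1: "k \<noteq> 1" and ck: "cos (k * (pi / 2)) = 0"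
    using False assms(2) m k0(2) by (auto simp: solvable_ratio_def k_def)
  from ck obtain i where i: "odd i" "k * (pi / 2) = of_int i * (pi / 2)" using cos_zero_iff_int by blast
  then have ki: "k = of_int i" by simp
  have k3: "k > 1"
    using k0(1) k1 ki by (metis int_one_le_iff_zero_less of_int_0_less_iff of_int_1_less_iff of_int_1 order_le_less)
  from m(2) obtain j where j: "odd j" "2 * r * m = of_int j * (pi / 2)" using cos_zero_iff_int by blast
  define m' where "m' = k * m"
  have "2 * r * m' = of_int (i * j) * (pi / 2)" using j(2) ki by (simp add: m'_def algebra_simps)
  moreover have "odd (i * j)" using i j by simp
  ultimately have c: "cos (2 * r * m') = 0" using cos_zero_iff_int by blast
  have \<beta>: "\<beta> = k\<^sup>2 * m ^ 4" using k0 m by simp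
  have "m\<^sup>2 * (m\<^sup>2 - \<alpha> + k\<^sup>2 * m\<^sup>2) = 0" using m(3) unfolding \<beta> m4 by (simp add: algebra_simps)
  then have \<alpha>: "\<alpha> = m\<^sup>2 + k\<^sup>2 * m\<^sup>2" using m(1) by simp
  have "m' ^ 4 - \<alpha> * m'\<^sup>2 + \<beta> = 0"
    unfolding \<alpha> \<beta> m'_def by (simp add: power_mult_distrib power4_eq_xxxx power2_eq_square algebra_simps)
  then have "mode r \<alpha> \<beta> m'" using c m k0 by (simp add: mode_def m'_def)
  moreover have "\<beta> / m' ^ 4 = (1 / k)\<^sup>2"
    using m(1) k0(1) unfolding \<beta> m'_def by (simp add: power_mult_distrib power4_eq_xxxx power2_eq_square)
  then have sq: "sqrt (\<beta> / m' ^ 4) = 1 / k" using k0 by (simp add: real_sqrt_divide)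
  have "0 < cos (1 / k * (pi / 2))"
  proof (rule cos_gt_zero_pi)
    have "1 / k * (pi / 2) > 0" using k0(1) by simp
    then show "- (pi / 2) < 1 / k * (pi / 2)" using pi_gt_zero by linarith
    have "1 / k < 1" using k3 by simp
    then show "1 / k * (pi / 2) < pi / 2" using mult_strict_right_mono[of "1/k" 1 "pi/2"] pi_gt_zero by simp
  qed
  then have "solvable_ratio (\<beta> / m' ^ 4)" using assms(2) m k0 sq by (simp add: solvable_ratio_def m'_def)
  ultimately show ?thesis by blast
qed

section \<open>Absence of bifurcation\<close>

lemma der_has_deriv:
  assumes "x \<in> Ck r n" "k < n" "s \<in> {-r..r}"
  shows "((\<lambda>s. complex_of_real (der r k x s)) has_vector_derivative of_real (der r (Suc k) x s)) (at s within {-r..r})"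
  using assms has_derivative_ideriv[of "der r k x" r s]
  by (intro has_vector_derivative_of_real) (simp add: Ck_def has_real_derivative_iff_has_vector_derivative)

definition lin_part :: "real \<Rightarrow> real \<Rightarrow> real \<Rightarrow> (real \<Rightarrow> real) \<Rightarrow> real \<Rightarrow> real" where
  "lin_part r \<alpha> \<beta> x s = der r 4 x s + \<alpha> * der r 2 x s + \<beta> * x s"

text \<open>The linear part is (D^2 + p)(D^2 + q)x. With g = x'' + q x this is g'' + p g followed by
  x'' + q x = g, and the conditions on x' and x''' at -r give both oscillators their Neumann
  condition.\<close>

lemma lin_part_factorization:
  fixes p q :: complex
  assumes x: "x \<in> spaceX r" and pq: "p + q = of_real \<alpha>" "p * q = of_real \<beta>"
    and B: "\<And>s. s \<in> {-r..r} \<Longrightarrow> \<bar>lin_part r \<alpha> \<beta> x s\<bar> \<le> B"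
  defines "g \<equiv> \<lambda>s. complex_of_real (der r 2 x s) + q * of_real (x s)"
    and "g1 \<equiv> \<lambda>s. complex_of_real (der r 3 x s) + q * of_real (der r 1 x s)"
  shows "forced_oscillator (-r) r (csqrt p) g g1 (\<lambda>s. of_real (lin_part r \<alpha> \<beta> x s)) B"
    and "(\<And>s. s \<in> {-r..r} \<Longrightarrow> norm (g s) \<le> D) \<Longrightarrow>
      forced_oscillator (-r) r (csqrt q) (\<lambda>s. of_real (x s)) (\<lambda>s. of_real (der r 1 x s)) g D"
proof -
  have C: "x \<in> Ck r 4" and bc: "der r 1 x (-r) = 0" "der r 3 x (-r) = 0" using x by (auto simp: spaceX_def)
  have d: "((\<lambda>s. complex_of_real (x s)) has_vector_derivative of_real (der r 1 x s)) (at s within {-r..r})"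
    "((\<lambda>s. complex_of_real (der r 1 x s)) has_vector_derivative of_real (der r 2 x s)) (at s within {-r..r})"
    "((\<lambda>s. complex_of_real (der r 2 x s)) has_vector_derivative of_real (der r 3 x s)) (at s within {-r..r})"
    "((\<lambda>s. complex_of_real (der r 3 x s)) has_vector_derivative of_real (der r 4 x s)) (at s within {-r..r})"
    if "s \<in> {-r..r}" for s
    using der_has_deriv[OF C _ that, of 0] der_has_deriv[OF C _ that, of 1] der_has_deriv[OF C _ that, of 2] der_has_deriv[OF C _ that, of 3]
    by (simp_all add: eval_nat_numeral)
  have q2: "q * of_real (der r 2 x s) + p * (of_real (der r 2 x s) + q * of_real (x s)) =
      of_real \<alpha> * of_real (der r 2 x s) + of_real \<beta> * of_real (x s)" for s
    unfolding pq[symmetric] by (simp add: algebra_simps)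
  have dg: "(g has_vector_derivative g1 s) (at s within {-r..r})" if "s \<in> {-r..r}" for s
    unfolding g_def g1_def by (intro derivative_intros d that)
  have dg1: "(g1 has_vector_derivative of_real (lin_part r \<alpha> \<beta> x s) - (csqrt p)\<^sup>2 * g s) (at s within {-r..r})" if "s \<in> {-r..r}" for s
  proof -
    have "(g1 has_vector_derivative of_real (der r 4 x s) + q * of_real (der r 2 x s)) (at s within {-r..r})"
      unfolding g1_def by (intro derivative_intros d that)
    moreover have "of_real (lin_part r \<alpha> \<beta> x s) - (csqrt p)\<^sup>2 * g s = of_real (der r 4 x s) + q * of_real (der r 2 x s)"
      using q2[of s] unfolding lin_part_def g_def power2_csqrt of_real_add of_real_mult by (simp add: algebra_simps)
    ultimately show ?thesis by simp
  qed
  show "forced_oscillator (-r) r (csqrt p) g g1 (\<lambda>s. of_real (lin_part r \<alpha> \<beta> x s)) B"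
    unfolding forced_oscillator_def using dg dg1 B bc by (simp add: g1_def)
  assume D: "\<And>s. s \<in> {-r..r} \<Longrightarrow> norm (g s) \<le> D"
  have "g s - (csqrt q)\<^sup>2 * of_real (x s) = of_real (der r 2 x s)" for s
    by (simp add: g_def power2_csqrt)
  then show "forced_oscillator (-r) r (csqrt q) (\<lambda>s. of_real (x s)) (\<lambda>s. of_real (der r 1 x s)) g D"
    unfolding forced_oscillator_def using d(1,2) D bc by simp
qed

lemma exists_complex_roots:
  fixes \<alpha> \<beta> :: real
  obtains p q :: complex where "p + q = of_real \<alpha>" "p * q = of_real \<beta>"
proof -
  define D where "D = csqrt (of_real (\<alpha>\<^sup>2 - 4 * \<beta>))"
  have D: "D * D = of_real \<alpha> * of_real \<alpha> - 4 * of_real \<beta>"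
    using power2_csqrt[of "of_real (\<alpha>\<^sup>2 - 4 * \<beta>)"] by (simp add: D_def power2_eq_square)
  show ?thesis
  proof (rule that)
    show "(of_real \<alpha> + D) / 2 + (of_real \<alpha> - D) / 2 = of_real \<alpha>" by (simp add: field_simps)
    show "(of_real \<alpha> + D) / 2 * ((of_real \<alpha> - D) / 2) = of_real \<beta>" using D by (simp add: field_simps)
  qed
qed

text \<open>Zero forcing and zero initial value annihilate first g = x'' + q x and then x; both
  frequencies are nonzero because p q = \<beta> > 0.\<close>

lemma kernelN_determined:
  assumes r: "r > 0" and \<beta>: "\<beta> > 0" and x: "x \<in> kernelN r \<alpha> \<beta>" and init: "x (-r) = 0" "der r 2 x (-r) = 0"
  shows "x = 0"
proof -
  obtain p q :: complex where pq: "p + q = of_real \<alpha>" "p * q = of_real \<beta>" by (rule exists_complex_roots)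
  have nz: "csqrt p \<noteq> 0" "csqrt q \<noteq> 0" using pq(2) \<beta> by auto
  have xX: "x \<in> spaceX r" and L: "\<And>s. s \<in> {-r..r} \<Longrightarrow> \<bar>lin_part r \<alpha> \<beta> x s\<bar> \<le> 0"
    using x by (auto simp: kernelN_def lin_part_def)
  have rr: "-r \<le> r" using r by simp
  note fac = lin_part_factorization[OF xX pq L]
  have g: "complex_of_real (der r 2 x s) + q * of_real (x s) = 0" if s: "s \<in> {-r..r}" for s
    using forced_oscillator_bound[OF rr, of "csqrt p"] fac(1) s init nz by fastforce
  have "complex_of_real (x s) = 0" if s: "s \<in> {-r..r}" for s
    using forced_oscillator_bound[OF rr, of "csqrt q"] fac(2)[of 0] g s init nz by fastforce
  moreover have "x s = 0" if "s \<notin> {-r..r}" for s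
    using der_outside[OF spaceX_Ck[OF xX] that, of 0] by simp
  ultimately show "x = 0" by (metis ext of_real_eq_0_iff zero_fun_def)
qed

text \<open>The complex cosine has only real zeros, so a resonant square root of a characteristic
  root is real. It is nonzero since \<beta> > 0, and its absolute value is a mode.\<close>

lemma mode_of_resonance:
  assumes r: "r > 0" and \<beta>: "\<beta> > 0" and p: "p\<^sup>2 - of_real \<alpha> * p + of_real \<beta> = 0"
    and res: "cos (csqrt p * of_real (r - - r)) = 0"
  shows "\<exists>m. mode r \<alpha> \<beta> m"
proof -
  obtain n :: int where n: "csqrt p * of_real (r - - r) = of_real (of_int n * pi) + of_real pi / 2"
    using res unfolding cos_eq_0 by auto
  define \<rho> where "\<rho> = (of_int n * pi + pi / 2) / (2 * r)"
  have "csqrt p * of_real (2 * r) = of_real (of_int n * pi + pi / 2)" using n by simp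
  then have w: "csqrt p = of_real \<rho>" using r by (simp add: \<rho>_def field_simps)
  then have p2: "p = of_real (\<rho>\<^sup>2)" using power2_csqrt[of p] by simp
  have "complex_of_real ((\<rho>\<^sup>2)\<^sup>2 - \<alpha> * \<rho>\<^sup>2 + \<beta>) = 0" using p unfolding p2 by simp
  then have ch: "(\<rho>\<^sup>2)\<^sup>2 - \<alpha> * \<rho>\<^sup>2 + \<beta> = 0" by (simp only: of_real_eq_0_iff)
  then have "\<rho> \<noteq> 0" using \<beta> by auto
  moreover have "cos (2 * r * \<rho>) = 0"
  proof -
    have "complex_of_real (cos (2 * r * \<rho>)) = cos (csqrt p * of_real (r - - r))"
      unfolding w by (simp add: mult.commute flip: cos_of_real)
    then show ?thesis using res by (simp only: of_real_eq_0_iff)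
  qed
  then have "cos (2 * r * \<bar>\<rho>\<bar>) = 0" using cos_minus[of "2 * r * \<rho>"] by (auto simp: abs_if)
  ultimately have "mode r \<alpha> \<beta> \<bar>\<rho>\<bar>" using ch by (simp add: mode_def power_abs power4_eq_xxxx power2_eq_square mult.assoc)
  then show ?thesis by blast
qed

lemma lin_part_apriori:
  assumes r: "r > 0" and \<beta>: "\<beta> > 0" and nomode: "\<nexists>m. mode r \<alpha> \<beta> m"
  shows "\<exists>C\<ge>0. \<forall>x B k s. x \<in> spaceX r \<longrightarrow> (\<forall>s\<in>{-r..r}. \<bar>lin_part r \<alpha> \<beta> x s\<bar> \<le> B) \<longrightarrow> k \<le> 4 \<longrightarrow> s \<in> {-r..r} \<longrightarrow>
     \<bar>der r k x s\<bar> \<le> C * B"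
proof -
  obtain p q :: complex where pq: "p + q = of_real \<alpha>" "p * q = of_real \<beta>" by (rule exists_complex_roots)
  have nz: "csqrt p \<noteq> 0" "csqrt q \<noteq> 0" using pq(2) \<beta> by auto
  have "p\<^sup>2 - of_real \<alpha> * p + of_real \<beta> = 0" "q\<^sup>2 - of_real \<alpha> * q + of_real \<beta> = 0"
    unfolding pq[symmetric] by (simp_all add: power2_eq_square algebra_simps)
  then have nr: "cos (csqrt p * of_real (r - - r)) \<noteq> 0" "cos (csqrt q * of_real (r - - r)) \<noteq> 0"
    using mode_of_resonance[OF r \<beta>] nomode by blast+
  have rr: "-r \<le> r" using r by simp
  obtain C1 where C1: "C1 \<ge> 0" "\<And>f f1 e B s. forced_oscillator (-r) r (csqrt p) f f1 e B \<Longrightarrow> f r = 0 \<Longrightarrow> s \<in> {-r..r} \<Longrightarrow>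
      norm (f s) \<le> C1 * B \<and> norm (f1 s) \<le> C1 * B"
    using forced_oscillator_bound_nonresonant[OF rr nz(1) nr(1)] by blast
  obtain C2 where C2: "C2 \<ge> 0" "\<And>f f1 e B s. forced_oscillator (-r) r (csqrt q) f f1 e B \<Longrightarrow> f r = 0 \<Longrightarrow> s \<in> {-r..r} \<Longrightarrow>
      norm (f s) \<le> C2 * B \<and> norm (f1 s) \<le> C2 * B"
    using forced_oscillator_bound_nonresonant[OF rr nz(2) nr(2)] by blast
  \<comment> \<open>\<open>D\<close> bounds x and x', \<open>E\<close> bounds x'' and x''' by
    solving the definitions of g and g' for them, and \<open>G\<close> bounds the fourth derivative
    through the equation itself.\<close>
  define D where "D = C2 * C1"
  define E where "E = C1 + norm q * D"
  define G where "G = 1 + \<bar>\<alpha>\<bar> * E + \<beta> * D"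
  have DE: "D \<ge> 0" "E \<ge> 0" "G \<ge> 0" using C1(1) C2(1) \<beta> by (auto simp: D_def E_def G_def)
  show ?thesis
  proof (intro exI[of _ "D + E + G"] conjI allI impI)
    show "D + E + G \<ge> 0" using DE by simp
    fix x B s and k :: nat
    assume x: "x \<in> spaceX r" and B: "\<forall>s\<in>{-r..r}. \<bar>lin_part r \<alpha> \<beta> x s\<bar> \<le> B" and k: "k \<le> 4" and s: "s \<in> {-r..r}"
    have B0: "B \<ge> 0" using B s abs_ge_zero order_trans by blast
    have bc: "x r = 0" "der r 2 x r = 0" using x by (auto simp: spaceX_def)
    note fac = lin_part_factorization[OF x pq, of B]
    have g: "norm (complex_of_real (der r 2 x s) + q * of_real (x s)) \<le> C1 * B \<and>
        norm (complex_of_real (der r 3 x s) + q * of_real (der r 1 x s)) \<le> C1 * B" if "s \<in> {-r..r}" for s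
      using C1(2)[OF fac(1) _ that] B bc by simp
    have x01: "norm (complex_of_real (x s)) \<le> C2 * (C1 * B) \<and> norm (complex_of_real (der r 1 x s)) \<le> C2 * (C1 * B)"
      by (rule C2(2)[OF fac(2) _ s]) (use B g bc in auto)
    then have b0: "\<bar>x s\<bar> \<le> D * B" "\<bar>der r 1 x s\<bar> \<le> D * B" unfolding norm_of_real D_def mult.assoc by blast+
    have sub: "norm a \<le> norm (a + q * b) + norm q * norm b" for a b :: complex
      using norm_triangle_ineq4[of "a + q * b" "q * b"] by (simp add: norm_mult)
    have qb: "norm q * \<bar>x s\<bar> \<le> norm q * (D * B)" "norm q * \<bar>der r 1 x s\<bar> \<le> norm q * (D * B)"
      using b0 by (auto intro!: mult_left_mono)
    have EB: "C1 * B + norm q * (D * B) = E * B" by (simp add: E_def algebra_simps)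
    have b2: "\<bar>der r 2 x s\<bar> \<le> E * B"
      using sub[of "of_real (der r 2 x s)" "of_real (x s)"] g[OF s] qb(1) unfolding norm_of_real EB[symmetric] by linarith
    have b3: "\<bar>der r 3 x s\<bar> \<le> E * B"
      using sub[of "of_real (der r 3 x s)" "of_real (der r 1 x s)"] g[OF s] qb(2) unfolding norm_of_real EB[symmetric] by linarith
    have "\<bar>\<alpha> * der r 2 x s\<bar> \<le> \<bar>\<alpha>\<bar> * (E * B)" "\<bar>\<beta> * x s\<bar> \<le> \<beta> * (D * B)"
      using b0 b2 \<beta> by (auto simp: abs_mult intro!: mult_left_mono)
    moreover have "\<bar>lin_part r \<alpha> \<beta> x s\<bar> \<le> B" using B s by blast
    moreover have "G * B = B + \<bar>\<alpha>\<bar> * (E * B) + \<beta> * (D * B)" by (simp add: G_def algebra_simps)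
    ultimately have b4: "\<bar>der r 4 x s\<bar> \<le> G * B" unfolding lin_part_def by linarith
    have pos: "D * B \<ge> 0" "E * B \<ge> 0" "G * B \<ge> 0" using DE B0 by auto
    have sum: "(D + E + G) * B = D * B + E * B + G * B" by (simp add: algebra_simps)
    from le_4_cases[OF k] show "\<bar>der r k x s\<bar> \<le> (D + E + G) * B"
    proof (elim disjE)
      assume "k = 0" then show ?thesis using b0(1) pos unfolding sum by simp
    next
      assume "k = 1" then show ?thesis using b0(2) pos unfolding sum by (simp only:)
    next
      assume "k = 2" then show ?thesis using b2 pos unfolding sum by (simp only:)
    next
      assume "k = 3" then show ?thesis using b3 pos unfolding sum by (simp only:)
    next
      assume "k = 4" then show ?thesis using b4 pos unfolding sum by (simp only:)
    qed
  qed
qed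

section \<open>Triviality and dimension of the kernel\<close>

lemma nomode_kernelN:
  assumes "r > 0" "\<beta> > 0" "\<nexists>m. mode r \<alpha> \<beta> m"
  shows "kernelN r \<alpha> \<beta> = {0}"
proof -
  obtain C where C: "\<And>x B k s. x \<in> spaceX r \<Longrightarrow> (\<forall>s\<in>{-r..r}. \<bar>lin_part r \<alpha> \<beta> x s\<bar> \<le> B) \<Longrightarrow> k \<le> 4 \<Longrightarrow> s \<in> {-r..r} \<Longrightarrow>
     \<bar>der r k x s\<bar> \<le> C * B"
    using lin_part_apriori[OF assms] by blast
  have "x = 0" if x: "x \<in> kernelN r \<alpha> \<beta>" for x
  proof (rule kernelN_determined[OF assms(1,2) x])
    have xX: "x \<in> spaceX r" and L: "\<forall>s\<in>{-r..r}. \<bar>lin_part r \<alpha> \<beta> x s\<bar> \<le> 0"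
      using x by (auto simp: kernelN_def lin_part_def)
    have "-r \<in> {-r..r}" using assms(1) by simp
    from C[OF xX L _ this, of 0] C[OF xX L _ this, of 2] show "x (-r) = 0" "der r 2 x (-r) = 0" by auto
  qed
  moreover have "0 \<in> kernelN r \<alpha> \<beta>" by (rule subspace_0[OF subspace_kernelN[OF assms(1)]])
  ultimately show ?thesis by blast
qed

lemma mode_kernelN:
  assumes r: "r > 0" and m: "mode r \<alpha> \<beta> m"
  shows "kernelN r \<alpha> \<beta> \<noteq> {0}"
proof -
  have m0: "m > 0" "cos (2 * r * m) = 0" and ch: "m ^ 4 - \<alpha> * m\<^sup>2 + \<beta> = 0" using m by (auto simp: mode_def)
  have PP: "prim2 (prim2 cos) = cos" using prim2_lincomb[OF cos_sym_cos cos_sym_cos, of "-1" 0] by (simp add: prim2_cos)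
  have Wc: "chain cos 0 = cos" "chain cos 2 = (\<lambda>u. - cos u)" "chain cos 4 = cos"
    unfolding chain_simps by (rule PP prim2_cos refl)+
  have "der r 4 (profile r m cos) s + \<alpha> * der r 2 (profile r m cos) s + \<beta> * profile r m cos s = 0" if "s \<in> {-r..r}" for s
  proof -
    have d: "der r k (profile r m cos) s = m ^ k * chain cos k (m * (s + r))" if "k \<le> 4" for k
      using der_profile[OF r cos_sym_cos that, of m] \<open>s \<in> {-r..r}\<close> by (simp add: zero_ext_def rescaled_def)
    have "der r 4 (profile r m cos) s + \<alpha> * der r 2 (profile r m cos) s + \<beta> * profile r m cos s = (m ^ 4 - \<alpha> * m\<^sup>2 + \<beta>) * cos (m * (s + r))"
      using d[of 4] d[of 2] d[of 0] by (simp add: Wc algebra_simps del: funpow.simps(2))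
    then show ?thesis using ch by simp
  qed
  then have "profile r m cos \<in> kernelN r \<alpha> \<beta>"
    using profile_spaceX[OF r cos_sym_cos m0(2)] by (simp add: kernelN_def del: funpow.simps)
  moreover have "profile r m cos \<noteq> 0" using profile_nonzero[OF r cos_sym_cos, of 1 m] m0 by simp
  ultimately show ?thesis by blast
qed

lemma independent_triple:
  fixes B :: "'a::real_vector set"
  assumes B: "independent B" "{x, y, z} \<subseteq> B" "x \<noteq> y" "x \<noteq> z" "y \<noteq> z"
    and eq: "a *\<^sub>R x + b *\<^sub>R y + c *\<^sub>R z = 0"
  shows "a = 0 \<and> b = 0 \<and> c = 0"
proof -
  define u where "u = (\<lambda>v. if v = x then a else if v = y then b else c)"
  have "(\<Sum>v\<in>{x, y, z}. u v *\<^sub>R v) = 0" using assms by (simp add: u_def add.assoc)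
  then have "\<forall>v\<in>{x, y, z}. u v = 0" using independentD[OF B(1) _ B(2), of u] by blast
  then show ?thesis using B by (auto simp: u_def)
qed

text \<open>Serves to rule out an infinite basis: two functionals with trivial common kernel do not
  admit three independent vectors.\<close>

lemma two_functionals_finite_independent:
  fixes V B :: "'a::real_vector set" and f g :: "'a \<Rightarrow> real"
  assumes V: "subspace V"
    and f: "\<And>x y. x \<in> V \<Longrightarrow> y \<in> V \<Longrightarrow> f (x + y) = f x + f y" "\<And>c x. x \<in> V \<Longrightarrow> f (c *\<^sub>R x) = c * f x"
    and g: "\<And>x y. x \<in> V \<Longrightarrow> y \<in> V \<Longrightarrow> g (x + y) = g x + g y" "\<And>c x. x \<in> V \<Longrightarrow> g (c *\<^sub>R x) = c * g x"
    and inj: "\<And>x. x \<in> V \<Longrightarrow> f x = 0 \<Longrightarrow> g x = 0 \<Longrightarrow> x = 0"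
    and B: "independent B" "B \<subseteq> V"
  shows "finite B"
proof (rule ccontr)
  assume "infinite B"
  then obtain S where "S \<subseteq> B" "card S = 3" by (meson infinite_arbitrarily_large)
  then obtain x y z where xyz: "{x, y, z} \<subseteq> B" "x \<noteq> y" "x \<noteq> z" "y \<noteq> z"
    by (auto simp: card_3_iff)
  then have v: "x \<in> V" "y \<in> V" "z \<in> V" using B by auto
  have comb: "a = 0 \<and> b = 0 \<and> c = 0" if "a * f x + b * f y + c * f z = 0" "a * g x + b * g y + c * g z = 0" for a b c
  proof (rule independent_triple[OF B(1) xyz])
    have m: "a *\<^sub>R x \<in> V" "b *\<^sub>R y \<in> V" "c *\<^sub>R z \<in> V" "a *\<^sub>R x + b *\<^sub>R y \<in> V" "a *\<^sub>R x + b *\<^sub>R y + c *\<^sub>R z \<in> V"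
      using V v by (auto intro!: subspace_add subspace_scale)
    show "a *\<^sub>R x + b *\<^sub>R y + c *\<^sub>R z = 0"
      by (rule inj[OF m(5)]) (use that in \<open>simp_all add: f g m v\<close>)
  qed
  \<comment> \<open>The 2x2 minors of the values at \<open>x, y, z\<close> are the coefficients of a linear dependence.\<close>
  have "f x * g y - f y * g x = 0"
    using comb[of "f y * g z - f z * g y" "f z * g x - f x * g z" "f x * g y - f y * g x"] by (simp add: algebra_simps)
  \<comment> \<open>With this minor zero, f(y) x - f(x) y and g(y) x - g(x) y are annihilated by
    both functionals, so their coefficients vanish.\<close>
  then have "f x = 0" "g x = 0"
    using comb[of "f y" "- f x" 0] comb[of "g y" "- g x" 0] by (simp_all add: algebra_simps)
  then have "x = 0" using inj v by blast
  then show False using B xyz dependent_zero by blast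
qed

text \<open>An infinite basis would also have \<open>card\<close> 0, so a basis must first be shown
  finite; the functionals are the values of x and x'' at -r.\<close>

lemma dim_kernelN_eq_0:
  assumes r: "r > 0" and \<beta>: "\<beta> > 0"
  shows "dim (kernelN r \<alpha> \<beta>) = 0 \<longleftrightarrow> kernelN r \<alpha> \<beta> = {0}"
proof
  assume d: "dim (kernelN r \<alpha> \<beta>) = 0"
  obtain B where B: "B \<subseteq> kernelN r \<alpha> \<beta>" "independent B" "kernelN r \<alpha> \<beta> \<subseteq> span B" "card B = dim (kernelN r \<alpha> \<beta>)"
    using basis_exists by blast
  have C: "x \<in> Ck r 4" if "x \<in> kernelN r \<alpha> \<beta>" for x using that by (simp add: kernelN_def spaceX_def)
  have "finite B"
  proof (rule two_functionals_finite_independent[where f = "\<lambda>x. x (-r)" and g = "\<lambda>x. der r 2 x (-r)"])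
    show "subspace (kernelN r \<alpha> \<beta>)" by (rule subspace_kernelN[OF r])
    show "der r 2 (x + y) (-r) = der r 2 x (-r) + der r 2 y (-r)" if "x \<in> kernelN r \<alpha> \<beta>" "y \<in> kernelN r \<alpha> \<beta>" for x y
      using der_add[OF r C[OF that(1)] C[OF that(2)], of 2] by simp
    show "der r 2 (c *\<^sub>R x) (-r) = c * der r 2 x (-r)" if "x \<in> kernelN r \<alpha> \<beta>" for x c
      using der_scaleR[OF r C[OF that], of 2 c] by (simp add: scaleR_fun_def)
    show "x = 0" if "x \<in> kernelN r \<alpha> \<beta>" "x (-r) = 0" "der r 2 x (-r) = 0" for x
      by (rule kernelN_determined[OF r \<beta> that])
  qed (use B in \<open>auto simp: scaleR_fun_def\<close>)
  then have "B = {}" using B(4) d by simp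
  then show "kernelN r \<alpha> \<beta> = {0}" using B(3) subspace_0[OF subspace_kernelN[OF r]] by auto
next
  assume "kernelN r \<alpha> \<beta> = {0}"
  then show "dim (kernelN r \<alpha> \<beta>) = 0"
    using dim_unique[of "{}" "{0 :: real \<Rightarrow> real}" 0] independent_empty by simp
qed

section \<open>Exclusion of small solutions when there is no mode\<close>

lemma normX_le:
  assumes "\<And>k s. k \<le> 4 \<Longrightarrow> s \<in> {-r..r} \<Longrightarrow> \<bar>der r k x s\<bar> \<le> D" "r > 0"
  shows "normX r x \<le> 5 * D"
proof -
  have "normX r x \<le> (\<Sum>k=0..4::nat. D)"
    unfolding normX_def using assms by (intro sum_mono cSUP_least) auto
  then show ?thesis by simp
qed

lemma der_le_normX:
  assumes "r > 0" "x \<in> spaceX r" "k \<le> 4" "s \<in> {-r..r}"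
  shows "\<bar>der r k x s\<bar> \<le> normX r x"
proof -
  note C = spaceX_Ck[OF assms(2)]
  have "\<bar>der r k x s\<bar> \<le> (SUP s\<in>{-r..r}. \<bar>der r k x s\<bar>)" by (rule der_SUP_upper[OF C assms(3,4)])
  also have "\<dots> \<le> normX r x"
    unfolding normX_def by (rule member_le_sum) (use assms der_SUP_nonneg[OF assms(1) C] in auto)
  finally show ?thesis .
qed

lemma abs_sum7_le:
  fixes t1 t2 t3 t4 t5 t6 t7 D E G :: real
  assumes "\<bar>t1\<bar> \<le> D" "\<bar>t2\<bar> \<le> D" "\<bar>t3\<bar> \<le> E" "\<bar>t4\<bar> \<le> D" "\<bar>t5\<bar> \<le> D" "\<bar>t6\<bar> \<le> D" "\<bar>t7\<bar> \<le> G"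
  shows "\<bar>t1 + t2 + t3 + 3 * t4 + 12 * t5 + 3 * t6 - t7\<bar> \<le> D + D + E + 3 * D + 12 * D + 3 * D + G"
  using assms unfolding abs_le_iff by linarith

text \<open>Freezing the linear part at the base parameters leaves parameter errors of size \<delta>
  n and cubic terms of size n^3 <= \<delta> n. Their constants add up to 45/2 + \<gamma>0 + (3/2)
  \<alpha>0, which is rounded up.\<close>

lemma lin_part_bound_of_solution:
  fixes n \<delta> :: real
  assumes x: "\<bar>x0\<bar> \<le> n" "\<bar>x1\<bar> \<le> n" "\<bar>x2\<bar> \<le> n" "\<bar>x3\<bar> \<le> n" "\<bar>x4\<bar> \<le> n" and n: "n \<le> \<delta>" and \<delta>: "\<delta> \<le> 1"
    and par: "\<bar>\<alpha> - \<alpha>0\<bar> \<le> \<delta>" "\<bar>\<beta> - \<beta>0\<bar> \<le> \<delta>" "\<bar>\<gamma> - \<gamma>0\<bar> \<le> \<delta>" and pos: "\<alpha>0 > 0" "\<gamma>0 > 0"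
    and eq: "x4 + \<alpha> * x2 + \<beta> * x0 - \<gamma> * x0 ^ 3 - 3 * x2 ^ 3 - 12 * x1 * x2 * x3 - 3 * x1\<^sup>2 * (x4 - \<alpha> / 2 * x2) = 0"
  shows "\<bar>x4 + \<alpha>0 * x2 + \<beta>0 * x0\<bar> \<le> (23 + \<gamma>0 + 2 * \<alpha>0) * (\<delta> * n)"
proof -
  have n0: "0 \<le> n" using x(1) by linarith
  have "n * n * n \<le> \<delta> * 1 * n" using n \<delta> n0 by (intro mult_mono) auto
  then have n3: "n * n * n \<le> \<delta> * n" by simp
  have T: "\<bar>a * b * c\<bar> \<le> \<delta> * n" if "\<bar>a\<bar> \<le> n" "\<bar>b\<bar> \<le> n" "\<bar>c\<bar> \<le> n" for a b c
    using abs_mult3_le[OF that] n3 by linarith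
  have g: "\<bar>\<gamma>\<bar> \<le> \<gamma>0 + 1" "\<bar>3/2 * \<alpha>\<bar> \<le> 3/2 * \<alpha>0 + 3/2" using par pos \<delta> by linarith+
  have 1: "\<bar>(\<alpha>0 - \<alpha>) * x2\<bar> \<le> \<delta> * n" "\<bar>(\<beta>0 - \<beta>) * x0\<bar> \<le> \<delta> * n"
    using mult_mono[OF par(1) x(3)] mult_mono[OF par(2) x(1)] n n0 by (simp_all add: abs_mult abs_minus_commute)
  have 2: "\<bar>\<gamma> * (x0 * x0 * x0)\<bar> \<le> (\<gamma>0 + 1) * (\<delta> * n)" 
    unfolding abs_mult[of \<gamma>] using T[OF x(1,1,1)] g(1) pos by (intro mult_mono) auto
  have 3: "\<bar>3/2 * \<alpha> * (x1 * x1 * x2)\<bar> \<le> (3/2 * \<alpha>0 + 3/2) * (\<delta> * n)" 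
    unfolding abs_mult[of "3/2 * \<alpha>"] using T[OF x(2,2,3)] g(2) pos by (intro mult_mono) auto
  have 4: "\<bar>x2 * x2 * x2\<bar> \<le> \<delta> * n" "\<bar>x1 * x2 * x3\<bar> \<le> \<delta> * n" "\<bar>x1 * x1 * x4\<bar> \<le> \<delta> * n"
    by (intro T x)+
  have "x4 + \<alpha>0 * x2 + \<beta>0 * x0 = (\<alpha>0 - \<alpha>) * x2 + (\<beta>0 - \<beta>) * x0 + \<gamma> * (x0 * x0 * x0) + 3 * (x2 * x2 * x2)
      + 12 * (x1 * x2 * x3) + 3 * (x1 * x1 * x4) - 3/2 * \<alpha> * (x1 * x1 * x2)"
    using eq by (simp add: algebra_simps power2_eq_square power3_eq_cube)
  then have "\<bar>x4 + \<alpha>0 * x2 + \<beta>0 * x0\<bar> \<le> \<delta> * n + \<delta> * n + (\<gamma>0 + 1) * (\<delta> * n) + 3 * (\<delta> * n) + 12 * (\<delta> * n) + 3 * (\<delta> * n)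
      + (3/2 * \<alpha>0 + 3/2) * (\<delta> * n)"
    using abs_sum7_le[OF 1 2 4 3] by (simp only:)
  also have "\<dots> = (45/2 + \<gamma>0 + 3/2 * \<alpha>0) * (\<delta> * n)" by (simp add: algebra_simps)
  also have "\<dots> \<le> (23 + \<gamma>0 + 2 * \<alpha>0) * (\<delta> * n)"
    using pos n n0 by (intro mult_right_mono) auto
  finally show ?thesis .
qed

lemma nomode_not_bifurcation:
  assumes r: "r > 0" and pos: "\<alpha> > 0" "\<beta> > 0" "\<gamma> > 0" and nomode: "\<nexists>m. mode r \<alpha> \<beta> m"
  shows "\<not> bifurcation_point r (0, \<alpha>, \<beta>, \<gamma>)"
proof
  assume bif: "bifurcation_point r (0, \<alpha>, \<beta>, \<gamma>)"
  obtain C where C0: "C \<ge> 0" and C: "\<And>x B k s. x \<in> spaceX r \<Longrightarrow> (\<forall>s\<in>{-r..r}. \<bar>lin_part r \<alpha> \<beta> x s\<bar> \<le> B) \<Longrightarrow> k \<le> 4 \<Longrightarrow> s \<in> {-r..r} \<Longrightarrow>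
     \<bar>der r k x s\<bar> \<le> C * B"
    using lin_part_apriori[OF r pos(2) nomode] by blast
  interpret M: Metric_space "spaceX r" "distX r" by (rule Metric_space_X[OF r])
  define M where "M = 23 + \<gamma> + 2 * \<alpha>"
  have M: "M > 0" using pos by (simp add: M_def)
  \<comment> \<open>Chosen so that the norm of a solution would be at most 5 C M \<delta> < 1 times
    itself; 5 counts the derivatives in \<open>normX\<close>, and the summand 2 also ensures
    \<delta> <= 1.\<close>
  define \<delta> where "\<delta> = 1 / (5 * C * M + 2)"
  have CM: "5 * C * M \<ge> 0" using C0 M by simp
  have \<delta>: "\<delta> > 0" "\<delta> \<le> 1" "5 * C * M * \<delta> < 1" using CM by (auto simp: \<delta>_def field_simps)
  define U where "U = M.mball 0 \<delta> \<times> (Rpos3 \<inter> (ball \<alpha> \<delta> \<times> ball \<beta> \<delta> \<times> ball \<gamma> \<delta>))"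
  have z: "0 \<in> spaceX r" by (rule subspace_0[OF subspace_spaceX[OF r]])
  have "openin (top_total r) U"
    unfolding U_def top_total_def topX_def openin_prod_Times_iff
    by (intro disjI2 conjI M.openin_mball openin_open_Int open_Times open_ball)
  moreover have "(0, \<alpha>, \<beta>, \<gamma>) \<in> U" using z \<delta> pos by (simp add: U_def Rpos3_def)
  ultimately obtain Q where Q: "Q \<in> U" "nontrivial_solution r Q"
    using bif unfolding bifurcation_point_def by blast
  obtain x a b c where Qe: "Q = (x, a, b, c)" by (cases Q) auto
  have x: "x \<in> spaceX r" and F: "opF r x a b c = 0" and xnz: "x \<noteq> 0"
    using Q(2) unfolding Qe nontrivial_solution_def is_solution_def trivial_family_def by auto
  have "distX r 0 x < \<delta>" using Q(1) unfolding Qe U_def by simp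
  then have n: "normX r x < \<delta>" using x z M.commute[of 0 x] by (simp add: distX_def)
  have par: "\<bar>a - \<alpha>\<bar> \<le> \<delta>" "\<bar>b - \<beta>\<bar> \<le> \<delta>" "\<bar>c - \<gamma>\<bar> \<le> \<delta>"
    using Q(1) unfolding Qe U_def by (auto simp: dist_real_def)
  have "\<bar>lin_part r \<alpha> \<beta> x s\<bar> \<le> M * (\<delta> * normX r x)" if s: "s \<in> {-r..r}" for s
    unfolding lin_part_def M_def
  proof (rule lin_part_bound_of_solution[OF _ _ _ _ _ less_imp_le[OF n] \<delta>(2) par pos(1,3)])
    show "\<bar>x s\<bar> \<le> normX r x" using der_le_normX[OF r x _ s, of 0] by simp
    show "\<bar>der r 1 x s\<bar> \<le> normX r x" "\<bar>der r 2 x s\<bar> \<le> normX r x" "\<bar>der r 3 x s\<bar> \<le> normX r x" "\<bar>der r 4 x s\<bar> \<le> normX r x"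
      by (rule der_le_normX[OF r x _ s], simp)+
    show "der r 4 x s + a * der r 2 x s + b * x s - c * x s ^ 3 - 3 * der r 2 x s ^ 3 - 12 * der r 1 x s * der r 2 x s * der r 3 x s -
       3 * (der r 1 x s)\<^sup>2 * (der r 4 x s - a / 2 * der r 2 x s) = 0"
      using fun_cong[OF F, of s] by (simp only: opF_def zero_fun_def)
  qed
  then have "\<bar>der r k x s\<bar> \<le> C * (M * (\<delta> * normX r x))" if "k \<le> 4" "s \<in> {-r..r}" for k s
    using C[OF x _ that] by blast
  then have "normX r x \<le> 5 * (C * (M * (\<delta> * normX r x)))" by (rule normX_le[OF _ r])
  also have "\<dots> = (5 * C * M * \<delta>) * normX r x" by simp
  finally have le: "normX r x \<le> (5 * C * M * \<delta>) * normX r x" .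
  have "normX r x = 0"
  proof (rule ccontr)
    assume "normX r x \<noteq> 0"
    then have "normX r x > 0" using normX_nonneg[OF r x] by simp
    then have "(5 * C * M * \<delta>) * normX r x < 1 * normX r x" using \<delta>(3) by (intro mult_strict_right_mono)
    then show False using le by simp
  qed
  then show False using normX_eq_0_iff[OF r x] xnz by simp
qed

lemma branching_point_iff:
  assumes r: "r > 0" and pos: "\<alpha> > 0" "\<beta> > 0" "\<gamma> > 0"
  shows "branching_point r (0, \<alpha>, \<beta>, \<gamma>) \<longleftrightarrow> dim (kernelN r \<alpha> \<beta>) \<noteq> 0"
proof (cases "\<exists>m. mode r \<alpha> \<beta> m")
  case True
  then obtain m where m: "mode r \<alpha> \<beta> m" "solvable_ratio (\<beta> / m ^ 4)"
    using mode_exists_solvable_ratio[OF r pos(2)] by blast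
  show ?thesis
    using mode_branching[OF r pos m] mode_kernelN[OF r m(1)] dim_kernelN_eq_0[OF r pos(2)] by simp
next
  case False
  have "\<not> branching_point r (0, \<alpha>, \<beta>, \<gamma>)"
    using nomode_not_bifurcation[OF r pos False] by (simp add: branching_point_def)
  then show ?thesis using nomode_kernelN[OF r pos(2) False] dim_kernelN_eq_0[OF r pos(2), of \<alpha>] by simp
qed

theorem theorem2p1:
  fixes r :: real
  assumes "r > 0"
  shows "\<forall>\<alpha>\<^sub>0 \<beta>\<^sub>0 \<gamma>\<^sub>0. (\<alpha>\<^sub>0, \<beta>\<^sub>0, \<gamma>\<^sub>0) \<in> Rpos3 \<longrightarrow>
           (branching_point r (0, \<alpha>\<^sub>0, \<beta>\<^sub>0, \<gamma>\<^sub>0) \<longleftrightarrow> dim (kernelN r \<alpha>\<^sub>0 \<beta>\<^sub>0) \<noteq> 0)"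
  using branching_point_iff[OF assms] by (simp add: Rpos3_def)

end
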